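(* Let $f\in L^\infty(\Omega)$ be nonnegative. Suppose that there exists an open set $\omega\subset\subset\Omega$ such that $f=0$ in $\Omega\setminus\omega$, and such that for every $\omega'\subset\subset\omega$ there exists $c_{\omega'}>0$ with $f\ge c_{\omega'}$ in $\omega'$. For each integer $n\ge 2$ let $u_n$ be the distributional solution (obtained by monotone approximation, see context) of $$-\mathrm{div}(M(x)\nabla u_n)=\frac{f(x)}{u_n^{n}}\ \text{ in }\Omega,\qquad u_n=0\ \text{ on }\partial\Omega.$$ Then: (1) $\{u_n\}$ is bounded in $L^\infty(\Omega)$, so that, up to subsequences, it converges (weakly-$*$ in $L^\infty(\Omega)$) to a bounded function $u$, and $u$ is identically equal to $1$ almost everywhere in $\omega$. (2) The sequence $\{f(x)/u_n^{n}\}$ is bounded in $L^1(\Omega)$, and if $\mu$ is the $*$-weak limit in the sense of measures of $f(x)/u_n^{n}$ (along a subsequence along which $u_n$ converges to $u$), then $\mu$ is concentrated on $\partial\omega$, and $u$ belongs to $W^{1,2}_0(\Omega)$ and is the solution of $$-\mathrm{div}(M(x)\nabla u)=\mu\ \text{ in }\Omega,\qquad u=0\ \text{ on }\partial\Omega,$$ in the sense that $\int_\Omega M(x)\nabla u\cdot\nabla\varphi=\int_\Omega\varphi\,d\mu$ for every $\varphi\in C^1_c(\Omega)$.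
   Context: $\Omega$ is an open bounded subset of $\mathbb{R}^N$, $N\ge1$. $A\subset\subset B$ means that $A$ is open and its closure is a compact subset of the open set $B$. $M(x)$ is a (measurable) matrix-valued function such that, for some constants $0<\alpha\le\beta$, for almost every $x\in\Omega$ and every $\xi\in\mathbb{R}^N$: $M(x)\xi\cdot\xi\ge\alpha|\xi|^2$ and $|M(x)|\le\beta$. Let $\gamma>1$ and let $f\in L^\infty(\Omega)$ be nonnegative and not identically zero. A distributional solution of $-\mathrm{div}(M(x)\nabla u)=f/u^\gamma$ in $\Omega$, $u>0$ in $\Omega$, $u=0$ on $\partial\Omega$, is a function $u\in W^{1,1}_{loc}(\Omega)$ with $u^{\frac{\gamma+1}{2}}\in W^{1,1}_0(\Omega)$ such that for every $\omega\subset\subset\Omega$ there is $c_{\omega,\gamma}>0$ with $u\ge c_{\omega,\gamma}$ in $\omega$, and $\int_\Omega M(x)\nabla u\cdot\nabla\varphi=\int_\Omega\frac{f\varphi}{u^\gamma}$ for all $\varphi\in C^1_c(\Omega)$. The distributional solution obtained by monotone approximation is the pointwise limit $u=\lim_{m\to\infty}u_m$ of the increasing sequence of nonnegative weak solutions $u_m\in W^{1,2}_0(\Omega)\cap L^\infty(\Omega)$ of $-\mathrm{div}(M(x)\nabla u_m)=\frac{f}{(u_m+\frac1m)^\gamma}$ in $\Omega$, $u_m=0$ on $\partial\Omega$, $m\in\mathbb{N}$; it belongs to $W^{1,2}_{loc}(\Omega)\cap L^\infty(\Omega)$. In the claim $\gamma=n$. *)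

theory Defs
  imports "HOL-Analysis.Analysis"
begin

text \<open>
  Functions on an open set are total functions of which only the values on that set matter,
  up to Lebesgue-null sets. Test functions are the exception: they are already extended by
  zero to the whole space.
\<close>

definition compactly_inside :: "'a::topological_space set \<Rightarrow> 'a set \<Rightarrow> bool" (infix \<open>\<Subset>\<close> 50)
  where "A \<Subset> B \<longleftrightarrow> open A \<and> open B \<and> compact (closure A) \<and> closure A \<subseteq> B"

subsection \<open>Lebesgue spaces\<close>

definition Lp :: "real \<Rightarrow> 'a::euclidean_space set \<Rightarrow> ('a \<Rightarrow> 'b::real_normed_vector) set"
  where "Lp p \<Omega> = {u \<in> borel_measurable (lebesgue_on \<Omega>).
                     integrable (lebesgue_on \<Omega>) (\<lambda>x. norm (u x) powr p)}"

definition Lp_loc :: "real \<Rightarrow> 'a::euclidean_space set \<Rightarrow> ('a \<Rightarrow> 'b::real_normed_vector) set"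
  where "Lp_loc p \<Omega> = {u. \<forall>K. compact K \<and> K \<subseteq> \<Omega> \<longrightarrow> u \<in> Lp p K}"

definition Linf :: "'a::euclidean_space set \<Rightarrow> ('a \<Rightarrow> real) set"
  where "Linf \<Omega> = {u \<in> borel_measurable (lebesgue_on \<Omega>).
                    \<exists>C. AE x in lebesgue_on \<Omega>. \<bar>u x\<bar> \<le> C}"

definition weak_star_Linf :: "'a::euclidean_space set \<Rightarrow> (nat \<Rightarrow> 'a \<Rightarrow> real) \<Rightarrow> ('a \<Rightarrow> real) \<Rightarrow> bool"
  where "weak_star_Linf \<Omega> v u \<longleftrightarrow> (\<forall>k. v k \<in> Linf \<Omega>) \<and> u \<in> Linf \<Omega> \<and>
    (\<forall>g \<in> Lp 1 \<Omega>. (\<lambda>k. \<integral>x. v k x * g x \<partial>lebesgue_on \<Omega>)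
                       \<longlonglongrightarrow> (\<integral>x. u x * g x \<partial>lebesgue_on \<Omega>))"

subsection \<open>Test functions\<close>

definition Cc :: "'a::euclidean_space set \<Rightarrow> ('a \<Rightarrow> real) set"
  where "Cc \<Omega> = {\<phi>. continuous_on UNIV \<phi> \<and>
                   compact (closure {x. \<phi> x \<noteq> 0}) \<and> closure {x. \<phi> x \<noteq> 0} \<subseteq> \<Omega>}"

definition grad :: "(real^'N \<Rightarrow> real) \<Rightarrow> real^'N \<Rightarrow> real^'N"
  where "grad \<phi> x = (\<chi> i. frechet_derivative \<phi> (at x) (axis i 1))"

definition C1c :: "(real^'N) set \<Rightarrow> (real^'N \<Rightarrow> real) set"
  where "C1c \<Omega> = {\<phi> \<in> Cc \<Omega>. (\<forall>x. \<phi> differentiable (at x)) \<and> continuous_on UNIV (grad \<phi>)}"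

subsection \<open>Sobolev spaces\<close>

text \<open>Testing with \<open>C\<^sup>1\<close> rather than smooth functions of compact support gives the same weak
  gradients and the same \<open>W\<^sub>0\<close> spaces, by mollification.\<close>

definition has_weak_grad :: "(real^'N) set \<Rightarrow> (real^'N \<Rightarrow> real) \<Rightarrow> (real^'N \<Rightarrow> real^'N) \<Rightarrow> bool"
  where "has_weak_grad \<Omega> u g \<longleftrightarrow> u \<in> Lp_loc 1 \<Omega> \<and> g \<in> Lp_loc 1 \<Omega> \<and>
    (\<forall>\<phi> \<in> C1c \<Omega>. (\<integral>x. u x *\<^sub>R grad \<phi> x \<partial>lebesgue_on \<Omega>)
                  = - (\<integral>x. \<phi> x *\<^sub>R g x \<partial>lebesgue_on \<Omega>))"

text \<open>On an open set the weak gradient is unique almost everywhere, so the choice of the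
  representative does not affect integrals.\<close>

definition weak_grad :: "(real^'N) set \<Rightarrow> (real^'N \<Rightarrow> real) \<Rightarrow> real^'N \<Rightarrow> real^'N"
  where "weak_grad \<Omega> u = (SOME g. has_weak_grad \<Omega> u g)"

definition W1p :: "real \<Rightarrow> (real^'N) set \<Rightarrow> (real^'N \<Rightarrow> real) set"
  where "W1p p \<Omega> = {u \<in> Lp p \<Omega>. \<exists>g \<in> Lp p \<Omega>. has_weak_grad \<Omega> u g}"

definition W1p_loc :: "real \<Rightarrow> (real^'N) set \<Rightarrow> (real^'N \<Rightarrow> real) set"
  where "W1p_loc p \<Omega> = {u \<in> Lp_loc p \<Omega>. \<exists>g \<in> Lp_loc p \<Omega>. has_weak_grad \<Omega> u g}"

text \<open>The closure of \<open>C1c \<Omega>\<close> in \<open>W1p p \<Omega>\<close>.\<close>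

definition W1p_0 :: "real \<Rightarrow> (real^'N) set \<Rightarrow> (real^'N \<Rightarrow> real) set"
  where "W1p_0 p \<Omega> = {u \<in> W1p p \<Omega>. \<exists>\<phi>. (\<forall>k. \<phi> k \<in> C1c \<Omega>) \<and>
    (\<lambda>k. \<integral>x. \<bar>u x - \<phi> k x\<bar> powr p \<partial>lebesgue_on \<Omega>) \<longlonglongrightarrow> 0 \<and>
    (\<lambda>k. \<integral>x. norm (weak_grad \<Omega> u x - grad (\<phi> k) x) powr p \<partial>lebesgue_on \<Omega>) \<longlonglongrightarrow> 0}"

subsection \<open>The singular problem\<close>

text \<open>The norm of a matrix is the Euclidean norm of its entries; the choice of norm only
  affects the value of \<open>\<beta>\<close>.\<close>

definition elliptic_matrix :: "(real^'N) set \<Rightarrow> real \<Rightarrow> real \<Rightarrow> (real^'N \<Rightarrow> real^'N^'N) \<Rightarrow> bool"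
  where "elliptic_matrix \<Omega> \<alpha> \<beta> M \<longleftrightarrow> 0 < \<alpha> \<and> \<alpha> \<le> \<beta> \<and> M \<in> borel_measurable (lebesgue_on \<Omega>) \<and>
    (AE x in lebesgue_on \<Omega>. (\<forall>\<xi>. (M x *v \<xi>) \<bullet> \<xi> \<ge> \<alpha> * (norm \<xi>)\<^sup>2) \<and> norm (M x) \<le> \<beta>)"

definition distributional_solution ::
    "(real^'N) set \<Rightarrow> (real^'N \<Rightarrow> real^'N^'N) \<Rightarrow> (real^'N \<Rightarrow> real) \<Rightarrow> real \<Rightarrow> (real^'N \<Rightarrow> real) \<Rightarrow> bool"
  where "distributional_solution \<Omega> M f \<gamma> u \<longleftrightarrow>
    u \<in> W1p_loc 1 \<Omega> \<and>
    (\<lambda>x. u x powr ((\<gamma> + 1) / 2)) \<in> W1p_0 1 \<Omega> \<and>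
    (\<forall>\<omega>. \<omega> \<Subset> \<Omega> \<longrightarrow> (\<exists>c>0. AE x in lebesgue_on \<omega>. u x \<ge> c)) \<and>
    (\<forall>\<phi> \<in> C1c \<Omega>. (\<integral>x. (M x *v weak_grad \<Omega> u x) \<bullet> grad \<phi> x \<partial>lebesgue_on \<Omega>)
                  = (\<integral>x. f x * \<phi> x / u x powr \<gamma> \<partial>lebesgue_on \<Omega>))"

definition approximate_solution ::
    "(real^'N) set \<Rightarrow> (real^'N \<Rightarrow> real^'N^'N) \<Rightarrow> (real^'N \<Rightarrow> real) \<Rightarrow> real \<Rightarrow> nat \<Rightarrow> (real^'N \<Rightarrow> real) \<Rightarrow> bool"
  where "approximate_solution \<Omega> M f \<gamma> m v \<longleftrightarrow>
    v \<in> W1p_0 2 \<Omega> \<and> v \<in> Linf \<Omega> \<and> (AE x in lebesgue_on \<Omega>. v x \<ge> 0) \<and>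
    (\<forall>\<phi> \<in> W1p_0 2 \<Omega>. (\<integral>x. (M x *v weak_grad \<Omega> v x) \<bullet> weak_grad \<Omega> \<phi> x \<partial>lebesgue_on \<Omega>)
                  = (\<integral>x. f x * \<phi> x / (v x + 1 / real m) powr \<gamma> \<partial>lebesgue_on \<Omega>))"

definition monotone_approximation_solution ::
    "(real^'N) set \<Rightarrow> (real^'N \<Rightarrow> real^'N^'N) \<Rightarrow> (real^'N \<Rightarrow> real) \<Rightarrow> real \<Rightarrow> (real^'N \<Rightarrow> real) \<Rightarrow> bool"
  where "monotone_approximation_solution \<Omega> M f \<gamma> u \<longleftrightarrow>
    distributional_solution \<Omega> M f \<gamma> u \<and>
    (\<exists>v. (\<forall>m\<ge>1. approximate_solution \<Omega> M f \<gamma> m (v m)) \<and>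
         (\<forall>m\<ge>1. AE x in lebesgue_on \<Omega>. v m x \<le> v (Suc m) x) \<and>
         (AE x in lebesgue_on \<Omega>. (\<lambda>m. v m x) \<longlonglongrightarrow> u x))"

subsection \<open>Measures\<close>

text \<open>A finite Borel measure on an open subset of a Euclidean space is a Radon measure. Limits of
  nonnegative functions are nonnegative, so signed measures are not needed.\<close>

definition weak_star_measure ::
    "'a::euclidean_space set \<Rightarrow> (nat \<Rightarrow> 'a \<Rightarrow> real) \<Rightarrow> 'a measure \<Rightarrow> bool"
  where "weak_star_measure \<Omega> g \<mu> \<longleftrightarrow>
    sets \<mu> = sets (restrict_space borel \<Omega>) \<and> finite_measure \<mu> \<and>
    (\<forall>\<phi> \<in> Cc \<Omega>. (\<lambda>k. \<integral>x. g k x * \<phi> x \<partial>lebesgue_on \<Omega>) \<longlonglongrightarrow> (\<integral>x. \<phi> x \<partial>\<mu>))"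

definition solution_with_measure_datum ::
    "(real^'N) set \<Rightarrow> (real^'N \<Rightarrow> real^'N^'N) \<Rightarrow> (real^'N) measure \<Rightarrow> (real^'N \<Rightarrow> real) \<Rightarrow> bool"
  where "solution_with_measure_datum \<Omega> M \<mu> u \<longleftrightarrow> u \<in> W1p_0 2 \<Omega> \<and>
    (\<forall>\<phi> \<in> C1c \<Omega>. (\<integral>x. (M x *v weak_grad \<Omega> u x) \<bullet> grad \<phi> x \<partial>lebesgue_on \<Omega>) = (\<integral>x. \<phi> x \<partial>\<mu>))"

end

theory Submission
  imports Defs "HOL-Probability.Helly_Selection"
begin

text \<open>
  Write \<open>F\<close> for a bound of \<open>f\<close> and let \<open>v\<close> be an approximation of \<open>u n\<close>, so that
  \<open>- div (M \<nabla>v) = G\<close> with \<open>G = f / (v + 1/m) ^ n\<close>. Three facts about these equations carry the theorem.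

  \<^item> On the set where \<open>v > k \<ge> 1\<close> the source is at most \<open>F / k ^ n\<close>. Stampacchia's truncation argument
  (\<open>weak_solution_upper_bound\<close>) turns this into \<open>v \<le> k + K / k ^ n\<close>, where \<open>K\<close> depends neither on \<open>n\<close>
  nor on \<open>m\<close>. The choice \<open>k = 1\<close> bounds the whole family; letting \<open>n\<close> tend to infinity with \<open>k > 1\<close>
  fixed shows that weak-star limits are at most 1.

  \<^item> The source lives in \<open>\<omega>\<close>, away from the boundary of \<open>\<Omega>\<close>. Let \<open>E\<close> be the energy of \<open>v\<close>, that is the
  integral of \<open>|\<nabla>v|\<^sup>2\<close>, and let \<open>X\<close> be the mass of \<open>G\<close>. Testing with \<open>v\<close> itself gives
  \<open>\<alpha> E \<le> \<integral>f + X\<close>, because \<open>t ^ (1 - n) \<le> 1 + t ^ (- n)\<close> for \<open>t = v + 1/m\<close>. Testing with a cutoff that is at least 1 on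
  \<open>\<omega>\<close> gives \<open>X \<le> \<alpha> E / 2 + const\<close>. Together they bound \<open>E\<close> and \<open>X\<close> (\<open>weak_solution_energy\<close>).

  \<^item> Bernoulli's inequality gives \<open>t \<ge> 1 - t ^ (- n) / n\<close> for \<open>t > 0\<close>. Where \<open>f \<ge> c > 0\<close> the bound of \<open>X\<close>
  makes the last term vanish in the mean, so weak-star limits are at least 1 in \<open>\<omega>\<close>.

  A weak-star limit \<open>w\<close> is therefore 1 in \<open>\<omega>\<close>. The energy bound puts it into the Sobolev space and lets
  the equation, which is linear in the gradient and the source, pass to the limit with \<open>\<mu>\<close> as source.
  Since \<open>\<nabla>w = 0\<close> in \<open>\<omega>\<close>, the measure \<open>\<mu>\<close> vanishes on balls inside \<open>\<omega>\<close>; since \<open>f = 0\<close> off \<open>\<omega>\<close>, it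
  vanishes on balls outside the closure of \<open>\<omega>\<close>. What remains is the frontier.

  Three tools are built on the way. Stampacchia's argument needs the Faber-Krahn inequality
  \<open>\<integral>z\<^sup>2 \<le> C |{z \<noteq> 0}| ^ (2/N) \<integral>|\<nabla>z|\<^sup>2\<close>; it follows from a Nash inequality, which in turn is a translation
  estimate averaged over a ball. Weak limits of bounded sequences in a Hilbert space are obtained as
  strong limits of iterated midpoints of the tails, by the parallelogram law, so that every closed
  convex condition and every linear functional passes to the limit at once. Weak compactness of
  measures is Helly's theorem on the line, transported by a ternary code of points.
\<close>

section \<open>Square-integrable functions\<close>

definition L2 :: "'a measure \<Rightarrow> ('a \<Rightarrow> 'b::euclidean_space) set"
  where "L2 M = {f \<in> borel_measurable M. integrable M (\<lambda>x. (norm (f x))\<^sup>2)}"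

definition sqn :: "'a measure \<Rightarrow> ('a \<Rightarrow> 'b::euclidean_space) \<Rightarrow> real"
  where "sqn M f = (\<integral>x. (norm (f x))\<^sup>2 \<partial>M)"

lemma L2_measurable: "f \<in> L2 M \<Longrightarrow> f \<in> borel_measurable M"
  by (simp add: L2_def)

lemma L2_integrable_sq: "f \<in> L2 M \<Longrightarrow> integrable M (\<lambda>x. (norm (f x))\<^sup>2)"
  by (simp add: L2_def)

lemma sqn_nonneg: "0 \<le> sqn M f"
  by (simp add: sqn_def)

lemma L2_dominated:
  assumes "f \<in> borel_measurable M" "integrable M g" "\<And>x. x \<in> space M \<Longrightarrow> (norm (f x))\<^sup>2 \<le> g x"
  shows "f \<in> L2 M"
proof -
  have "integrable M (\<lambda>x. (norm (f x))\<^sup>2)"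
  proof (rule Bochner_Integration.integrable_bound[OF assms(2)])
    show "(\<lambda>x. (norm (f x))\<^sup>2) \<in> borel_measurable M" using assms(1) by simp
    show "AE x in M. norm ((norm (f x))\<^sup>2) \<le> norm (g x)"
    proof (rule AE_I2)
      fix x assume "x \<in> space M"
      from assms(3)[OF this] show "norm ((norm (f x))\<^sup>2) \<le> norm (g x)" by simp
    qed
  qed
  with assms(1) show ?thesis by (simp add: L2_def)
qed

lemma norm_sum_sq_le: "(norm (a + b))\<^sup>2 \<le> 2 * (norm a)\<^sup>2 + 2 * (norm (b::'b::real_inner))\<^sup>2"
proof -
  have "(norm (a + b))\<^sup>2 + (norm (a - b))\<^sup>2 = 2 * (norm a)\<^sup>2 + 2 * (norm b)\<^sup>2"
    unfolding power2_norm_eq_inner by (simp add: inner_add inner_diff)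
  moreover have "0 \<le> (norm (a - b))\<^sup>2" by simp
  ultimately show ?thesis by linarith
qed

lemma L2_add: "f \<in> L2 M \<Longrightarrow> g \<in> L2 M \<Longrightarrow> (\<lambda>x. f x + g x) \<in> L2 M"
  by (rule L2_dominated[where g = "\<lambda>x. 2 * (norm (f x))\<^sup>2 + 2 * (norm (g x))\<^sup>2"])
    (auto simp: L2_def norm_sum_sq_le)

lemma L2_scaleR: "f \<in> L2 M \<Longrightarrow> (\<lambda>x. c *\<^sub>R f x) \<in> L2 M"
  by (auto simp: L2_def power_mult_distrib)

lemma L2_diff: "f \<in> L2 M \<Longrightarrow> g \<in> L2 M \<Longrightarrow> (\<lambda>x. f x - g x) \<in> L2 M"
  using L2_add[OF _ L2_scaleR[of g M "-1"], of f] by simp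

lemma L2_mid: "f \<in> L2 M \<Longrightarrow> g \<in> L2 M \<Longrightarrow> (\<lambda>x. (1/2) *\<^sub>R (f x + g x)) \<in> L2 M"
  by (intro L2_scaleR L2_add)

lemma L2_inner_integrable:
  assumes "f \<in> L2 M" "g \<in> L2 M"
  shows "integrable M (\<lambda>x. f x \<bullet> g x)"
proof (rule Bochner_Integration.integrable_bound)
  show "integrable M (\<lambda>x. (norm (f x))\<^sup>2 + (norm (g x))\<^sup>2)"
    using assms by (auto simp: L2_def)
  show "(\<lambda>x. f x \<bullet> g x) \<in> borel_measurable M"
    using assms by (auto simp: L2_def)
  have "norm (f x \<bullet> g x) \<le> norm ((norm (f x))\<^sup>2 + (norm (g x))\<^sup>2)" for x
  proof -
    have "0 \<le> norm (f x) * norm (g x)" by simp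
    then show ?thesis
      using Cauchy_Schwarz_ineq2[of "f x" "g x"] sum_squares_bound[of "norm (f x)" "norm (g x)"]
      by simp
  qed
  then show "AE x in M. norm (f x \<bullet> g x) \<le> norm ((norm (f x))\<^sup>2 + (norm (g x))\<^sup>2)"
    by simp
qed

lemma L2_add_sqn:
  assumes "f \<in> L2 M" "g \<in> L2 M"
  shows "sqn M (\<lambda>x. f x + t *\<^sub>R g x) = sqn M f + 2 * t * (\<integral>x. f x \<bullet> g x \<partial>M) + t\<^sup>2 * sqn M g"
proof -
  have "(norm (f x + t *\<^sub>R g x))\<^sup>2 = (norm (f x))\<^sup>2 + 2 * t * (f x \<bullet> g x) + t\<^sup>2 * (norm (g x))\<^sup>2" for x
    unfolding power2_norm_eq_inner
    by (simp add: inner_add inner_commute[of "g x" "f x"] distrib_left power2_eq_square)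
  then show ?thesis
    using assms L2_inner_integrable[OF assms] by (simp add: sqn_def L2_def)
qed

text \<open>The quadratic polynomial \<open>t \<mapsto> \<parallel>f + t g\<parallel>\<^sup>2\<close> is nonnegative, hence so is minus its discriminant.\<close>

lemma L2_Cauchy_Schwarz:
  assumes "f \<in> L2 M" "g \<in> L2 M"
  shows "(\<integral>x. f x \<bullet> g x \<partial>M)\<^sup>2 \<le> sqn M f * sqn M g"
proof -
  let ?b = "\<integral>x. f x \<bullet> g x \<partial>M"
  have *: "0 \<le> sqn M f + 2 * t * ?b + t\<^sup>2 * sqn M g" for t
    using L2_add_sqn[OF assms, of t] sqn_nonneg[of M "\<lambda>x. f x + t *\<^sub>R g x"] by simp
  show ?thesis
  proof (cases "sqn M g = 0")
    case True
    have "?b = 0"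
    proof (rule ccontr)
      assume "?b \<noteq> 0"
      \<comment> \<open>with a vanishing leading coefficient the polynomial is affine, and this \<open>t\<close> makes it \<open>-1\<close>\<close>
      with *[of "- (sqn M f + 1) / (2 * ?b)"] True sqn_nonneg[of M f] show False by (simp add: field_simps)
    qed
    then show ?thesis using True by simp
  next
    case False
    with sqn_nonneg[of M g] have "sqn M g > 0" by simp
    with *[of "- ?b / sqn M g"] show ?thesis
      by (simp add: field_simps power2_eq_square)
  qed
qed

lemma sqn_parallelogram:
  assumes "f \<in> L2 M" "g \<in> L2 M"
  shows "sqn M (\<lambda>x. f x - g x) = 2 * sqn M f + 2 * sqn M g - 4 * sqn M (\<lambda>x. (1/2) *\<^sub>R (f x + g x))"
proof -
  have "sqn M (\<lambda>x. (1/2) *\<^sub>R (f x + g x)) = (1/4) * sqn M (\<lambda>x. f x + 1 *\<^sub>R g x)"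
    unfolding sqn_def by (simp add: power_mult_distrib power2_eq_square)
  with L2_add_sqn[OF assms, of 1] L2_add_sqn[OF assms, of "-1"] show ?thesis by simp
qed

lemma sqn_add_le:
  assumes "f \<in> L2 M" "g \<in> L2 M"
  shows "sqn M (\<lambda>x. f x + g x) \<le> 2 * sqn M f + 2 * sqn M g"
proof -
  have "sqn M (\<lambda>x. f x + 1 *\<^sub>R g x) + sqn M (\<lambda>x. f x + (-1) *\<^sub>R g x) = 2 * sqn M f + 2 * sqn M g"
    unfolding L2_add_sqn[OF assms] by simp
  with sqn_nonneg[of M "\<lambda>x. f x + (-1) *\<^sub>R g x"] show ?thesis by simp
qed

lemma sqn_mid_le:
  assumes "f \<in> L2 M" "g \<in> L2 M" "sqn M f \<le> C" "sqn M g \<le> C"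
  shows "sqn M (\<lambda>x. (1/2) *\<^sub>R (f x + g x)) \<le> C"
proof -
  have "0 \<le> sqn M (\<lambda>x. f x - g x)" by (rule sqn_nonneg)
  with sqn_parallelogram[OF assms(1,2)] assms(3,4) show ?thesis by linarith
qed

lemma (in finite_measure) L2_integrable:
  assumes "f \<in> L2 M" shows "integrable M f"
proof (rule Bochner_Integration.integrable_bound)
  show "integrable M (\<lambda>x. 1 + (norm (f x))\<^sup>2)" using assms by (auto simp: L2_def)
  show "f \<in> borel_measurable M" using assms by (auto simp: L2_def)
  have "norm (f x) \<le> norm (1 + (norm (f x))\<^sup>2)" for x
  proof -
    have "2 * norm (f x) \<le> 1 + (norm (f x))\<^sup>2"
      using sum_squares_bound[of 1 "norm (f x)"] by simp
    with norm_ge_zero[of "f x"] have "norm (f x) \<le> 1 + (norm (f x))\<^sup>2" by linarith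
    then show ?thesis by simp
  qed
  then show "AE x in M. norm (f x) \<le> norm (1 + (norm (f x))\<^sup>2)" by simp
qed

text \<open>Young's inequality with a free weight \<open>t\<close>, which a fast Cauchy sequence can afford to let grow.\<close>

lemma (in finite_measure) L1_le_L2:
  assumes "f \<in> L2 M" "t > 0"
  shows "(\<integral>x. norm (f x) \<partial>M) \<le> measure M (space M) / t + t * sqn M f"
proof -
  have "norm (f x) \<le> 1 / t + t * (norm (f x))\<^sup>2" for x
  proof -
    have "2 * (norm (f x)) \<le> 1/t + t * (norm (f x))\<^sup>2"
      using sum_squares_bound[of 1 "t * norm (f x)"] \<open>t > 0\<close>
      by (simp add: field_simps power2_eq_square)
    then show ?thesis using norm_ge_zero[of "f x"] by linarith
  qed
  then have "(\<integral>x. norm (f x) \<partial>M) \<le> (\<integral>x. 1 / t + t * (norm (f x))\<^sup>2 \<partial>M)"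
    using assms L2_integrable[OF assms(1)] by (intro integral_mono) (auto simp: L2_def)
  also have "\<dots> = measure M (space M) / t + t * sqn M f"
    using assms by (subst Bochner_Integration.integral_add) (auto simp: L2_def sqn_def)
  finally show ?thesis .
qed

text \<open>
  The Riesz-Fischer argument: along a subsequence with squared distances at most \<open>4 ^ (- j)\<close> the
  increments are summable in \<open>L1\<close>, hence almost everywhere; Fatou's lemma transfers the Cauchy
  estimates to the pointwise limit.
\<close>

lemma (in finite_measure) L2_complete:
  fixes f :: "nat \<Rightarrow> 'a \<Rightarrow> 'b::euclidean_space"
  assumes f: "\<And>k. f k \<in> L2 M"
    and Cauchy: "\<And>e. e > 0 \<Longrightarrow> \<exists>N. \<forall>m\<ge>N. \<forall>n\<ge>N. sqn M (\<lambda>x. f m x - f n x) \<le> e"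
  shows "\<exists>F\<in>L2 M. (\<lambda>k. sqn M (\<lambda>x. f k x - F x)) \<longlonglongrightarrow> 0"
proof -
  have "\<exists>N. \<forall>m\<ge>N. \<forall>n\<ge>N. sqn M (\<lambda>x. f m x - f n x) \<le> (1/4)^j" for j
    by (rule Cauchy) simp
  then obtain N where N: "\<And>j m n. m \<ge> N j \<Longrightarrow> n \<ge> N j \<Longrightarrow> sqn M (\<lambda>x. f m x - f n x) \<le> (1/4)^j"
    by metis
  \<comment> \<open>at least every threshold up to \<open>j\<close>\<close>
  define r where "r j = (\<Sum>i\<le>j. N i) + j" for j
  have rN: "r i \<ge> N j" if "i \<ge> j" for i j
    unfolding r_def using member_le_sum[of j "{..i}" N] that by fastforce
  have fm[measurable]: "f k \<in> borel_measurable M" for k using f by (rule L2_measurable)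
  define d where "d j x = norm (f (r (Suc j)) x - f (r j) x)" for j x
  have d_int: "integrable M (d j)" for j
    unfolding d_def by (intro integrable_norm L2_integrable L2_diff f)
  have d_le: "(\<integral>x. d j x \<partial>M) \<le> (measure M (space M) + 1) * (1/2)^j" for j
  proof -
    have "(\<integral>x. d j x \<partial>M) \<le> measure M (space M) / 2^j + 2^j * sqn M (\<lambda>x. f (r (Suc j)) x - f (r j) x)"
      unfolding d_def by (intro L1_le_L2 L2_diff f) simp
    also have "\<dots> \<le> measure M (space M) / 2^j + 2^j * (1/4)^j"
      by (intro add_left_mono mult_left_mono N rN) auto
    also have "\<dots> = (measure M (space M) + 1) * (1/2)^j"
      by (simp add: field_simps power_mult_distrib[symmetric] flip: power_divide)
    finally show ?thesis .
  qed
  have "(\<integral>\<^sup>+x. (\<Sum>j. ennreal (d j x)) \<partial>M) = (\<Sum>j. \<integral>\<^sup>+x. ennreal (d j x) \<partial>M)"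
    unfolding d_def by (intro nn_integral_suminf) auto
  also have "\<dots> = (\<Sum>j. ennreal (\<integral>x. d j x \<partial>M))"
    using d_int by (subst nn_integral_eq_integral) (auto simp: d_def)
  also have "\<dots> \<le> (\<Sum>j. ennreal ((measure M (space M) + 1) * (1/2)^j))"
    by (intro suminf_le ennreal_leI d_le) auto
  also have "\<dots> < \<infinity>"
    by (subst suminf_ennreal2) (auto intro!: summable_mult summable_geometric)
  finally have "AE x in M. (\<Sum>j. ennreal (d j x)) \<noteq> \<infinity>"
    by (intro nn_integral_PInf_AE) (auto simp: d_def)
  then have AEconv: "AE x in M. convergent (\<lambda>j. f (r j) x)"
  proof eventually_elim
    case (elim x)
    then have "summable (\<lambda>j. d j x)"
      by (intro summable_suminf_not_top) (auto simp: d_def)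
    then have "summable (\<lambda>j. f (r (Suc j)) x - f (r j) x)"
      unfolding d_def by (rule summable_norm_cancel)
    then obtain l where "(\<lambda>n. \<Sum>j<n. f (r (Suc j)) x - f (r j) x) \<longlonglongrightarrow> l"
      unfolding summable_def sums_def by blast
    then have "(\<lambda>n. f (r n) x - f (r 0) x) \<longlonglongrightarrow> l"
      using sum_lessThan_telescope[of "\<lambda>n. f (r n) x"] by simp
    from tendsto_add[OF this tendsto_const[of "f (r 0) x"]] show ?case
      by (auto simp: convergent_def)
  qed
  define F where "F x = lim (\<lambda>j. f (r j) x)" for x
  have Fm[measurable]: "F \<in> borel_measurable M"
    unfolding F_def by (rule borel_measurable_lim_metric) simp
  have Flim: "AE x in M. (\<lambda>j. f (r j) x) \<longlonglongrightarrow> F x"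
    using AEconv unfolding F_def by (simp add: convergent_LIMSEQ_iff)
  have key: "(\<integral>\<^sup>+x. ennreal ((norm (f k x - F x))\<^sup>2) \<partial>M) \<le> ennreal ((1/4)^j)" if k: "k \<ge> N j" for k j
  proof -
    have "(\<integral>\<^sup>+x. ennreal ((norm (f k x - F x))\<^sup>2) \<partial>M)
        = (\<integral>\<^sup>+x. liminf (\<lambda>i. ennreal ((norm (f k x - f (r i) x))\<^sup>2)) \<partial>M)"
    proof (rule nn_integral_cong_AE)
      show "AE x in M. ennreal ((norm (f k x - F x))\<^sup>2) = liminf (\<lambda>i. ennreal ((norm (f k x - f (r i) x))\<^sup>2))"
        using Flim
      proof eventually_elim
        case (elim x)
        then have "(\<lambda>i. ennreal ((norm (f k x - f (r i) x))\<^sup>2)) \<longlonglongrightarrow> ennreal ((norm (f k x - F x))\<^sup>2)"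
          by (intro tendsto_intros) auto
        from lim_imp_Liminf[OF _ this] show ?case by simp
      qed
    qed
    also have "\<dots> \<le> liminf (\<lambda>i. \<integral>\<^sup>+x. ennreal ((norm (f k x - f (r i) x))\<^sup>2) \<partial>M)"
      by (rule nn_integral_liminf) simp
    also have "\<dots> \<le> ennreal ((1/4)^j)"
    proof (rule order_trans[OF Liminf_mono[where g="\<lambda>_. ennreal ((1/4)^j)"]])
      show "\<forall>\<^sub>F i in sequentially. (\<integral>\<^sup>+x. ennreal ((norm (f k x - f (r i) x))\<^sup>2) \<partial>M) \<le> ennreal ((1/4)^j)"
        using eventually_ge_at_top[of j]
      proof eventually_elim
        case (elim i)
        have "(\<integral>\<^sup>+x. ennreal ((norm (f k x - f (r i) x))\<^sup>2) \<partial>M) = ennreal (sqn M (\<lambda>x. f k x - f (r i) x))"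
          unfolding sqn_def
          by (intro nn_integral_eq_integral L2_integrable_sq L2_diff f) auto
        then show ?case using N[OF k rN[OF elim]] by (simp add: ennreal_leI)
      qed
    qed (simp add: Liminf_const)
    finally show ?thesis .
  qed
  have inL: "(\<lambda>x. f k x - F x) \<in> L2 M" if "k \<ge> N j" for k j
  proof -
    have "(\<integral>\<^sup>+x. ennreal ((norm (f k x - F x))\<^sup>2) \<partial>M) < \<infinity>"
      using key[OF that] ennreal_less_top infinity_ennreal_def order_le_less_trans by metis
    then have "integrable M (\<lambda>x. (norm (f k x - F x))\<^sup>2)"
      by (intro integrableI_bounded) simp_all
    then show ?thesis by (simp add: L2_def)
  qed
  have FL: "F \<in> L2 M"
    using L2_diff[OF f[of "N 0"] inL[of 0 "N 0"]] by simp
  have "sqn M (\<lambda>x. f k x - F x) \<le> (1/4)^j" if "k \<ge> N j" for k j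
  proof -
    have "ennreal (sqn M (\<lambda>x. f k x - F x)) = (\<integral>\<^sup>+x. ennreal ((norm (f k x - F x))\<^sup>2) \<partial>M)"
      unfolding sqn_def
      by (intro nn_integral_eq_integral[symmetric] L2_integrable_sq inL[OF that]) auto
    with key[OF that] have "ennreal (sqn M (\<lambda>x. f k x - F x)) \<le> ennreal ((1/4) ^ j)" by simp
    then show ?thesis by (subst (asm) ennreal_le_iff) auto
  qed
  note sq = this
  have "(\<lambda>k. sqn M (\<lambda>x. f k x - F x)) \<longlonglongrightarrow> 0"
  proof (rule LIMSEQ_I)
    fix e :: real assume "e > 0"
    then obtain j where "(1/4::real)^j < e" using real_arch_pow_inv[of e "1/4"] by auto
    moreover have "norm (sqn M (\<lambda>x. f n x - F x) - 0) \<le> (1/4)^j" if "n \<ge> N j" for n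
      using sq[OF that] sqn_nonneg[of M "\<lambda>x. f n x - F x"] by simp
    ultimately show "\<exists>no. \<forall>n\<ge>no. norm (sqn M (\<lambda>x. f n x - F x) - 0) < e"
      by (blast intro: le_less_trans)
  qed
  with FL show ?thesis by blast
qed

text \<open>
  The functions obtained from the tail \<open>U k, U (k + 1), \<dots>\<close> by repeated midpoints: the part of the convex hull
  that the parallelogram law needs, with an induction rule in place of weights.
\<close>

inductive_set midhull :: "(nat \<Rightarrow> 'a \<Rightarrow> 'b::real_vector) \<Rightarrow> nat \<Rightarrow> ('a \<Rightarrow> 'b) set"
  for U :: "nat \<Rightarrow> 'a \<Rightarrow> 'b" and k :: nat where
  base: "j \<ge> k \<Longrightarrow> U j \<in> midhull U k"
| mid: "a \<in> midhull U k \<Longrightarrow> b \<in> midhull U k \<Longrightarrow> (\<lambda>x. (1/2) *\<^sub>R (a x + b x)) \<in> midhull U k"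

lemma midhull_mono: "a \<in> midhull U l \<Longrightarrow> k \<le> l \<Longrightarrow> a \<in> midhull U k"
  by (induction rule: midhull.induct) (auto intro: midhull.intros)

lemma midhull_L2: "a \<in> midhull U k \<Longrightarrow> (\<And>j. U j \<in> L2 M) \<Longrightarrow> a \<in> L2 M"
  by (induction rule: midhull.induct) (auto intro!: L2_mid)

lemma midhull_sqn_le:
  assumes "a \<in> midhull U k" "\<And>j. U j \<in> L2 M" "\<And>j. sqn M (U j) \<le> C"
  shows "sqn M a \<le> C"
  using assms(1)
proof (induction rule: midhull.induct)
  case (base j)
  show ?case by (rule assms(3))
next
  case (mid a b)
  show ?case
    by (rule sqn_mid_le[OF midhull_L2[OF mid.hyps(1) assms(2)] midhull_L2[OF mid.hyps(2) assms(2)] mid.IH])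
qed

text \<open>
  Let \<open>d k\<close> be the infimum of the squared norm over the midpoints of the \<open>k\<close>-th tail. It increases to a
  finite limit, so for nearly minimal elements of late tails the parallelogram law, applied with their
  midpoint, forces small distances.
\<close>

lemma (in finite_measure) strongly_convergent_midpoints:
  fixes U :: "nat \<Rightarrow> 'a \<Rightarrow> 'b::euclidean_space"
  assumes U: "\<And>j. U j \<in> L2 M" and C: "\<And>j. sqn M (U j) \<le> C"
  shows "\<exists>y. \<exists>Y\<in>L2 M. (\<forall>k. y k \<in> midhull U k) \<and> (\<lambda>k. sqn M (\<lambda>x. y k x - Y x)) \<longlonglongrightarrow> 0"
proof -
  define d where "d k = Inf (sqn M ` midhull U k)" for k
  have bdd: "bdd_below (sqn M ` midhull U k)" for k
    by (rule bdd_belowI[of _ 0]) (auto simp: sqn_nonneg)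
  have ne: "sqn M ` midhull U k \<noteq> {}" for k
    using midhull.base[of k k U] by blast
  have d_le: "d k \<le> sqn M a" if "a \<in> midhull U k" for k a
    unfolding d_def using that bdd by (intro cInf_lower) auto
  have "mono d"
    unfolding d_def by (intro monoI cInf_superset_mono ne bdd image_mono) (auto intro: midhull_mono)
  moreover have "d k \<le> C" for k
    using d_le[OF midhull.base[of k k U]] C[of k] by simp
  ultimately obtain D where D: "d \<longlonglongrightarrow> D" and dD: "\<And>k. d k \<le> D"
    using incseq_convergent[of d C] by auto
  have "\<exists>a\<in>midhull U k. sqn M a < d k + inverse (Suc k)" for k
    using cInf_lessD[OF ne, of k "d k + inverse (Suc k)"] by (auto simp: d_def)
  then obtain y where y: "\<And>k. y k \<in> midhull U k" "\<And>k. sqn M (y k) < d k + inverse (Suc k)"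
    by metis
  have yL: "y k \<in> L2 M" for k using midhull_L2[OF y(1)] U by blast
  have est: "sqn M (\<lambda>x. y m x - y n x) \<le> 4 * (D - d l) + 4 * inverse (Suc l)" if "m \<ge> l" "n \<ge> l" for m n l
  proof -
    have "(\<lambda>x. (1/2) *\<^sub>R (y m x + y n x)) \<in> midhull U l"
      by (intro midhull.mid midhull_mono[OF y(1)] that)
    from d_le[OF this] sqn_parallelogram[OF yL yL, of m n]
    have "sqn M (\<lambda>x. y m x - y n x) \<le> 2 * sqn M (y m) + 2 * sqn M (y n) - 4 * d l" by linarith
    moreover have bnd: "sqn M (y i) \<le> D + inverse (Suc l)" if "i \<ge> l" for i
    proof -
      have "inverse (real (Suc i)) \<le> inverse (real (Suc l))" using that by (simp add: field_simps)
      with y(2)[of i] dD[of i] show ?thesis by linarith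
    qed
    moreover note bnd[OF that(1)] bnd[OF that(2)]
    ultimately show ?thesis by (simp add: algebra_simps)
  qed
  have "(\<lambda>l. 4 * (D - d l) + 4 * inverse (real (Suc l))) \<longlonglongrightarrow> 4 * (D - D) + 4 * 0"
    by (intro tendsto_intros D LIMSEQ_inverse_real_of_nat)
  then have lim0: "(\<lambda>l. 4 * (D - d l) + 4 * inverse (real (Suc l))) \<longlonglongrightarrow> 0" by simp
  have "\<exists>N. \<forall>m\<ge>N. \<forall>n\<ge>N. sqn M (\<lambda>x. y m x - y n x) \<le> e" if "e > 0" for e
  proof -
    from order_tendstoD(2)[OF lim0 that] obtain N
      where "4 * (D - d N) + 4 * inverse (real (Suc N)) < e"
      by (auto simp: eventually_sequentially)
    with est[of N] show ?thesis by (intro exI[of _ N]) (blast intro: order.strict_implies_order order_trans)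
  qed
  from L2_complete[OF yL this] y(1) show ?thesis by blast
qed

section \<open>Test functions\<close>

lemma lebesgue_on_eq_lborel:
  fixes f :: "'a::euclidean_space \<Rightarrow> 'b::euclidean_space"
  assumes "f \<in> borel_measurable borel" "\<Omega> \<in> sets lebesgue" "\<And>x. x \<notin> \<Omega> \<Longrightarrow> f x = 0"
  shows "integral\<^sup>L (lebesgue_on \<Omega>) f = integral\<^sup>L lborel f"
    and "integrable (lebesgue_on \<Omega>) f \<longleftrightarrow> integrable lborel f"
proof -
  have eq: "(\<lambda>x. if x \<in> \<Omega> then f x else 0) = f" using assms(3) by auto
  show "integral\<^sup>L (lebesgue_on \<Omega>) f = integral\<^sup>L lborel f"
    using Lebesgue_Measure.integral_restrict_UNIV[OF assms(2), of f] integral_completion[of f lborel] assms(1) by (simp add: eq)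
  show "integrable (lebesgue_on \<Omega>) f \<longleftrightarrow> integrable lborel f"
    using Lebesgue_Measure.integrable_restrict_UNIV[OF assms(2), of f] integrable_completion[of f lborel] assms(1) by (simp add: eq)
qed

lemma borel_measurable_lebesgue_onI:
  fixes f :: "'a::euclidean_space \<Rightarrow> 'b::topological_space"
  shows "f \<in> borel_measurable borel \<Longrightarrow> f \<in> borel_measurable (lebesgue_on \<Omega>)"
  by (intro measurable_restrict_space1 measurable_completion) simp

lemma continuous_borel_lebesgue_on:
  fixes f :: "'a::euclidean_space \<Rightarrow> 'b::topological_space"
  shows "continuous_on UNIV f \<Longrightarrow> f \<in> borel_measurable (lebesgue_on \<Omega>)"
  by (intro borel_measurable_lebesgue_onI borel_measurable_continuous_onI)

lemma open_bounded_finite_measure: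
  fixes \<Omega> :: "'a::euclidean_space set"
  assumes "open \<Omega>" "bounded \<Omega>"
  shows "finite_measure (lebesgue_on \<Omega>)" "\<Omega> \<in> sets lebesgue"
proof -
  show "\<Omega> \<in> sets lebesgue" using assms(1) by auto
  with assms(2) have "\<Omega> \<in> lmeasurable" by (rule bounded_set_imp_lmeasurable)
  then show "finite_measure (lebesgue_on \<Omega>)" by (rule finite_measure_lebesgue_on)
qed

lemma grad_eqI:
  assumes "(\<phi> has_derivative (\<lambda>h. g \<bullet> h)) (at x)"
  shows "grad \<phi> x = g"
  using frechet_derivative_at[OF assms, symmetric]
  by (simp add: grad_def vec_eq_iff inner_axis)

lemma has_derivative_grad:
  assumes "\<phi> differentiable (at x)"
  shows "(\<phi> has_derivative (\<lambda>h. grad \<phi> x \<bullet> h)) (at x)"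
proof -
  let ?D = "frechet_derivative \<phi> (at x)"
  have D: "(\<phi> has_derivative ?D) (at x)" using assms by (simp add: frechet_derivative_works)
  then have lin: "linear ?D" by (rule has_derivative_linear)
  have "?D h = grad \<phi> x \<bullet> h" for h
  proof -
    have "?D h = ?D (\<Sum>i\<in>UNIV. (h $ i) *\<^sub>R axis i 1)"
      by (simp add: basis_expansion flip: scalar_mult_eq_scaleR)
    also have "\<dots> = (\<Sum>i\<in>UNIV. (h $ i) * ?D (axis i 1))"
      by (simp add: linear_sum[OF lin] linear_cmul[OF lin])
    also have "\<dots> = grad \<phi> x \<bullet> h"
      by (simp add: grad_def inner_vec_def mult.commute)
    finally show ?thesis .
  qed
  then have "?D = (\<lambda>h. grad \<phi> x \<bullet> h)" by blast
  with D show ?thesis by simp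
qed

lemma C1c_has_derivative: "\<phi> \<in> C1c \<Omega> \<Longrightarrow> (\<phi> has_derivative (\<lambda>h. grad \<phi> x \<bullet> h)) (at x)"
  by (intro has_derivative_grad) (simp add: C1c_def)

lemma C1cI:
  assumes D: "\<And>x. (\<phi> has_derivative (\<lambda>h. g x \<bullet> h)) (at x)" and g: "continuous_on UNIV g"
    and K: "compact K" "K \<subseteq> \<Omega>" "\<And>x. x \<notin> K \<Longrightarrow> \<phi> x = 0"
  shows "\<phi> \<in> C1c \<Omega>" "grad \<phi> = g"
proof -
  show gr: "grad \<phi> = g" by (rule ext) (rule grad_eqI[OF D])
  have "closure {x. \<phi> x \<noteq> 0} \<subseteq> K"
    using K by (intro closure_minimal compact_imp_closed) auto
  moreover have "compact (closure {x. \<phi> x \<noteq> 0})"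
    using calculation K(1) by (metis closed_closure compact_Int_closed inf.absorb_iff2)
  moreover have "continuous_on UNIV \<phi>"
    using D by (intro continuous_at_imp_continuous_on ballI) (rule has_derivative_continuous)
  ultimately show "\<phi> \<in> C1c \<Omega>"
    using g K(2) gr D unfolding C1c_def Cc_def differentiable_def by blast
qed

lemma C1c_continuous: "\<phi> \<in> C1c \<Omega> \<Longrightarrow> continuous_on UNIV \<phi>"
  and C1c_continuous_grad: "\<phi> \<in> C1c \<Omega> \<Longrightarrow> continuous_on UNIV (grad \<phi>)"
  and C1c_Cc: "\<phi> \<in> C1c \<Omega> \<Longrightarrow> \<phi> \<in> Cc \<Omega>"
  by (auto simp: C1c_def Cc_def)

lemma C1c_support:
  assumes "\<phi> \<in> C1c \<Omega>"
  obtains K where "compact K" "K \<subseteq> \<Omega>" "\<And>x. x \<notin> K \<Longrightarrow> \<phi> x = 0" "\<And>x. x \<notin> K \<Longrightarrow> grad \<phi> x = 0"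
proof -
  define K where "K = closure {x. \<phi> x \<noteq> 0}"
  have K: "compact K" "K \<subseteq> \<Omega>" using assms by (auto simp: C1c_def Cc_def K_def)
  have z: "\<phi> x = 0" if "x \<notin> K" for x
    using that closure_subset[of "{x. \<phi> x \<noteq> 0}"] unfolding K_def by blast
  have op: "open (- K)" using K(1) by (intro open_Compl compact_imp_closed)
  have "grad \<phi> x = 0" if x: "x \<notin> K" for x
  proof (rule grad_eqI)
    have "((\<lambda>_. 0) has_derivative (\<lambda>h. 0 \<bullet> h)) (at x)" by simp
    then show "(\<phi> has_derivative (\<lambda>h. 0 \<bullet> h)) (at x)"
    proof (rule has_derivative_transform_within_open[OF _ op])
      show "x \<in> - K" using x by simp
      show "\<And>y. y \<in> - K \<Longrightarrow> 0 = \<phi> y" using z by simp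
    qed
  qed
  with K z show ?thesis by (rule that)
qed

lemma continuous_zero_off_compact_bounded:
  fixes f :: "'a::euclidean_space \<Rightarrow> 'b::real_normed_vector"
  assumes "continuous_on UNIV f" "compact K" "\<And>x. x \<notin> K \<Longrightarrow> f x = 0"
  obtains B where "B > 0" "\<And>x. norm (f x) \<le> B"
proof -
  have "bounded (f ` K)"
    using assms continuous_on_subset by (blast intro: compact_imp_bounded compact_continuous_image)
  then obtain B where "B > 0" "\<forall>y\<in>f ` K. norm y \<le> B" by (auto simp: bounded_pos)
  then show ?thesis using assms(3) by (intro that[of B]) (metis image_eqI norm_zero less_imp_le)+
qed

lemma C1c_bounded:
  assumes "\<phi> \<in> C1c \<Omega>"
  obtains B where "B > 0" "\<And>x. \<bar>\<phi> x\<bar> \<le> B" "\<And>x. norm (grad \<phi> x) \<le> B"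
proof -
  obtain K where K: "compact K" "\<And>x. x \<notin> K \<Longrightarrow> \<phi> x = 0" "\<And>x. x \<notin> K \<Longrightarrow> grad \<phi> x = 0"
    by (rule C1c_support[OF assms]) blast
  obtain B1 where B1: "B1 > 0" "\<And>x. norm (\<phi> x) \<le> B1"
    by (rule continuous_zero_off_compact_bounded[OF C1c_continuous[OF assms] K(1,2)]) blast+
  obtain B2 where B2: "B2 > 0" "\<And>x. norm (grad \<phi> x) \<le> B2"
    by (rule continuous_zero_off_compact_bounded[OF C1c_continuous_grad[OF assms] K(1,3)]) blast+
  show ?thesis
    using B1(1) B1(2) B2(2) by (intro that[of "max B1 B2"]) (auto simp: le_max_iff_disj)
qed

lemma C1c_mono: "\<phi> \<in> C1c \<Omega> \<Longrightarrow> \<Omega> \<subseteq> \<Omega>' \<Longrightarrow> \<phi> \<in> C1c \<Omega>'"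
  by (auto simp: C1c_def Cc_def)

lemma C1c_add:
  assumes "\<phi> \<in> C1c \<Omega>" "\<psi> \<in> C1c \<Omega>"
  shows "(\<lambda>x. \<phi> x + \<psi> x) \<in> C1c \<Omega>" "grad (\<lambda>x. \<phi> x + \<psi> x) = (\<lambda>x. grad \<phi> x + grad \<psi> x)"
proof -
  obtain K where K: "compact K" "K \<subseteq> \<Omega>" "\<And>x. x \<notin> K \<Longrightarrow> \<phi> x = 0"
    by (rule C1c_support[OF assms(1)]) blast
  obtain L where L: "compact L" "L \<subseteq> \<Omega>" "\<And>x. x \<notin> L \<Longrightarrow> \<psi> x = 0"
    by (rule C1c_support[OF assms(2)]) blast
  have D: "((\<lambda>x. \<phi> x + \<psi> x) has_derivative (\<lambda>h. (grad \<phi> x + grad \<psi> x) \<bullet> h)) (at x)" for x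
    using has_derivative_add[OF C1c_has_derivative[OF assms(1)] C1c_has_derivative[OF assms(2)]]
    by (simp add: inner_add_left)
  have C: "continuous_on UNIV (\<lambda>x. grad \<phi> x + grad \<psi> x)"
    using assms by (intro continuous_intros C1c_continuous_grad)
  show "(\<lambda>x. \<phi> x + \<psi> x) \<in> C1c \<Omega>" "grad (\<lambda>x. \<phi> x + \<psi> x) = (\<lambda>x. grad \<phi> x + grad \<psi> x)"
    by (rule C1cI[OF D C, of "K \<union> L"]; use K L in \<open>auto intro: compact_Un\<close>)+
qed

text \<open>Only one factor needs compact support, so that polynomials are admissible as the other one.\<close>

lemma C1c_mult:
  assumes "\<phi> \<in> C1c \<Omega>" "\<And>x. (\<psi> has_derivative (\<lambda>h. g x \<bullet> h)) (at x)" "continuous_on UNIV g"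
  shows "(\<lambda>x. \<phi> x * \<psi> x) \<in> C1c \<Omega>" "grad (\<lambda>x. \<phi> x * \<psi> x) = (\<lambda>x. \<phi> x *\<^sub>R g x + \<psi> x *\<^sub>R grad \<phi> x)"
proof -
  obtain K where K: "compact K" "K \<subseteq> \<Omega>" "\<And>x. x \<notin> K \<Longrightarrow> \<phi> x = 0"
    by (rule C1c_support[OF assms(1)]) blast
  have D: "((\<lambda>x. \<phi> x * \<psi> x) has_derivative (\<lambda>h. (\<phi> x *\<^sub>R g x + \<psi> x *\<^sub>R grad \<phi> x) \<bullet> h)) (at x)" for x
    using has_derivative_mult[OF C1c_has_derivative[OF assms(1)] assms(2)]
    by (simp add: inner_add_left mult.commute)
  have "continuous_on UNIV \<psi>"
    using assms(2) by (intro continuous_at_imp_continuous_on ballI) (rule has_derivative_continuous)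
  then have C: "continuous_on UNIV (\<lambda>x. \<phi> x *\<^sub>R g x + \<psi> x *\<^sub>R grad \<phi> x)"
    using assms by (intro continuous_intros C1c_continuous_grad C1c_continuous[OF assms(1)])
  show "(\<lambda>x. \<phi> x * \<psi> x) \<in> C1c \<Omega>" "grad (\<lambda>x. \<phi> x * \<psi> x) = (\<lambda>x. \<phi> x *\<^sub>R g x + \<psi> x *\<^sub>R grad \<phi> x)"
    by (rule C1cI[OF D C, of K]; use K in auto)+
qed

lemma C1c_cmult:
  assumes "\<phi> \<in> C1c \<Omega>"
  shows "(\<lambda>x. c * \<phi> x) \<in> C1c \<Omega>" "grad (\<lambda>x. c * \<phi> x) = (\<lambda>x. c *\<^sub>R grad \<phi> x)"
proof -
  have "((\<lambda>x. c) has_derivative (\<lambda>h. 0 \<bullet> h)) (at x)" for x :: "real^'n" by simp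
  from C1c_mult[OF assms this continuous_on_const] show "(\<lambda>x. c * \<phi> x) \<in> C1c \<Omega>" "grad (\<lambda>x. c * \<phi> x) = (\<lambda>x. c *\<^sub>R grad \<phi> x)"
    by (simp_all add: mult.commute)
qed

lemma C1c_compose:
  assumes "\<phi> \<in> C1c \<Omega>" "\<And>t. (H has_real_derivative H' t) (at t)" "continuous_on UNIV H'" "H 0 = 0"
  shows "(\<lambda>x. H (\<phi> x)) \<in> C1c \<Omega>" "grad (\<lambda>x. H (\<phi> x)) = (\<lambda>x. H' (\<phi> x) *\<^sub>R grad \<phi> x)"
proof -
  obtain K where K: "compact K" "K \<subseteq> \<Omega>" "\<And>x. x \<notin> K \<Longrightarrow> \<phi> x = 0"
    by (rule C1c_support[OF assms(1)]) blast
  have D: "((\<lambda>x. H (\<phi> x)) has_derivative (\<lambda>h. (H' (\<phi> x) *\<^sub>R grad \<phi> x) \<bullet> h)) (at x)" for x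
    using has_derivative_compose[OF C1c_has_derivative[OF assms(1)] assms(2)[unfolded has_field_derivative_def]]
    by simp
  have C: "continuous_on UNIV (\<lambda>x. H' (\<phi> x) *\<^sub>R grad \<phi> x)"
    using assms(1) by (intro continuous_intros C1c_continuous_grad
        continuous_on_compose2[OF assms(3) C1c_continuous[OF assms(1)]]) auto
  show "(\<lambda>x. H (\<phi> x)) \<in> C1c \<Omega>" "grad (\<lambda>x. H (\<phi> x)) = (\<lambda>x. H' (\<phi> x) *\<^sub>R grad \<phi> x)"
    by (rule C1cI[OF D C, of K]; use K assms(4) in auto)+
qed

lemma pos_part_sq_derivative: "((\<lambda>t. (max 0 t)\<^sup>2) has_real_derivative 2 * max 0 t) (at (t::real))"
proof -
  consider "t > 0" | "t < 0" | "t = 0" by linarith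
  then show ?thesis
  proof cases
    case 1
    have "((\<lambda>t. t\<^sup>2) has_real_derivative 2 * max 0 t) (at t)"
      using 1 by (auto intro!: derivative_eq_intros)
    then show ?thesis
      by (rule has_field_derivative_transform_within_open[where S = "{0<..}"]) (use 1 in auto)
  next
    case 2
    have "((\<lambda>t. 0) has_real_derivative 2 * max 0 t) (at t)" using 2 by simp
    then show ?thesis
      by (rule has_field_derivative_transform_within_open[where S = "{..<0}"]) (use 2 in auto)
  next
    case 3
    have "((\<lambda>h. ((max 0 (0 + h))\<^sup>2 - (max 0 0)\<^sup>2) / h) \<longlongrightarrow> 0) (at (0::real))"
    proof (rule Lim_null_comparison)
      have "norm (((max 0 (0 + h))\<^sup>2 - (max 0 0)\<^sup>2) / h) \<le> \<bar>h\<bar>" for h :: real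
        by (cases "h > 0") (auto simp: max_def power2_eq_square)
      then show "\<forall>\<^sub>F h in at 0. norm (((max 0 (0 + h))\<^sup>2 - (max 0 0)\<^sup>2) / h) \<le> \<bar>h::real\<bar>"
        by simp
      show "((\<lambda>h. \<bar>h::real\<bar>) \<longlongrightarrow> 0) (at 0)" by (intro tendsto_rabs_zero tendsto_ident_at)
    qed
    then show ?thesis using 3 by (simp add: DERIV_def)
  qed
qed

text \<open>The exponent 2 outside makes the positive part continuously differentiable.\<close>

definition bump :: "real^'N \<Rightarrow> real \<Rightarrow> real^'N \<Rightarrow> real"
  where "bump a r x = (max 0 (r\<^sup>2 - (norm (x - a))\<^sup>2))\<^sup>2"

lemma bump_nonneg: "0 \<le> bump a r x"
  by (simp add: bump_def)

lemma bump_pos_iff: "r > 0 \<Longrightarrow> bump a r x > 0 \<longleftrightarrow> x \<in> ball a r"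
proof -
  assume r: "r > 0"
  have "bump a r x > 0 \<longleftrightarrow> (norm (x - a))\<^sup>2 < r\<^sup>2"
    by (auto simp: bump_def max_def)
  also have "\<dots> \<longleftrightarrow> norm (x - a) < r"
    using r by (metis norm_ge_zero power_less_imp_less_base less_imp_le power_strict_mono zero_less_numeral)
  finally show ?thesis by (simp add: dist_norm norm_minus_commute)
qed

lemma bump_C1c:
  assumes r: "r > 0" and "cball a r \<subseteq> \<Omega>"
  shows "bump a r \<in> C1c \<Omega>"
proof (rule C1cI(1))
  have 1: "((\<lambda>x. r\<^sup>2 - (norm (x - a))\<^sup>2) has_derivative (\<lambda>h. - 2 * ((x - a) \<bullet> h))) (at x)" for x
    unfolding power2_norm_eq_inner
    by (auto intro!: derivative_eq_intros simp: inner_diff inner_commute fun_eq_iff)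
  show "(bump a r has_derivative (\<lambda>h. ((2 * max 0 (r\<^sup>2 - (norm (x - a))\<^sup>2)) *\<^sub>R (- 2 *\<^sub>R (x - a))) \<bullet> h)) (at x)" for x
    using has_derivative_compose[OF 1[of x] pos_part_sq_derivative[unfolded has_field_derivative_def]]
    unfolding bump_def by (simp add: algebra_simps)
  show "continuous_on UNIV (\<lambda>x. (2 * max 0 (r\<^sup>2 - (norm (x - a))\<^sup>2)) *\<^sub>R (- 2 *\<^sub>R (x - a)))"
    by (intro continuous_intros)
  show "compact (cball a r)" by simp
  show "cball a r \<subseteq> \<Omega>" by fact
  show "bump a r x = 0" if "x \<notin> cball a r" for x
    using bump_pos_iff[OF r, of a x] bump_nonneg[of a r x] that by (auto simp: not_less)
qed

lemma C1c_sum: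
  assumes "finite I" "\<And>i. i \<in> I \<Longrightarrow> \<phi> i \<in> C1c \<Omega>"
  shows "(\<lambda>x. \<Sum>i\<in>I. \<phi> i x) \<in> C1c \<Omega>"
  using assms
proof (induction I rule: finite_induct)
  case empty
  show ?case
    by (rule C1cI(1)[of _ "\<lambda>_. 0" "{}"]) auto
next
  case (insert i I)
  then show ?case by (simp add: C1c_add(1))
qed

text \<open>A finite sum of bumps covering \<open>K\<close> is positive on \<open>K\<close>; dividing by its minimum suffices, as the cutoff may exceed 1.\<close>

lemma C1c_cutoff:
  fixes K :: "(real^'N) set"
  assumes "compact K" "open \<Omega>" "K \<subseteq> \<Omega>"
  obtains \<phi> where "\<phi> \<in> C1c \<Omega>" "\<And>x. \<phi> x \<ge> 0" "\<And>x. x \<in> K \<Longrightarrow> \<phi> x \<ge> 1"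
proof -
  have "\<forall>x\<in>K. \<exists>r>0. cball x r \<subseteq> \<Omega>" using assms open_contains_cball by blast
  then obtain r where r: "\<And>x. x \<in> K \<Longrightarrow> r x > 0" "\<And>x. x \<in> K \<Longrightarrow> cball x (r x) \<subseteq> \<Omega>" by metis
  have "K \<subseteq> (\<Union>x\<in>K. ball x (r x))" using r by auto
  with assms(1) obtain C where C: "C \<subseteq> K" "finite C" "K \<subseteq> (\<Union>x\<in>C. ball x (r x))"
    using compactE_image[of K K "\<lambda>x. ball x (r x)"] by (metis open_ball)
  define s where "s x = (\<Sum>c\<in>C. bump c (r c) x)" for x
  have s: "s \<in> C1c \<Omega>"
    unfolding s_def
  proof (rule C1c_sum[OF C(2)])
    fix i assume "i \<in> C"
    with C(1) have "i \<in> K" by blast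
    then show "bump i (r i) \<in> C1c \<Omega>" by (intro bump_C1c r)
  qed
  have s0: "s x \<ge> 0" for x unfolding s_def by (intro sum_nonneg bump_nonneg)
  have spos: "s x > 0" if x: "x \<in> K" for x
  proof -
    obtain c where c: "c \<in> C" "x \<in> ball c (r c)" using C(3) x by blast
    then have "bump c (r c) x > 0" using r C by (subst bump_pos_iff) auto
    with c C show ?thesis unfolding s_def by (intro sum_pos2[of _ c]) (auto simp: bump_nonneg)
  qed
  have "\<exists>d>0. \<forall>x\<in>K. d \<le> s x"
  proof (cases "K = {}")
    case False
    have "continuous_on K s" using C1c_continuous[OF s] continuous_on_subset by blast
    from continuous_attains_inf[OF assms(1) False this] spos show ?thesis by blast
  qed (auto intro: exI[of _ 1])
  then obtain d where d: "d > 0" "\<And>x. x \<in> K \<Longrightarrow> d \<le> s x" by blast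
  show ?thesis
  proof (rule that[of "\<lambda>x. (1/d) * s x"])
    show "(\<lambda>x. (1/d) * s x) \<in> C1c \<Omega>" by (rule C1c_cmult(1)[OF s])
  qed (use d s0 in \<open>auto simp: field_simps\<close>)
qed

lemma continuous_zero_off_compact_integrable:
  fixes f :: "'a::euclidean_space \<Rightarrow> 'b::euclidean_space"
  assumes f: "continuous_on UNIV f" and K: "compact K" "\<And>x. x \<notin> K \<Longrightarrow> f x = 0"
  shows "integrable lborel f"
proof -
  have "integrable lborel (\<lambda>x. indicator K x *\<^sub>R f x)"
    using assms continuous_on_subset by (intro borel_integrable_compact) blast+
  moreover have "(\<lambda>x. indicator K x *\<^sub>R f x) = f" using K by (auto simp: indicator_def)
  ultimately show ?thesis by simp
qed

lemma C1c_integrable: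
  assumes "\<phi> \<in> C1c \<Omega>"
  shows "integrable lborel \<phi>" "integrable lborel (grad \<phi>)" "integrable lborel (\<lambda>x. (\<phi> x)\<^sup>2)"
    "integrable lborel (\<lambda>x. (norm (grad \<phi> x))\<^sup>2)" "integrable lborel (\<lambda>x. \<bar>\<phi> x\<bar>)"
proof -
  obtain K where K: "compact K" "\<And>x. x \<notin> K \<Longrightarrow> \<phi> x = 0" "\<And>x. x \<notin> K \<Longrightarrow> grad \<phi> x = 0"
    by (rule C1c_support[OF assms]) blast
  note c = C1c_continuous[OF assms] C1c_continuous_grad[OF assms]
  show "integrable lborel \<phi>" "integrable lborel (grad \<phi>)" "integrable lborel (\<lambda>x. (\<phi> x)\<^sup>2)"
    "integrable lborel (\<lambda>x. (norm (grad \<phi> x))\<^sup>2)" "integrable lborel (\<lambda>x. \<bar>\<phi> x\<bar>)"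
    by (rule continuous_zero_off_compact_integrable[OF _ K(1)]; use K c in \<open>auto intro!: continuous_intros\<close>)+
qed

lemma C1c_Lipschitz:
  assumes "\<phi> \<in> C1c \<Omega>" "\<And>x. norm (grad \<phi> x) \<le> B"
  shows "\<bar>\<phi> y - \<phi> x\<bar> \<le> B * norm (y - x)"
proof -
  have "norm (\<phi> y - \<phi> x) \<le> B * norm (y - x)"
  proof (rule differentiable_bound[of UNIV \<phi> "\<lambda>x h. grad \<phi> x \<bullet> h"])
    show "onorm (\<lambda>h. grad \<phi> x \<bullet> h) \<le> B" for x
    proof (rule onorm_bound)
      show "0 \<le> B" using assms(2) norm_ge_zero order_trans by blast
      fix h show "norm (grad \<phi> x \<bullet> h) \<le> B * norm h"
        using Cauchy_Schwarz_ineq2[of "grad \<phi> x" h] mult_right_mono[OF assms(2)[of x] norm_ge_zero[of h]]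
        by simp
    qed
  qed (use C1c_has_derivative[OF assms(1)] in auto)
  then show ?thesis by simp
qed

lemma lborel_integral_shift:
  fixes f :: "'a::euclidean_space \<Rightarrow> 'b::euclidean_space"
  assumes "f \<in> borel_measurable borel"
  shows "(\<integral>x. f (y + x) \<partial>lborel) = (\<integral>x. f x \<partial>lborel)"
    and "integrable lborel (\<lambda>x. f (y + x)) \<longleftrightarrow> integrable lborel f"
  using integral_distr[of "(+) y" lborel borel f] integrable_distr_eq[of "(+) y" lborel borel f] assms
  by (simp_all add: lborel_distr_plus)

text \<open>
  Difference quotients of an integrable function have integral zero by translation invariance, and
  they converge dominatedly to the directional derivative.
\<close>

lemma C1c_integral_grad_zero:
  fixes \<psi> :: "real^'N \<Rightarrow> real"
  assumes "\<psi> \<in> C1c \<Omega>"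
  shows "(\<integral>x. grad \<psi> x \<partial>lborel) = 0"
proof -
  obtain K where K: "compact K" "\<And>x. x \<notin> K \<Longrightarrow> \<psi> x = 0" "\<And>x. x \<notin> K \<Longrightarrow> grad \<psi> x = 0"
    by (rule C1c_support[OF assms]) blast
  obtain B where B: "B > 0" "\<And>x. norm (grad \<psi> x) \<le> B"
    by (rule C1c_bounded[OF assms]) blast
  obtain R where R: "\<And>x. x \<in> K \<Longrightarrow> norm x \<le> R" "R > 0"
    using compact_imp_bounded[OF K(1)] by (auto simp: bounded_pos)
  note [measurable] = borel_measurable_continuous_onI[OF C1c_continuous[OF assms]]
    borel_measurable_continuous_onI[OF C1c_continuous_grad[OF assms]]
  have dir: "(\<integral>x. grad \<psi> x \<bullet> e \<partial>lborel) = 0" for e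
  proof -
    define t where "t k = inverse (real (Suc k))" for k
    have t0: "t \<longlonglongrightarrow> 0" unfolding t_def by (rule LIMSEQ_inverse_real_of_nat)
    have tp: "t k > 0" "t k \<le> 1" for k by (auto simp: t_def field_simps)
    have shift: "(\<integral>x. (\<psi> (t k *\<^sub>R e + x) - \<psi> x) / t k \<partial>lborel) = 0" for k
      using lborel_integral_shift[of \<psi> "t k *\<^sub>R e"] C1c_integrable(1)[OF assms] by simp
    have "(\<lambda>k. \<integral>x. (\<psi> (t k *\<^sub>R e + x) - \<psi> x) / t k \<partial>lborel) \<longlonglongrightarrow> (\<integral>x. grad \<psi> x \<bullet> e \<partial>lborel)"
    proof (rule integral_dominated_convergence)
      show "integrable lborel (\<lambda>x::real^'N. (B * norm e) * indicator (cball 0 (R + norm e)) x)"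
        by (intro integrable_mult_right integrable_real_indicator)
          (auto simp: emeasure_lborel_cball_finite[unfolded infinity_ennreal_def])
      show "AE x in lborel. (\<lambda>k. (\<psi> (t k *\<^sub>R e + x) - \<psi> x) / t k) \<longlonglongrightarrow> grad \<psi> x \<bullet> e"
      proof (rule AE_I2)
        fix x
        have "((\<lambda>s. x + s *\<^sub>R e) has_derivative (\<lambda>s. s *\<^sub>R e)) (at 0)"
          by (auto intro!: derivative_eq_intros)
        moreover have "(\<psi> has_derivative (\<lambda>h. grad \<psi> x \<bullet> h)) (at (x + 0 *\<^sub>R e))"
          using C1c_has_derivative[OF assms] by simp
        ultimately have "((\<lambda>s. \<psi> (x + s *\<^sub>R e)) has_derivative (\<lambda>s. grad \<psi> x \<bullet> (s *\<^sub>R e))) (at 0)"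
          by (rule has_derivative_compose)
        then have "((\<lambda>s. \<psi> (x + s *\<^sub>R e)) has_real_derivative (grad \<psi> x \<bullet> e)) (at 0)"
          by (simp add: has_field_derivative_def mult_commute_abs)
        then have "((\<lambda>h. (\<psi> (x + h *\<^sub>R e) - \<psi> x) / h) \<longlongrightarrow> grad \<psi> x \<bullet> e) (at 0)"
          by (simp add: DERIV_def)
        moreover have "filterlim t (at 0) sequentially"
          using t0 tp by (intro filterlim_atI) (auto simp: less_imp_neq[symmetric])
        ultimately show "(\<lambda>k. (\<psi> (t k *\<^sub>R e + x) - \<psi> x) / t k) \<longlonglongrightarrow> grad \<psi> x \<bullet> e"
          by (auto dest: filterlim_compose simp: add.commute)
      qed
      show "AE x in lborel. norm ((\<psi> (t k *\<^sub>R e + x) - \<psi> x) / t k) \<le> (B * norm e) * indicator (cball 0 (R + norm e)) x" for k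
      proof (rule AE_I2)
        fix x
        show "norm ((\<psi> (t k *\<^sub>R e + x) - \<psi> x) / t k) \<le> (B * norm e) * indicator (cball 0 (R + norm e)) x"
        proof (cases "norm x \<le> R + norm e")
          case True
          have "\<bar>\<psi> (t k *\<^sub>R e + x) - \<psi> x\<bar> \<le> B * norm (t k *\<^sub>R e)"
            using C1c_Lipschitz[OF assms B(2), of "t k *\<^sub>R e + x" x] by simp
          then show ?thesis using True tp[of k] by (simp add: field_simps)
        next
          case False
          have "norm x \<le> norm (t k *\<^sub>R e + x) + norm (t k *\<^sub>R e)"
            by (metis add_diff_cancel_left' norm_triangle_ineq4 add.commute)
          moreover have "norm (t k *\<^sub>R e) \<le> norm e" using tp[of k] by (simp add: mult_left_le_one_le)
          ultimately have "t k *\<^sub>R e + x \<notin> K" "x \<notin> K" using R(1)[of "t k *\<^sub>R e + x"] R(1)[of x] False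
              norm_ge_zero[of e] by linarith+
          then show ?thesis using K(2) B(1) by (simp add: indicator_def)
        qed
      qed
    qed auto
    then show ?thesis unfolding shift by (simp only: LIMSEQ_const_iff)
  qed
  have "(\<integral>x. grad \<psi> x \<partial>lborel) \<bullet> (\<integral>x. grad \<psi> x \<partial>lborel) = 0"
    using dir[of "\<integral>x. grad \<psi> x \<partial>lborel"] C1c_integrable(2)[OF assms] by simp
  then show ?thesis by simp
qed

section \<open>Uniqueness of weak gradients\<close>

lemma AE_lebesgue_on_iff:
  "S \<in> sets lebesgue \<Longrightarrow> (AE x in lebesgue_on S. P x) \<longleftrightarrow> (AE x in lebesgue. x \<in> S \<longrightarrow> P x)"
  by (simp add: AE_restrict_space_iff)

lemma AE_lebesgue_on_subset:
  assumes "AE x in lebesgue_on \<Omega>. P x" "S \<subseteq> \<Omega>" "S \<in> sets lebesgue" "\<Omega> \<in> sets lebesgue"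
  shows "AE x in lebesgue_on S. P x"
  using assms(1) unfolding AE_lebesgue_on_iff[OF assms(3)] AE_lebesgue_on_iff[OF assms(4)]
  by (rule AE_mp) (use assms(2) in auto)

text \<open>By the Lindelof property countably many of the neighbourhoods suffice.\<close>

lemma AE_lebesgue_on_local:
  assumes "\<Omega> \<in> sets lebesgue"
    and loc: "\<And>x. x \<in> \<Omega> \<Longrightarrow> \<exists>U. open U \<and> x \<in> U \<and> (AE y in lebesgue_on U. P y)"
  shows "AE x in lebesgue_on \<Omega>. P x"
proof -
  define \<U> where "\<U> = {U. open U \<and> (AE y in lebesgue_on U. P y)}"
  obtain \<V> where V: "\<V> \<subseteq> \<U>" "countable \<V>" "\<Union>\<V> = \<Union>\<U>"
    using Lindelof[of \<U>] unfolding \<U>_def by blast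
  have "AE x in lebesgue. \<forall>U\<in>\<V>. x \<in> U \<longrightarrow> P x"
  proof (rule AE_ball_countable[THEN iffD2, OF V(2)], rule ballI)
    fix U assume "U \<in> \<V>"
    then have "open U" "AE y in lebesgue_on U. P y" using V(1) by (auto simp: \<U>_def)
    then show "AE x in lebesgue. x \<in> U \<longrightarrow> P x" by (simp add: AE_lebesgue_on_iff)
  qed
  then have "AE x in lebesgue. x \<in> \<Omega> \<longrightarrow> P x"
  proof eventually_elim
    case (elim x)
    show ?case
    proof
      assume "x \<in> \<Omega>"
      then have "x \<in> \<Union>\<U>" using loc unfolding \<U>_def by blast
      then show "P x" using V(3) elim by blast
    qed
  qed
  then show ?thesis using assms(1) by (simp add: AE_lebesgue_on_iff)
qed

lemma measurable_lebesgue_on_AE_eq: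
  fixes f g :: "'a::euclidean_space \<Rightarrow> 'b::euclidean_space"
  assumes "f \<in> borel_measurable (lebesgue_on \<Omega>)" "\<Omega> \<in> sets lebesgue" "AE x in lebesgue_on \<Omega>. f x = g x"
  shows "g \<in> borel_measurable (lebesgue_on \<Omega>)"
proof -
  have "(\<lambda>x. if x \<in> \<Omega> then f x else 0) \<in> borel_measurable lebesgue"
    using assms(1,2) by (simp add: borel_measurable_if)
  moreover have "AE x in lebesgue. (if x \<in> \<Omega> then f x else 0) = (if x \<in> \<Omega> then g x else 0)"
    using assms(3)[unfolded AE_lebesgue_on_iff[OF assms(2)]] by eventually_elim auto
  ultimately have "(\<lambda>x. if x \<in> \<Omega> then g x else 0) \<in> borel_measurable lebesgue"
    by (rule borel_measurable_AE)
  then show ?thesis using assms(2) by (simp add: borel_measurable_if)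
qed

lemma integral_lebesgue_on_subset:
  fixes f :: "'a::euclidean_space \<Rightarrow> 'b::euclidean_space"
  assumes "K \<subseteq> \<Omega>" "K \<in> sets lebesgue" "\<Omega> \<in> sets lebesgue" "\<And>x. x \<in> \<Omega> \<Longrightarrow> x \<notin> K \<Longrightarrow> f x = 0"
  shows "integral\<^sup>L (lebesgue_on \<Omega>) f = integral\<^sup>L (lebesgue_on K) f"
    and "integrable (lebesgue_on \<Omega>) f \<longleftrightarrow> integrable (lebesgue_on K) f"
proof -
  have "integral\<^sup>L (lebesgue_on \<Omega>) f = integral\<^sup>L (lebesgue_on \<Omega>) (\<lambda>x. if x \<in> K then f x else 0)"
    using assms(4) by (intro Bochner_Integration.integral_cong) auto
  also have "\<dots> = integral\<^sup>L (lebesgue_on K) f" by (rule integral_restrict[OF assms(1-3)])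
  finally show "integral\<^sup>L (lebesgue_on \<Omega>) f = integral\<^sup>L (lebesgue_on K) f" .
  have "(\<lambda>x. if x \<in> \<Omega> then f x else 0) = (\<lambda>x. if x \<in> K then f x else 0)"
    by (rule ext) (use assms(1,4) in auto)
  with Lebesgue_Measure.integrable_restrict_UNIV[OF assms(2), of f]
    Lebesgue_Measure.integrable_restrict_UNIV[OF assms(3), of f]
  show "integrable (lebesgue_on \<Omega>) f \<longleftrightarrow> integrable (lebesgue_on K) f" by simp
qed

text \<open>Clamping preserves the limit, so the approximations obey the bound of \<open>g\<close>; this is what dominated convergence will ask for.\<close>

lemma bounded_measurable_approx_continuous:
  fixes g :: "'a::euclidean_space \<Rightarrow> real"
  assumes "g \<in> borel_measurable (lebesgue_on \<Omega>)" "\<Omega> \<in> sets lebesgue" "\<And>x. x \<in> \<Omega> \<Longrightarrow> \<bar>g x\<bar> \<le> B" "0 \<le> B"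
  obtains \<psi> :: "nat \<Rightarrow> 'a \<Rightarrow> real" where "\<And>i. continuous_on UNIV (\<psi> i)" "\<And>i x. \<bar>\<psi> i x\<bar> \<le> B"
    "AE x in lebesgue_on \<Omega>. (\<lambda>i. \<psi> i x) \<longlonglongrightarrow> g x"
proof -
  have "g measurable_on \<Omega>"
    using assms(1,2) by (simp add: measurable_on_iff_borel_measurable)
  then obtain N and q :: "nat \<Rightarrow> 'a \<Rightarrow> real" where N: "negligible N" and q: "\<And>n. continuous_on UNIV (q n)"
    and lim: "\<And>x. x \<notin> N \<Longrightarrow> (\<lambda>n. q n x) \<longlonglongrightarrow> (if x \<in> \<Omega> then g x else 0)"
    unfolding measurable_on_def by blast
  define \<psi> where "\<psi> n x = max (-B) (min B (q n x))" for n x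
  show ?thesis
  proof (rule that[of \<psi>])
    show "continuous_on UNIV (\<psi> i)" for i
      unfolding \<psi>_def by (intro continuous_intros q)
    show "\<bar>\<psi> i x\<bar> \<le> B" for i x unfolding \<psi>_def using assms(4) by auto
    have "AE x in lebesgue. x \<notin> N"
      using N by (simp add: negligible_iff_null_sets AE_not_in)
    then have "AE x in lebesgue. x \<in> \<Omega> \<longrightarrow> (\<lambda>i. \<psi> i x) \<longlonglongrightarrow> g x"
    proof eventually_elim
      case (elim x)
      show ?case
      proof
        assume x: "x \<in> \<Omega>"
        have "(\<lambda>i. \<psi> i x) \<longlonglongrightarrow> max (-B) (min B (g x))"
          unfolding \<psi>_def using lim[OF elim] x by (intro tendsto_intros) auto
        moreover have "max (-B) (min B (g x)) = g x" using assms(3)[OF x] by auto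
        ultimately show "(\<lambda>i. \<psi> i x) \<longlonglongrightarrow> g x" by simp
      qed
    qed
    then show "AE x in lebesgue_on \<Omega>. (\<lambda>i. \<psi> i x) \<longlonglongrightarrow> g x"
      by (simp add: AE_lebesgue_on_iff[OF assms(2)])
  qed
qed

lemma real_polynomial_function_C1:
  fixes p :: "real^'N \<Rightarrow> real"
  assumes "real_polynomial_function p"
  shows "\<exists>g. continuous_on UNIV g \<and> (\<forall>x. (p has_derivative (\<lambda>h. g x \<bullet> h)) (at x))"
  using assms
proof (induction p rule: real_polynomial_function.induct)
  case (linear f)
  have D: "(f has_derivative f) (at x)" for x by (rule bounded_linear_imp_has_derivative[OF linear])
  have "grad f x = grad f 0" for x
    using frechet_derivative_at[OF D, of x] frechet_derivative_at[OF D, of 0] by (simp add: grad_def)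
  moreover have "(f has_derivative (\<lambda>h. grad f x \<bullet> h)) (at x)" for x
    using D by (intro has_derivative_grad) (auto simp: differentiable_def)
  ultimately have "(f has_derivative (\<lambda>h. grad f 0 \<bullet> h)) (at x)" for x by metis
  then show ?case using continuous_on_const by blast
next
  case (const c)
  show ?case by (intro exI[of _ "\<lambda>_. 0"]) auto
next
  case (add f g)
  then obtain a b where "continuous_on UNIV a" "continuous_on UNIV b"
    "\<And>x. (f has_derivative (\<lambda>h. a x \<bullet> h)) (at x)" "\<And>x. (g has_derivative (\<lambda>h. b x \<bullet> h)) (at x)" by blast
  then show ?case
    by (intro exI[of _ "\<lambda>x. a x + b x"]) (auto intro!: continuous_intros has_derivative_add simp: inner_add_left)
next
  case (mult f g)
  then obtain a b where c: "continuous_on UNIV a" "continuous_on UNIV b"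
    and D: "\<And>x. (f has_derivative (\<lambda>h. a x \<bullet> h)) (at x)" "\<And>x. (g has_derivative (\<lambda>h. b x \<bullet> h)) (at x)" by blast
  have "continuous_on UNIV f" "continuous_on UNIV g"
    using D by (auto intro!: continuous_at_imp_continuous_on has_derivative_continuous)
  with c have "continuous_on UNIV (\<lambda>x. f x *\<^sub>R b x + g x *\<^sub>R a x)" by (intro continuous_intros)
  moreover have "((\<lambda>x. f x * g x) has_derivative (\<lambda>h. (f x *\<^sub>R b x + g x *\<^sub>R a x) \<bullet> h)) (at x)" for x
    using has_derivative_mult[OF D] by (simp add: inner_add_left mult.commute)
  ultimately show ?case by blast
qed

lemma Lp_loc_1_integrable:
  fixes h :: "'a::euclidean_space \<Rightarrow> 'b::{banach,second_countable_topology}"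
  shows "h \<in> Lp_loc 1 \<Omega> \<Longrightarrow> compact K \<Longrightarrow> K \<subseteq> \<Omega> \<Longrightarrow> integrable (lebesgue_on K) h"
  unfolding Lp_loc_def Lp_def by (auto simp: integrable_norm_iff)

lemma Lp_loc_1_I:
  fixes h :: "'a::euclidean_space \<Rightarrow> 'b::{banach,second_countable_topology}"
  assumes "\<And>K. compact K \<Longrightarrow> K \<subseteq> \<Omega> \<Longrightarrow> integrable (lebesgue_on K) h"
  shows "h \<in> Lp_loc 1 \<Omega>"
  unfolding Lp_loc_def Lp_def using assms by auto

lemma compact_sets_lebesgue: "compact K \<Longrightarrow> K \<in> sets lebesgue"
  by (simp add: compact_imp_closed)

text \<open>
  Localized by a bump \<open>s\<close>, one would like to test with \<open>s sgn h\<close>. The sign is almost everywhere a limit of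
  bounded continuous functions, and these are uniformly close to polynomials on the support of \<open>s\<close>.
  Since \<open>s\<close> times a polynomial is a test function, \<open>\<integral>s |h| = 0\<close> follows.
\<close>

lemma fundamental_lemma:
  fixes h :: "real^'N \<Rightarrow> real"
  assumes "open \<Omega>" and h: "h \<in> Lp_loc 1 \<Omega>"
    and zero: "\<And>\<phi>. \<phi> \<in> C1c \<Omega> \<Longrightarrow> (\<integral>x. \<phi> x * h x \<partial>lebesgue_on \<Omega>) = 0"
  shows "AE x in lebesgue_on \<Omega>. h x = 0"
proof (rule AE_lebesgue_on_local)
  show "\<Omega> \<in> sets lebesgue" using assms(1) by simp
  note Om = this
  fix a assume "a \<in> \<Omega>"
  then obtain r where r: "r > 0" "cball a r \<subseteq> \<Omega>" using assms(1) open_contains_cball by blast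
  define K where "K = cball a r"
  define s where "s = bump a r"
  have K: "compact K" "K \<subseteq> \<Omega>" "K \<in> sets lebesgue" using r by (auto simp: K_def)
  have s: "s \<in> C1c \<Omega>" unfolding s_def by (rule bump_C1c[OF r])
  have s0: "s x \<ge> 0" "x \<notin> K \<Longrightarrow> s x = 0" for x
    using bump_nonneg[of a r x] bump_pos_iff[OF r(1), of a x] by (auto simp: s_def K_def not_less)
  obtain S where S: "\<And>x. \<bar>s x\<bar> \<le> S" "S > 0" by (rule C1c_bounded[OF s]) blast
  have hK: "integrable (lebesgue_on K) h" by (rule Lp_loc_1_integrable[OF h K(1,2)])
  note [measurable] = borel_measurable_integrable[OF hK]
  have [measurable]: "s \<in> borel_measurable (lebesgue_on K)"
    by (rule continuous_borel_lebesgue_on[OF C1c_continuous[OF s]])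
  obtain \<psi> where \<psi>: "\<And>i::nat. continuous_on UNIV (\<psi> i)" "\<And>i x. \<bar>\<psi> i x\<bar> \<le> 1"
      "AE x in lebesgue_on K. (\<lambda>i. \<psi> i x) \<longlonglongrightarrow> sgn (h x)"
    by (rule bounded_measurable_approx_continuous[of "\<lambda>x. sgn (h x)" K 1]) (auto simp: sgn_if K(3))
  have "\<exists>p. real_polynomial_function p \<and> (\<forall>x\<in>K. \<bar>\<psi> i x - p x\<bar> < inverse (Suc i))" for i
    by (rule Stone_Weierstrass_real_polynomial_function[OF K(1) continuous_on_subset[OF \<psi>(1)], of "inverse (Suc i)" i])
      auto
  then obtain p where p: "\<And>i. real_polynomial_function (p i)"
    and near: "\<And>i x. x \<in> K \<Longrightarrow> \<bar>\<psi> i x - p i x\<bar> < inverse (Suc i)" by metis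
  have sp: "(\<lambda>x. s x * p i x) \<in> C1c \<Omega>" for i
    using real_polynomial_function_C1[OF p[of i]] C1c_mult(1)[OF s] by blast
  have "(\<lambda>i. \<integral>x. s x * p i x * h x \<partial>lebesgue_on K) \<longlonglongrightarrow> (\<integral>x. s x * sgn (h x) * h x \<partial>lebesgue_on K)"
  proof (rule integral_dominated_convergence)
    show "integrable (lebesgue_on K) (\<lambda>x. S * 2 * norm (h x))"
      using hK by (intro integrable_mult_right integrable_norm)
    show "(\<lambda>x. s x * p i x * h x) \<in> borel_measurable (lebesgue_on K)" for i
      using continuous_borel_lebesgue_on[OF C1c_continuous[OF sp]] by measurable
    show "AE x in lebesgue_on K. (\<lambda>i. s x * p i x * h x) \<longlonglongrightarrow> s x * sgn (h x) * h x"
      using \<psi>(3) AE_space[of "lebesgue_on K"]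
    proof eventually_elim
      case (elim x)
      have "(\<lambda>i. p i x - \<psi> i x) \<longlonglongrightarrow> 0"
      proof (rule Lim_null_comparison[OF _ LIMSEQ_inverse_real_of_nat])
        show "\<forall>\<^sub>F i in sequentially. norm (p i x - \<psi> i x) \<le> inverse (real (Suc i))"
          using near[of x] elim(2) by (auto simp: abs_minus_commute intro!: always_eventually less_imp_le)
      qed
      from tendsto_add[OF this elim(1)] have "(\<lambda>i. p i x) \<longlonglongrightarrow> sgn (h x)" by simp
      then show ?case by (intro tendsto_intros)
    qed
    show "AE x in lebesgue_on K. norm (s x * p i x * h x) \<le> S * 2 * norm (h x)" for i
    proof (rule AE_I2)
      fix x assume "x \<in> space (lebesgue_on K)"
      then have x: "x \<in> K" by simp
      have "inverse (real (Suc i)) \<le> 1" by (simp add: field_simps)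
      then have "\<bar>p i x\<bar> \<le> 2" using near[OF x, of i] \<psi>(2)[of i x] by linarith
      then have "\<bar>s x\<bar> * \<bar>p i x\<bar> \<le> S * 2" using S by (intro mult_mono) (auto intro: less_imp_le)
      then show "norm (s x * p i x * h x) \<le> S * 2 * norm (h x)"
        by (simp add: abs_mult mult_right_mono)
    qed
  qed measurable
  moreover have "(\<integral>x. s x * p i x * h x \<partial>lebesgue_on K) = 0" for i
    using integral_lebesgue_on_subset(1)[OF K(2,3) Om, of "\<lambda>x. s x * p i x * h x"] zero[OF sp[of i]] s0(2)
    by simp
  ultimately have "(\<integral>x. s x * sgn (h x) * h x \<partial>lebesgue_on K) = 0"
    by (simp add: LIMSEQ_const_iff)
  moreover have "s x * sgn (h x) * h x = s x * \<bar>h x\<bar>" for x by (auto simp: sgn_if)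
  ultimately have I0: "(\<integral>x. s x * \<bar>h x\<bar> \<partial>lebesgue_on K) = 0" by simp
  have "integrable (lebesgue_on K) (\<lambda>x. s x * \<bar>h x\<bar>)"
  proof (rule Bochner_Integration.integrable_bound)
    show "integrable (lebesgue_on K) (\<lambda>x. S * \<bar>h x\<bar>)" using hK by auto
    show "AE x in lebesgue_on K. norm (s x * \<bar>h x\<bar>) \<le> norm (S * \<bar>h x\<bar>)"
      using S by (auto simp: abs_mult intro!: mult_right_mono)
  qed measurable
  with I0 s0(1) have "AE x in lebesgue_on K. s x * \<bar>h x\<bar> = 0"
    by (subst (asm) integral_nonneg_eq_0_iff_AE) auto
  then have "AE x in lebesgue_on (ball a r). s x * \<bar>h x\<bar> = 0"
    by (rule AE_lebesgue_on_subset) (auto simp: K_def)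
  then have "AE x in lebesgue_on (ball a r). h x = 0"
    using AE_space[of "lebesgue_on (ball a r)"]
  proof eventually_elim
    case (elim x)
    then have "s x > 0" using bump_pos_iff[OF r(1), of a x] by (simp add: s_def)
    with elim(1) show ?case by simp
  qed
  then show "\<exists>U. open U \<and> a \<in> U \<and> (AE y in lebesgue_on U. h y = 0)"
    using r(1) by (intro exI[of _ "ball a r"]) auto
qed

lemma compact_support_mult_integrable:
  fixes \<phi> :: "'a::euclidean_space \<Rightarrow> real" and h :: "'a \<Rightarrow> 'b::euclidean_space"
  assumes "\<Omega> \<in> sets lebesgue" "continuous_on UNIV \<phi>" "compact K" "K \<subseteq> \<Omega>" "\<And>x. x \<notin> K \<Longrightarrow> \<phi> x = 0" "h \<in> Lp_loc 1 \<Omega>"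
  shows "integrable (lebesgue_on \<Omega>) (\<lambda>x. \<phi> x *\<^sub>R h x)"
proof -
  obtain B where B: "\<And>x. norm (\<phi> x) \<le> B" by (rule continuous_zero_off_compact_bounded[OF assms(2,3,5)]) blast+
  have hK: "integrable (lebesgue_on K) h" by (rule Lp_loc_1_integrable[OF assms(6,3,4)])
  have "integrable (lebesgue_on K) (\<lambda>x. \<phi> x *\<^sub>R h x)"
  proof (rule Bochner_Integration.integrable_bound)
    show "integrable (lebesgue_on K) (\<lambda>x. B * norm (h x))" using hK by auto
    show "(\<lambda>x. \<phi> x *\<^sub>R h x) \<in> borel_measurable (lebesgue_on K)"
      using borel_measurable_integrable[OF hK] continuous_borel_lebesgue_on[OF assms(2)] by measurable
    show "AE x in lebesgue_on K. norm (\<phi> x *\<^sub>R h x) \<le> norm (B * norm (h x))"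
    proof (rule AE_I2)
      fix x
      have "norm (\<phi> x *\<^sub>R h x) \<le> B * norm (h x)" using B[of x] by (simp add: mult_right_mono)
      then show "norm (\<phi> x *\<^sub>R h x) \<le> norm (B * norm (h x))" by simp
    qed
  qed
  then show ?thesis
    using integral_lebesgue_on_subset(2)[OF assms(4) compact_sets_lebesgue[OF assms(3)] assms(1), of "\<lambda>x. \<phi> x *\<^sub>R h x"] assms(5)
    by simp
qed

lemma C1c_mult_integrable:
  fixes h :: "real^'N \<Rightarrow> 'b::euclidean_space"
  assumes "\<Omega> \<in> sets lebesgue" "\<phi> \<in> C1c \<Omega>" "h \<in> Lp_loc 1 \<Omega>"
  shows "integrable (lebesgue_on \<Omega>) (\<lambda>x. \<phi> x *\<^sub>R h x)"
proof -
  obtain K where "compact K" "K \<subseteq> \<Omega>" "\<And>x. x \<notin> K \<Longrightarrow> \<phi> x = 0" by (rule C1c_support[OF assms(2)]) blast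
  then show ?thesis
    by (intro compact_support_mult_integrable[OF assms(1) C1c_continuous[OF assms(2)] _ _ _ assms(3)]) auto
qed

lemma fundamental_lemma_vector:
  fixes h :: "real^'N \<Rightarrow> 'b::euclidean_space"
  assumes "open \<Omega>" and h: "h \<in> Lp_loc 1 \<Omega>"
    and zero: "\<And>\<phi>. \<phi> \<in> C1c \<Omega> \<Longrightarrow> (\<integral>x. \<phi> x *\<^sub>R h x \<partial>lebesgue_on \<Omega>) = 0"
  shows "AE x in lebesgue_on \<Omega>. h x = 0"
proof -
  have Om: "\<Omega> \<in> sets lebesgue" using assms(1) by simp
  have "AE x in lebesgue_on \<Omega>. h x \<bullet> b = 0" for b
  proof (rule fundamental_lemma[OF assms(1)])
    show "(\<lambda>x. h x \<bullet> b) \<in> Lp_loc 1 \<Omega>"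
      by (rule Lp_loc_1_I) (intro integrable_inner_left Lp_loc_1_integrable[OF h])
    show "(\<integral>x. \<phi> x * (h x \<bullet> b) \<partial>lebesgue_on \<Omega>) = 0" if "\<phi> \<in> C1c \<Omega>" for \<phi>
      using integral_inner_left[of b "lebesgue_on \<Omega>" "\<lambda>x. \<phi> x *\<^sub>R h x"] C1c_mult_integrable[OF Om that h] zero[OF that]
      by simp
  qed
  then have "AE x in lebesgue_on \<Omega>. \<forall>b\<in>Basis. h x \<bullet> b = 0"
    by (intro AE_finite_allI[OF finite_Basis])
  then show ?thesis
    by eventually_elim (metis euclidean_all_zero_iff)
qed

lemma has_weak_grad_unique:
  assumes "open \<Omega>" "has_weak_grad \<Omega> u g" "has_weak_grad \<Omega> u g'"
  shows "AE x in lebesgue_on \<Omega>. g x = g' x"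
proof -
  have Om: "\<Omega> \<in> sets lebesgue" using assms(1) by simp
  have gl: "g \<in> Lp_loc 1 \<Omega>" "g' \<in> Lp_loc 1 \<Omega>" using assms(2,3) by (auto simp: has_weak_grad_def)
  have "AE x in lebesgue_on \<Omega>. g x - g' x = 0"
  proof (rule fundamental_lemma_vector[OF assms(1)])
    show "(\<lambda>x. g x - g' x) \<in> Lp_loc 1 \<Omega>"
      by (rule Lp_loc_1_I) (intro Bochner_Integration.integrable_diff Lp_loc_1_integrable[OF gl(1)] Lp_loc_1_integrable[OF gl(2)])
    show "(\<integral>x. \<phi> x *\<^sub>R (g x - g' x) \<partial>lebesgue_on \<Omega>) = 0" if "\<phi> \<in> C1c \<Omega>" for \<phi>
    proof -
      have "(\<integral>x. \<phi> x *\<^sub>R g x \<partial>lebesgue_on \<Omega>) = (\<integral>x. \<phi> x *\<^sub>R g' x \<partial>lebesgue_on \<Omega>)"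
      proof -
        have "- (\<integral>x. \<phi> x *\<^sub>R g x \<partial>lebesgue_on \<Omega>) = - (\<integral>x. \<phi> x *\<^sub>R g' x \<partial>lebesgue_on \<Omega>)"
          using bspec[OF conjunct2[OF conjunct2[OF assms(2)[unfolded has_weak_grad_def]]] that]
            bspec[OF conjunct2[OF conjunct2[OF assms(3)[unfolded has_weak_grad_def]]] that] by (rule trans[OF sym])
        then show ?thesis by (simp only: neg_equal_iff_equal)
      qed
      then show ?thesis
        using C1c_mult_integrable[OF Om that gl(1)] C1c_mult_integrable[OF Om that gl(2)]
        by (simp add: scaleR_diff_right)
    qed
  qed
  then show ?thesis by eventually_elim simp
qed

lemma has_weak_grad_weak_grad: "has_weak_grad \<Omega> u g \<Longrightarrow> has_weak_grad \<Omega> u (weak_grad \<Omega> u)"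
  unfolding weak_grad_def by (rule someI[of "has_weak_grad \<Omega> u"])

section \<open>The Nash inequality\<close>

lemma nn_integral_lborel_shift:
  fixes f :: "'a::euclidean_space \<Rightarrow> ennreal"
  assumes "f \<in> borel_measurable borel"
  shows "(\<integral>\<^sup>+x. f (y + x) \<partial>lborel) = (\<integral>\<^sup>+x. f x \<partial>lborel)"
  using nn_integral_distr[of "(+) y" lborel borel f] assms by (simp add: lborel_distr_plus)

text \<open>The increment is the integral of the derivative along the segment; Cauchy-Schwarz on the segment and Tonelli give the bound.\<close>

lemma C1c_translation_estimate:
  fixes \<phi> :: "real^'N \<Rightarrow> real"
  assumes "\<phi> \<in> C1c \<Omega>"
  shows "(\<integral>\<^sup>+x. ennreal ((\<phi> (x + y) - \<phi> x)\<^sup>2) \<partial>lborel) \<le> ennreal ((norm y)\<^sup>2 * (\<integral>x. (norm (grad \<phi> x))\<^sup>2 \<partial>lborel))"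
proof -
  define P where "P = restrict_space lborel {0..1::real}"
  have P1: "emeasure P (space P) = 1"
    by (simp add: P_def space_restrict_space emeasure_restrict_space)
  interpret P: finite_measure P
    by (rule finite_measureI) (simp add: P1)
  have mP: "measure P (space P) = 1" using P1 by (simp add: measure_def)
  interpret PL: pair_sigma_finite P lborel
    by unfold_locales
  have cg: "continuous_on UNIV (grad \<phi>)" by (rule C1c_continuous_grad[OF assms])
  have [measurable]: "grad \<phi> \<in> borel_measurable borel" using cg by (rule borel_measurable_continuous_onI)
  have [measurable]: "\<phi> \<in> borel_measurable borel"
    using C1c_continuous[OF assms] by (rule borel_measurable_continuous_onI)
  have [measurable]: "id \<in> measurable P borel" "(\<lambda>x. x) \<in> measurable P borel"
    unfolding P_def by (auto intro: measurable_restrict_space1)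
  obtain B where B: "B > 0" "\<And>x. norm (grad \<phi> x) \<le> B" by (rule C1c_bounded[OF assms]) blast
  define g where "g x t = grad \<phi> (x + t *\<^sub>R y)" for x t
  have gm[measurable]: "g x \<in> borel_measurable P" for x unfolding g_def by measurable
  have sq_le: "ennreal ((\<phi> (x + y) - \<phi> x)\<^sup>2) \<le> ennreal ((norm y)\<^sup>2) * (\<integral>\<^sup>+t. ennreal ((norm (g x t))\<^sup>2) \<partial>P)" for x
  proof -
    have gL: "g x \<in> L2 P"
    proof (rule L2_dominated[OF gm, of "\<lambda>_. B\<^sup>2"])
      show "integrable P (\<lambda>_. B\<^sup>2)" by simp
      show "(norm (g x t))\<^sup>2 \<le> B\<^sup>2" for t
        unfolding g_def by (intro power_mono B(2)) simp
    qed
    have cL: "(\<lambda>_. y) \<in> L2 P" by (auto simp: L2_def)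
    have "((\<lambda>t. \<phi> (x + t *\<^sub>R y)) has_vector_derivative (g x t \<bullet> y)) (at t within {0..1})" for t
    proof -
      have "((\<lambda>s. x + s *\<^sub>R y) has_derivative (\<lambda>s. s *\<^sub>R y)) (at t)"
        by (auto intro!: derivative_eq_intros)
      from has_derivative_compose[OF this C1c_has_derivative[OF assms]]
      have "((\<lambda>t. \<phi> (x + t *\<^sub>R y)) has_derivative (\<lambda>s. s *\<^sub>R (g x t \<bullet> y))) (at t)"
        by (simp add: g_def)
      then show ?thesis unfolding has_vector_derivative_def by (rule has_derivative_at_withinI)
    qed
    moreover have "continuous_on {0..1} (\<lambda>t. g x t \<bullet> y)"
      unfolding g_def by (intro continuous_intros continuous_on_compose2[OF cg]) auto
    ultimately have "(\<integral>t. indicator {0..1} t *\<^sub>R (g x t \<bullet> y) \<partial>lborel) = \<phi> (x + 1 *\<^sub>R y) - \<phi> (x + 0 *\<^sub>R y)"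
      by (intro integral_FTC_Icc) auto
    then have "(\<integral>t. g x t \<bullet> y \<partial>P) = \<phi> (x + y) - \<phi> x"
      unfolding P_def by (subst integral_restrict_space) auto
    with L2_Cauchy_Schwarz[OF gL cL] mP
    have "(\<phi> (x + y) - \<phi> x)\<^sup>2 \<le> sqn P (g x) * (norm y)\<^sup>2"
      by (simp add: sqn_def[of P "\<lambda>_. y"])
    then have "ennreal ((\<phi> (x + y) - \<phi> x)\<^sup>2) \<le> ennreal ((norm y)\<^sup>2) * ennreal (sqn P (g x))"
      by (subst ennreal_mult[symmetric]) (auto simp: sqn_nonneg mult.commute intro: ennreal_leI)
    also have "ennreal (sqn P (g x)) = (\<integral>\<^sup>+t. ennreal ((norm (g x t))\<^sup>2) \<partial>P)"
      unfolding sqn_def by (rule nn_integral_eq_integral[symmetric, OF L2_integrable_sq[OF gL]]) simp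
    finally show ?thesis .
  qed
  have gpair: "(\<lambda>(t, x). ennreal ((norm (g x t))\<^sup>2)) \<in> borel_measurable (P \<Otimes>\<^sub>M lborel)"
    unfolding g_def by measurable
  have "(\<integral>\<^sup>+x. ennreal ((\<phi> (x + y) - \<phi> x)\<^sup>2) \<partial>lborel)
     \<le> (\<integral>\<^sup>+x. ennreal ((norm y)\<^sup>2) * (\<integral>\<^sup>+t. ennreal ((norm (g x t))\<^sup>2) \<partial>P) \<partial>lborel)"
    by (intro nn_integral_mono sq_le)
  also have "\<dots> = ennreal ((norm y)\<^sup>2) * (\<integral>\<^sup>+x. \<integral>\<^sup>+t. ennreal ((norm (g x t))\<^sup>2) \<partial>P \<partial>lborel)"
  proof (rule nn_integral_cmult)
    show "(\<lambda>x. \<integral>\<^sup>+t. ennreal ((norm (g x t))\<^sup>2) \<partial>P) \<in> borel_measurable lborel"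
    proof -
      have "(\<lambda>(x, t). ennreal ((norm (g x t))\<^sup>2)) \<in> borel_measurable (lborel \<Otimes>\<^sub>M P)"
        unfolding g_def by measurable
      from P.borel_measurable_nn_integral[OF this] show ?thesis .
    qed
  qed
  also have "(\<integral>\<^sup>+x. \<integral>\<^sup>+t. ennreal ((norm (g x t))\<^sup>2) \<partial>P \<partial>lborel) = (\<integral>\<^sup>+t. \<integral>\<^sup>+x. ennreal ((norm (g x t))\<^sup>2) \<partial>lborel \<partial>P)"
    by (rule PL.Fubini'[OF gpair])
  also have "\<dots> = (\<integral>\<^sup>+t. \<integral>\<^sup>+x. ennreal ((norm (grad \<phi> x))\<^sup>2) \<partial>lborel \<partial>P)"
  proof (rule nn_integral_cong)
    fix t
    show "(\<integral>\<^sup>+x. ennreal ((norm (g x t))\<^sup>2) \<partial>lborel) = (\<integral>\<^sup>+x. ennreal ((norm (grad \<phi> x))\<^sup>2) \<partial>lborel)"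
      using nn_integral_lborel_shift[of "\<lambda>x. ennreal ((norm (grad \<phi> x))\<^sup>2)" "t *\<^sub>R y"]
      by (simp add: g_def add.commute)
  qed
  also have "\<dots> = (\<integral>\<^sup>+x. ennreal ((norm (grad \<phi> x))\<^sup>2) \<partial>lborel)"
    by (simp add: P1)
  also have "\<dots> = ennreal (\<integral>x. (norm (grad \<phi> x))\<^sup>2 \<partial>lborel)"
    by (rule nn_integral_eq_integral[OF C1c_integrable(4)[OF assms]]) simp
  also have "ennreal ((norm y)\<^sup>2) * \<dots> = ennreal ((norm y)\<^sup>2 * (\<integral>x. (norm (grad \<phi> x))\<^sup>2 \<partial>lborel))"
    by (simp add: ennreal_mult)
  finally show ?thesis .
qed

text \<open>
  Integrating \<open>\<phi>(x)\<^sup>2 \<le> (\<phi>(x + y) - \<phi>(x))\<^sup>2 + 2 |\<phi>(x)| |\<phi>(x + y)|\<close> in \<open>x\<close> and averaging over \<open>y\<close> in a ball of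
  radius \<open>R\<close> bounds the first term by the translation estimate, and the double integral of the second
  by the square of the \<open>L1\<close> norm.
\<close>

lemma C1c_Nash:
  fixes \<phi> :: "real^'N \<Rightarrow> real"
  assumes "\<phi> \<in> C1c \<Omega>" "R > 0"
  shows "(\<integral>x. (\<phi> x)\<^sup>2 \<partial>lborel) \<le> R\<^sup>2 * (\<integral>x. (norm (grad \<phi> x))\<^sup>2 \<partial>lborel)
     + 2 * (\<integral>x. \<bar>\<phi> x\<bar> \<partial>lborel)\<^sup>2 / measure lborel (ball (0::real^'N) R)"
proof -
  define a where "a = (\<integral>x. (\<phi> x)\<^sup>2 \<partial>lborel)"
  define E where "E = (\<integral>x. (norm (grad \<phi> x))\<^sup>2 \<partial>lborel)"
  define l where "l = (\<integral>x. \<bar>\<phi> x\<bar> \<partial>lborel)"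
  define V where "V = measure lborel (ball (0::real^'N) R)"
  note cphi = C1c_continuous[OF assms(1)]
  have [measurable]: "\<phi> \<in> borel_measurable borel"
    using cphi by (rule borel_measurable_continuous_onI)
  have E0: "E \<ge> 0" unfolding E_def by simp
  have V: "V > 0" unfolding V_def using assms(2) by simp
  have eV: "emeasure lborel (ball (0::real^'N) R) = ennreal V"
    unfolding V_def by (intro emeasure_eq_ennreal_measure) (simp add: emeasure_lborel_ball_finite less_imp_neq[OF emeasure_lborel_ball_finite[unfolded infinity_ennreal_def]])
  have key: "ennreal ((a - R\<^sup>2 * E) / 2) \<le> (\<integral>\<^sup>+x. ennreal (\<bar>\<phi> x\<bar> * \<bar>\<phi> (x + y)\<bar>) \<partial>lborel)" if y: "y \<in> ball 0 R" for y
  proof -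
    have sh: "integrable lborel (\<lambda>x. (\<phi> (x + y))\<^sup>2)"
      using lborel_integral_shift(2)[of "\<lambda>x. (\<phi> x)\<^sup>2" y] C1c_integrable(3)[OF assms(1)] by (simp add: add.commute)
    have idiff: "integrable lborel (\<lambda>x. (\<phi> (x + y) - \<phi> x)\<^sup>2)"
    proof (rule Bochner_Integration.integrable_bound)
      show "integrable lborel (\<lambda>x. 2 * (\<phi> (x + y))\<^sup>2 + 2 * (\<phi> x)\<^sup>2)"
        using sh C1c_integrable(3)[OF assms(1)] by auto
      have "(\<phi> (x + y) - \<phi> x)\<^sup>2 \<le> 2 * (\<phi> (x + y))\<^sup>2 + 2 * (\<phi> x)\<^sup>2" for x
        using norm_sum_sq_le[of "\<phi> (x + y)" "- \<phi> x"] by simp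
      then show "AE x in lborel. norm ((\<phi> (x + y) - \<phi> x)\<^sup>2) \<le> norm (2 * (\<phi> (x + y))\<^sup>2 + 2 * (\<phi> x)\<^sup>2)"
        by simp
    qed simp
    have iprod: "integrable lborel (\<lambda>x. \<bar>\<phi> x\<bar> * \<bar>\<phi> (x + y)\<bar>)"
    proof (rule Bochner_Integration.integrable_bound)
      show "integrable lborel (\<lambda>x. (\<phi> x)\<^sup>2 + (\<phi> (x + y))\<^sup>2)"
        using sh C1c_integrable(3)[OF assms(1)] by auto
      have "\<bar>\<phi> x\<bar> * \<bar>\<phi> (x + y)\<bar> \<le> (\<phi> x)\<^sup>2 + (\<phi> (x + y))\<^sup>2" for x
      proof -
        have "0 \<le> \<bar>\<phi> x\<bar> * \<bar>\<phi> (x + y)\<bar>" by simp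
        moreover have "2 * (\<bar>\<phi> x\<bar> * \<bar>\<phi> (x + y)\<bar>) \<le> (\<phi> x)\<^sup>2 + (\<phi> (x + y))\<^sup>2"
          using sum_squares_bound[of "\<bar>\<phi> x\<bar>" "\<bar>\<phi> (x + y)\<bar>"] by (simp add: mult.assoc)
        ultimately show ?thesis by linarith
      qed
      then show "AE x in lborel. norm (\<bar>\<phi> x\<bar> * \<bar>\<phi> (x + y)\<bar>) \<le> norm ((\<phi> x)\<^sup>2 + (\<phi> (x + y))\<^sup>2)"
        by simp
    qed simp
    have "ennreal (\<integral>x. (\<phi> (x + y) - \<phi> x)\<^sup>2 \<partial>lborel) \<le> ennreal ((norm y)\<^sup>2 * E)"
      using C1c_translation_estimate[OF assms(1), of y] nn_integral_eq_integral[OF idiff]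
      by (simp add: E_def)
    then have "(\<integral>x. (\<phi> (x + y) - \<phi> x)\<^sup>2 \<partial>lborel) \<le> (norm y)\<^sup>2 * E"
      using E0 by (subst (asm) ennreal_le_iff) auto
    also have "\<dots> \<le> R\<^sup>2 * E"
      using y E0 by (intro mult_right_mono power_mono) auto
    finally have tr: "(\<integral>x. (\<phi> (x + y) - \<phi> x)\<^sup>2 \<partial>lborel) \<le> R\<^sup>2 * E" .
    have "(\<phi> x)\<^sup>2 \<le> (\<phi> (x + y) - \<phi> x)\<^sup>2 + 2 * (\<bar>\<phi> x\<bar> * \<bar>\<phi> (x + y)\<bar>)" for x
    proof -
      have "(\<phi> (x + y) - \<phi> x)\<^sup>2 = (\<phi> (x + y))\<^sup>2 + (\<phi> x)\<^sup>2 - 2 * (\<phi> x * \<phi> (x + y))"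
        by (simp add: power2_eq_square algebra_simps)
      moreover have "\<phi> x * \<phi> (x + y) \<le> \<bar>\<phi> x\<bar> * \<bar>\<phi> (x + y)\<bar>" by (metis abs_ge_self abs_mult)
      moreover have "0 \<le> (\<phi> (x + y))\<^sup>2" by simp
      ultimately show ?thesis by linarith
    qed
    then have "a \<le> (\<integral>x. (\<phi> (x + y) - \<phi> x)\<^sup>2 + 2 * (\<bar>\<phi> x\<bar> * \<bar>\<phi> (x + y)\<bar>) \<partial>lborel)"
      unfolding a_def using idiff iprod C1c_integrable(3)[OF assms(1)] by (intro integral_mono) auto
    also have "\<dots> = (\<integral>x. (\<phi> (x + y) - \<phi> x)\<^sup>2 \<partial>lborel) + 2 * (\<integral>x. \<bar>\<phi> x\<bar> * \<bar>\<phi> (x + y)\<bar> \<partial>lborel)"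
      using idiff iprod by simp
    finally have aq: "a \<le> (\<integral>x. (\<phi> (x + y) - \<phi> x)\<^sup>2 \<partial>lborel) + 2 * (\<integral>x. \<bar>\<phi> x\<bar> * \<bar>\<phi> (x + y)\<bar> \<partial>lborel)" .
    have "(a - R\<^sup>2 * E) / 2 \<le> q" if "a \<le> p + 2 * q" "p \<le> R\<^sup>2 * E" for p q :: real
      using that by (simp add: field_simps)
    from this[OF aq tr] have "(a - R\<^sup>2 * E) / 2 \<le> (\<integral>x. \<bar>\<phi> x\<bar> * \<bar>\<phi> (x + y)\<bar> \<partial>lborel)" .
    then show ?thesis
      using nn_integral_eq_integral[OF iprod] by (simp add: ennreal_leI)
  qed
  have pm: "(\<lambda>(y, x). ennreal (\<bar>\<phi> x\<bar> * \<bar>\<phi> (x + y)\<bar>)) \<in> borel_measurable (lborel \<Otimes>\<^sub>M lborel)"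
    by measurable
  have "ennreal ((a - R\<^sup>2 * E) / 2) * ennreal V = (\<integral>\<^sup>+y. ennreal ((a - R\<^sup>2 * E) / 2) * indicator (ball (0::real^'N) R) y \<partial>lborel)"
    by (simp add: nn_integral_cmult_indicator eV)
  also have "\<dots> \<le> (\<integral>\<^sup>+y. \<integral>\<^sup>+x. ennreal (\<bar>\<phi> x\<bar> * \<bar>\<phi> (x + y)\<bar>) \<partial>lborel \<partial>lborel)"
    by (intro nn_integral_mono) (auto simp: indicator_def intro: key)
  also have "\<dots> = (\<integral>\<^sup>+x. \<integral>\<^sup>+y. ennreal (\<bar>\<phi> x\<bar> * \<bar>\<phi> (x + y)\<bar>) \<partial>lborel \<partial>lborel)"
    by (rule lborel_pair.Fubini'[OF pm, symmetric])
  also have "\<dots> = (\<integral>\<^sup>+x. ennreal \<bar>\<phi> x\<bar> * ennreal l \<partial>lborel)"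
  proof (rule nn_integral_cong)
    fix x
    have "(\<integral>\<^sup>+y. ennreal (\<bar>\<phi> x\<bar> * \<bar>\<phi> (x + y)\<bar>) \<partial>lborel) = ennreal \<bar>\<phi> x\<bar> * (\<integral>\<^sup>+y. ennreal \<bar>\<phi> (x + y)\<bar> \<partial>lborel)"
      by (subst nn_integral_cmult[symmetric]) (auto simp: ennreal_mult)
    also have "(\<integral>\<^sup>+y. ennreal \<bar>\<phi> (x + y)\<bar> \<partial>lborel) = (\<integral>\<^sup>+y. ennreal \<bar>\<phi> y\<bar> \<partial>lborel)"
      by (rule nn_integral_lborel_shift) measurable
    also have "\<dots> = ennreal l"
      unfolding l_def by (rule nn_integral_eq_integral[OF C1c_integrable(5)[OF assms(1)]]) simp
    finally show "(\<integral>\<^sup>+y. ennreal (\<bar>\<phi> x\<bar> * \<bar>\<phi> (x + y)\<bar>) \<partial>lborel) = ennreal \<bar>\<phi> x\<bar> * ennreal l" .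
  qed
  also have "\<dots> = ennreal l * ennreal l"
    using nn_integral_eq_integral[OF C1c_integrable(5)[OF assms(1)]]
    by (simp add: nn_integral_multc l_def)
  finally have fin: "ennreal ((a - R\<^sup>2 * E) / 2) * ennreal V \<le> ennreal l * ennreal l" .
  have l0: "l \<ge> 0" unfolding l_def by simp
  have "(a - R\<^sup>2 * E) / 2 * V \<le> l * l"
  proof (cases "a - R\<^sup>2 * E \<ge> 0")
    case True
    then have "ennreal ((a - R\<^sup>2 * E) / 2 * V) = ennreal ((a - R\<^sup>2 * E) / 2) * ennreal V"
      using V by (intro ennreal_mult) auto
    moreover have "ennreal (l * l) = ennreal l * ennreal l" using l0 by (rule ennreal_mult) (rule l0)
    ultimately have "ennreal ((a - R\<^sup>2 * E) / 2 * V) \<le> ennreal (l * l)" using fin by simp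
    then show ?thesis using l0 by (subst (asm) ennreal_le_iff) auto
  next
    case False
    then have "(a - R\<^sup>2 * E) / 2 * V \<le> 0" using V by (simp add: mult_le_0_iff)
    then show ?thesis using l0 by (meson order_trans mult_nonneg_nonneg)
  qed
  then have "a \<le> R\<^sup>2 * E + 2 * l\<^sup>2 / V" using V by (simp add: field_simps power2_eq_square)
  then show ?thesis by (simp add: a_def E_def l_def V_def)
qed

section \<open>The Sobolev space of functions vanishing on the boundary\<close>

lemma borel_measurable_fst': "U \<in> borel_measurable M \<Longrightarrow> (\<lambda>x. fst (U x)) \<in> borel_measurable M"
  and borel_measurable_snd': "U \<in> borel_measurable M \<Longrightarrow> (\<lambda>x. snd (U x)) \<in> borel_measurable M"
  by (erule measurable_compose, intro borel_measurable_continuous_onI continuous_intros)+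

lemma borel_measurable_norm': "f \<in> borel_measurable M \<Longrightarrow> (\<lambda>x. norm (f x)) \<in> borel_measurable M"
  by measurable

lemma L2_pair:
  fixes U :: "'a \<Rightarrow> 'b::euclidean_space \<times> 'c::euclidean_space"
  shows "U \<in> L2 M \<longleftrightarrow> (\<lambda>x. fst (U x)) \<in> L2 M \<and> (\<lambda>x. snd (U x)) \<in> L2 M"
proof safe
  assume U: "U \<in> L2 M"
  note [measurable] = L2_measurable[OF U]
  show "(\<lambda>x. fst (U x)) \<in> L2 M" "(\<lambda>x. snd (U x)) \<in> L2 M"
    by (rule L2_dominated[OF _ L2_integrable_sq[OF U]]; simp add: norm_prod_def borel_measurable_fst' borel_measurable_snd')+
next
  assume f: "(\<lambda>x. fst (U x)) \<in> L2 M" and g: "(\<lambda>x. snd (U x)) \<in> L2 M"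
  have "(\<lambda>x. (fst (U x), snd (U x))) \<in> borel_measurable M"
    using f g by (intro borel_measurable_Pair L2_measurable)
  then have m: "U \<in> borel_measurable M" by simp
  show "U \<in> L2 M"
    by (rule L2_dominated[OF m, where g = "\<lambda>x. (norm (fst (U x)))\<^sup>2 + (norm (snd (U x)))\<^sup>2"])
      (use L2_integrable_sq[OF f] L2_integrable_sq[OF g] in \<open>auto simp: norm_prod_def\<close>)
qed

lemma sqn_pair:
  fixes U :: "'a \<Rightarrow> 'b::euclidean_space \<times> 'c::euclidean_space"
  assumes "U \<in> L2 M"
  shows "sqn M U = sqn M (\<lambda>x. fst (U x)) + sqn M (\<lambda>x. snd (U x))"
proof -
  have "(norm (U x))\<^sup>2 = (norm (fst (U x)))\<^sup>2 + (norm (snd (U x)))\<^sup>2" for x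
    by (simp add: norm_prod_def)
  then show ?thesis
    using assms[unfolded L2_pair] unfolding sqn_def
    by (simp add: Bochner_Integration.integral_add[OF L2_integrable_sq L2_integrable_sq])
qed

lemma L2_AE_cong:
  assumes "f \<in> L2 M" "g \<in> borel_measurable M" "AE x in M. f x = g x"
  shows "g \<in> L2 M" "sqn M g = sqn M f"
proof -
  have sq: "AE x in M. (norm (f x))\<^sup>2 = (norm (g x))\<^sup>2" using assms(3) by eventually_elim simp
  have m: "(\<lambda>x. (norm (f x))\<^sup>2) \<in> borel_measurable M" "(\<lambda>x. (norm (g x))\<^sup>2) \<in> borel_measurable M"
    using L2_measurable[OF assms(1)] assms(2) by measurable
  show "g \<in> L2 M"
    using integrable_cong_AE[OF m sq] L2_integrable_sq[OF assms(1)] assms(2) by (simp add: L2_def)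
  show "sqn M g = sqn M f"
    using integral_cong_AE[OF m sq] by (simp add: sqn_def)
qed

lemma L2_tendsto_inner:
  assumes "\<And>k. f k \<in> L2 M" "F \<in> L2 M" "g \<in> L2 M" "(\<lambda>k. sqn M (\<lambda>x. f k x - F x)) \<longlonglongrightarrow> 0"
  shows "(\<lambda>k. \<integral>x. f k x \<bullet> g x \<partial>M) \<longlonglongrightarrow> (\<integral>x. F x \<bullet> g x \<partial>M)"
proof -
  have "(\<lambda>k. \<integral>x. (f k x - F x) \<bullet> g x \<partial>M) \<longlonglongrightarrow> 0"
  proof (rule Lim_null_comparison)
    have "norm (\<integral>x. (f k x - F x) \<bullet> g x \<partial>M) \<le> sqrt (sqn M (\<lambda>x. f k x - F x) * sqn M g)" for k
      using L2_Cauchy_Schwarz[OF L2_diff[OF assms(1) assms(2)] assms(3), of k]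
      by (simp add: real_le_rsqrt)
    then show "\<forall>\<^sub>F k in sequentially. norm (\<integral>x. (f k x - F x) \<bullet> g x \<partial>M) \<le> sqrt (sqn M (\<lambda>x. f k x - F x) * sqn M g)"
      by simp
    have "(\<lambda>k. sqrt (sqn M (\<lambda>x. f k x - F x) * sqn M g)) \<longlonglongrightarrow> sqrt (0 * sqn M g)"
      by (intro tendsto_intros assms(4))
    then show "(\<lambda>k. sqrt (sqn M (\<lambda>x. f k x - F x) * sqn M g)) \<longlonglongrightarrow> 0" by simp
  qed
  moreover have "(\<integral>x. (f k x - F x) \<bullet> g x \<partial>M) = (\<integral>x. f k x \<bullet> g x \<partial>M) - (\<integral>x. F x \<bullet> g x \<partial>M)" for k
    using L2_inner_integrable[OF assms(1,3)] L2_inner_integrable[OF assms(2,3)] by (simp add: inner_diff_left)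
  ultimately show ?thesis by (simp add: LIM_zero_iff)
qed

lemma L2_tendsto_sqn:
  assumes "\<And>k. f k \<in> L2 M" "F \<in> L2 M" "(\<lambda>k. sqn M (\<lambda>x. f k x - F x)) \<longlonglongrightarrow> 0"
  shows "(\<lambda>k. sqn M (f k)) \<longlonglongrightarrow> sqn M F"
proof -
  have "sqn M (f k) = sqn M (\<lambda>x. f k x - F x) + 2 * (\<integral>x. f k x \<bullet> F x \<partial>M) - sqn M F" for k
  proof -
    have "(\<integral>x. (f k x - F x) \<bullet> F x \<partial>M) = (\<integral>x. f k x \<bullet> F x \<partial>M) - sqn M F"
      using L2_inner_integrable[OF assms(1,2)] L2_inner_integrable[OF assms(2,2)]
      by (simp add: inner_diff_left sqn_def power2_norm_eq_inner)
    then show ?thesis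
      using L2_add_sqn[OF L2_diff[OF assms(1,2)] assms(2), of k 1] by simp
  qed
  moreover have "(\<lambda>k. sqn M (\<lambda>x. f k x - F x) + 2 * (\<integral>x. f k x \<bullet> F x \<partial>M) - sqn M F)
      \<longlonglongrightarrow> 0 + 2 * (\<integral>x. F x \<bullet> F x \<partial>M) - sqn M F"
    by (intro tendsto_intros assms L2_tendsto_inner)
  ultimately show ?thesis by (simp add: sqn_def power2_norm_eq_inner)
qed

text \<open>Cauchy-Schwarz against the indicator of a set carrying \<open>f\<close>.\<close>

lemma (in finite_measure) L1_sq_le:
  fixes f :: "'a \<Rightarrow> 'b::euclidean_space"
  assumes "f \<in> L2 M" "A \<in> sets M" "\<And>x. x \<in> space M \<Longrightarrow> x \<notin> A \<Longrightarrow> f x = 0"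
  shows "(\<integral>x. norm (f x) \<partial>M)\<^sup>2 \<le> measure M A * sqn M f"
proof -
  have 1: "(\<lambda>x. norm (f x)) \<in> L2 M"
    using L2_integrable_sq[OF assms(1)] borel_measurable_norm'[OF L2_measurable[OF assms(1)]] by (simp add: L2_def)
  have ind: "(norm (indicator A x :: real))\<^sup>2 = indicator A x" for x by (simp add: indicator_def)
  have "integrable M (\<lambda>x. (norm (indicator A x :: real))\<^sup>2)"
    unfolding ind using assms(2) by (intro integrable_real_indicator) (auto simp: emeasure_eq_measure)
  then have 2: "(indicator A :: 'a \<Rightarrow> real) \<in> L2 M" using assms(2) by (simp add: L2_def)
  have "(\<integral>x. norm (f x) * indicator A x \<partial>M) = (\<integral>x. norm (f x) \<partial>M)"
    using assms(3) by (intro Bochner_Integration.integral_cong) (auto simp: indicator_def)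
  moreover have "sqn M (indicator A :: 'a \<Rightarrow> real) = measure M A"
    unfolding sqn_def ind using assms(2) by simp
  moreover have "sqn M (\<lambda>x. norm (f x)) = sqn M f" by (simp add: sqn_def)
  ultimately show ?thesis using L2_Cauchy_Schwarz[OF 1 2] by (simp add: mult.commute)
qed

lemma (in finite_measure) L2_tendsto_L1:
  fixes f :: "nat \<Rightarrow> 'a \<Rightarrow> 'b::euclidean_space"
  assumes "\<And>k. f k \<in> L2 M" "(\<lambda>k. sqn M (f k)) \<longlonglongrightarrow> 0"
  shows "(\<lambda>k. \<integral>x. norm (f k x) \<partial>M) \<longlonglongrightarrow> 0"
proof (rule Lim_null_comparison)
  have "(\<integral>x. norm (f k x) \<partial>M) \<le> sqrt (measure M (space M) * sqn M (f k))" for k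
    using L1_sq_le[OF assms(1)[of k] sets.top] by (simp add: real_le_rsqrt)
  then show "\<forall>\<^sub>F k in sequentially. norm (\<integral>x. norm (f k x) \<partial>M) \<le> sqrt (measure M (space M) * sqn M (f k))"
    by simp
  have "(\<lambda>k. sqrt (measure M (space M) * sqn M (f k))) \<longlonglongrightarrow> sqrt (measure M (space M) * 0)"
    by (intro tendsto_intros assms(2))
  then show "(\<lambda>k. sqrt (measure M (space M) * sqn M (f k))) \<longlonglongrightarrow> 0" by simp
qed

definition jet :: "(real^'N \<Rightarrow> real) \<Rightarrow> real^'N \<Rightarrow> real \<times> (real^'N)"
  where "jet \<phi> x = (\<phi> x, grad \<phi> x)"

text \<open>
  \<open>W1p_0 2 \<Omega>\<close> as a closed subspace of a Hilbert space: a function is paired with its gradient, and the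
  space is the \<open>L2\<close>-closure of the pairs that come from test functions. This avoids chosen
  representatives of the gradient until the end.
\<close>

definition H0 :: "(real^'N) set \<Rightarrow> (real^'N \<Rightarrow> real \<times> (real^'N)) set"
  where "H0 \<Omega> = {U \<in> L2 (lebesgue_on \<Omega>). \<exists>\<phi>. (\<forall>k. \<phi> k \<in> C1c \<Omega>) \<and>
    (\<lambda>k::nat. sqn (lebesgue_on \<Omega>) (\<lambda>x. U x - jet (\<phi> k) x)) \<longlonglongrightarrow> 0}"

locale bounded_open_set =
  fixes \<Omega> :: "(real^'N) set"
  assumes open_Om: "open \<Omega>" and bounded_Om: "bounded \<Omega>"
begin

lemma Om_sets: "\<Omega> \<in> sets lebesgue" using open_Om by simp

sublocale finite_measure "lebesgue_on \<Omega>"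
  by (rule open_bounded_finite_measure[OF open_Om bounded_Om])

lemma bounded_measurable_L2:
  fixes f :: "real^'N \<Rightarrow> 'b::euclidean_space"
  assumes "f \<in> borel_measurable (lebesgue_on \<Omega>)" "AE x in lebesgue_on \<Omega>. norm (f x) \<le> B"
  shows "f \<in> L2 (lebesgue_on \<Omega>)"
proof -
  have "integrable (lebesgue_on \<Omega>) (\<lambda>x. (norm (f x))\<^sup>2)"
  proof (rule integrable_const_bound)
    show "AE x in lebesgue_on \<Omega>. norm ((norm (f x))\<^sup>2) \<le> B\<^sup>2"
      using assms(2) by eventually_elim (simp add: power_mono)
  qed (use assms(1) in measurable)
  then show ?thesis using assms(1) by (simp add: L2_def)
qed

lemma C1c_L2:
  assumes "\<phi> \<in> C1c \<Omega>"
  shows "\<phi> \<in> L2 (lebesgue_on \<Omega>)" "grad \<phi> \<in> L2 (lebesgue_on \<Omega>)" "jet \<phi> \<in> L2 (lebesgue_on \<Omega>)"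
proof -
  obtain B where B: "\<And>x. \<bar>\<phi> x\<bar> \<le> B" "\<And>x. norm (grad \<phi> x) \<le> B" by (rule C1c_bounded[OF assms]) blast
  show 1: "\<phi> \<in> L2 (lebesgue_on \<Omega>)"
    by (rule bounded_measurable_L2[OF continuous_borel_lebesgue_on[OF C1c_continuous[OF assms]], of B]) (simp add: B)
  show 2: "grad \<phi> \<in> L2 (lebesgue_on \<Omega>)"
    by (rule bounded_measurable_L2[OF continuous_borel_lebesgue_on[OF C1c_continuous_grad[OF assms]], of B]) (simp add: B)
  show "jet \<phi> \<in> L2 (lebesgue_on \<Omega>)"
    unfolding L2_pair using 1 2 by (simp add: jet_def)
qed

lemma H0_L2: "U \<in> H0 \<Omega> \<Longrightarrow> U \<in> L2 (lebesgue_on \<Omega>)"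
  and H0_fst_L2: "U \<in> H0 \<Omega> \<Longrightarrow> (\<lambda>x. fst (U x)) \<in> L2 (lebesgue_on \<Omega>)"
  and H0_snd_L2: "U \<in> H0 \<Omega> \<Longrightarrow> (\<lambda>x. snd (U x)) \<in> L2 (lebesgue_on \<Omega>)"
  using L2_pair[of U] by (auto simp: H0_def)

lemma jet_H0: "\<phi> \<in> C1c \<Omega> \<Longrightarrow> jet \<phi> \<in> H0 \<Omega>"
  unfolding H0_def using C1c_L2(3) by (auto intro!: exI[of _ "\<lambda>_. \<phi>"] simp: sqn_def)

lemma H0_closed:
  assumes V: "\<And>k. V k \<in> H0 \<Omega>" and U: "U \<in> L2 (lebesgue_on \<Omega>)"
    and lim: "(\<lambda>k. sqn (lebesgue_on \<Omega>) (\<lambda>x. V k x - U x)) \<longlonglongrightarrow> 0"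
  shows "U \<in> H0 \<Omega>"
proof -
  have "\<exists>\<phi>. \<phi> \<in> C1c \<Omega> \<and> sqn (lebesgue_on \<Omega>) (\<lambda>x. V k x - jet \<phi> x) < inverse (Suc k)" for k
  proof -
    obtain \<phi> where \<phi>: "\<And>j. \<phi> j \<in> C1c \<Omega>" "(\<lambda>j::nat. sqn (lebesgue_on \<Omega>) (\<lambda>x. V k x - jet (\<phi> j) x)) \<longlonglongrightarrow> 0"
      using V[of k] by (auto simp: H0_def)
    have "\<forall>\<^sub>F j in sequentially. sqn (lebesgue_on \<Omega>) (\<lambda>x. V k x - jet (\<phi> j) x) < inverse (Suc k)"
      by (rule order_tendstoD(2)[OF \<phi>(2)]) simp
    then show ?thesis using \<phi>(1) by (auto simp: eventually_sequentially)
  qed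
  then have "\<exists>\<phi>. \<forall>k. \<phi> k \<in> C1c \<Omega> \<and> sqn (lebesgue_on \<Omega>) (\<lambda>x. V k x - jet (\<phi> k) x) < inverse (Suc k)"
    by (intro choice allI)
  then obtain \<phi> where \<phi>: "\<And>k. \<phi> k \<in> C1c \<Omega>"
    "\<And>k. sqn (lebesgue_on \<Omega>) (\<lambda>x. V k x - jet (\<phi> k) x) < inverse (Suc k)" by blast
  have "(\<lambda>k. sqn (lebesgue_on \<Omega>) (\<lambda>x. U x - jet (\<phi> k) x)) \<longlonglongrightarrow> 0"
  proof (rule Lim_null_comparison)
    have "sqn (lebesgue_on \<Omega>) (\<lambda>x. U x - jet (\<phi> k) x)
        \<le> 2 * sqn (lebesgue_on \<Omega>) (\<lambda>x. V k x - U x) + 2 * inverse (Suc k)" for k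
    proof -
      have "sqn (lebesgue_on \<Omega>) (\<lambda>x. (U x - V k x) + (V k x - jet (\<phi> k) x))
        \<le> 2 * sqn (lebesgue_on \<Omega>) (\<lambda>x. U x - V k x) + 2 * sqn (lebesgue_on \<Omega>) (\<lambda>x. V k x - jet (\<phi> k) x)"
        by (intro sqn_add_le L2_diff U H0_L2[OF V] C1c_L2 \<phi>)
      moreover have "sqn (lebesgue_on \<Omega>) (\<lambda>x. U x - V k x) = sqn (lebesgue_on \<Omega>) (\<lambda>x. V k x - U x)"
        by (simp add: sqn_def norm_minus_commute)
      ultimately show ?thesis using \<phi>(2)[of k] by simp
    qed
    then show "\<forall>\<^sub>F k in sequentially. norm (sqn (lebesgue_on \<Omega>) (\<lambda>x. U x - jet (\<phi> k) x))
        \<le> 2 * sqn (lebesgue_on \<Omega>) (\<lambda>x. V k x - U x) + 2 * inverse (Suc k)"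
      by (simp add: sqn_nonneg)
    show "(\<lambda>k. 2 * sqn (lebesgue_on \<Omega>) (\<lambda>x. V k x - U x) + 2 * inverse (real (Suc k))) \<longlonglongrightarrow> 0"
      using tendsto_add[OF tendsto_mult_left[OF lim, of 2] tendsto_mult_left[OF LIMSEQ_inverse_real_of_nat, of 2]] by simp
  qed
  with \<phi>(1) U show ?thesis by (auto simp: H0_def)
qed

lemma H0_add:
  assumes "U \<in> H0 \<Omega>" "V \<in> H0 \<Omega>"
  shows "(\<lambda>x. U x + V x) \<in> H0 \<Omega>"
proof -
  obtain \<phi> where \<phi>: "\<And>k. \<phi> k \<in> C1c \<Omega>" "(\<lambda>k::nat. sqn (lebesgue_on \<Omega>) (\<lambda>x. U x - jet (\<phi> k) x)) \<longlonglongrightarrow> 0"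
    using assms(1) by (auto simp: H0_def)
  obtain \<psi> where \<psi>: "\<And>k. \<psi> k \<in> C1c \<Omega>" "(\<lambda>k::nat. sqn (lebesgue_on \<Omega>) (\<lambda>x. V x - jet (\<psi> k) x)) \<longlonglongrightarrow> 0"
    using assms(2) by (auto simp: H0_def)
  have j: "jet (\<lambda>x. \<phi> k x + \<psi> k x) x = jet (\<phi> k) x + jet (\<psi> k) x" for k x
    by (simp add: jet_def C1c_add(2)[OF \<phi>(1) \<psi>(1)])
  have "(\<lambda>k. sqn (lebesgue_on \<Omega>) (\<lambda>x. (U x + V x) - jet (\<lambda>x. \<phi> k x + \<psi> k x) x)) \<longlonglongrightarrow> 0"
  proof (rule Lim_null_comparison)
    have "sqn (lebesgue_on \<Omega>) (\<lambda>x. (U x + V x) - jet (\<lambda>x. \<phi> k x + \<psi> k x) x)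
      \<le> 2 * sqn (lebesgue_on \<Omega>) (\<lambda>x. U x - jet (\<phi> k) x) + 2 * sqn (lebesgue_on \<Omega>) (\<lambda>x. V x - jet (\<psi> k) x)" for k
      using sqn_add_le[OF L2_diff[OF H0_L2[OF assms(1)] C1c_L2(3)[OF \<phi>(1)[of k]]] L2_diff[OF H0_L2[OF assms(2)] C1c_L2(3)[OF \<psi>(1)[of k]]]]
      by (simp add: j add_diff_add)
    then show "\<forall>\<^sub>F k in sequentially. norm (sqn (lebesgue_on \<Omega>) (\<lambda>x. (U x + V x) - jet (\<lambda>x. \<phi> k x + \<psi> k x) x))
      \<le> 2 * sqn (lebesgue_on \<Omega>) (\<lambda>x. U x - jet (\<phi> k) x) + 2 * sqn (lebesgue_on \<Omega>) (\<lambda>x. V x - jet (\<psi> k) x)"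
      by (simp add: sqn_nonneg)
    show "(\<lambda>k. 2 * sqn (lebesgue_on \<Omega>) (\<lambda>x. U x - jet (\<phi> k) x) + 2 * sqn (lebesgue_on \<Omega>) (\<lambda>x. V x - jet (\<psi> k) x)) \<longlonglongrightarrow> 0"
      using tendsto_add[OF tendsto_mult_left[OF \<phi>(2), of 2] tendsto_mult_left[OF \<psi>(2), of 2]] by simp
  qed
  with C1c_add(1)[OF \<phi>(1) \<psi>(1)] L2_add[OF H0_L2[OF assms(1)] H0_L2[OF assms(2)]]
  show ?thesis unfolding H0_def by (intro CollectI conjI exI[of _ "\<lambda>k x. \<phi> k x + \<psi> k x"]) auto
qed

lemma H0_scaleR:
  assumes "U \<in> H0 \<Omega>"
  shows "(\<lambda>x. c *\<^sub>R U x) \<in> H0 \<Omega>"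
proof -
  obtain \<phi> where \<phi>: "\<And>k. \<phi> k \<in> C1c \<Omega>" "(\<lambda>k::nat. sqn (lebesgue_on \<Omega>) (\<lambda>x. U x - jet (\<phi> k) x)) \<longlonglongrightarrow> 0"
    using assms(1) by (auto simp: H0_def)
  have j: "jet (\<lambda>x. c * \<phi> k x) x = c *\<^sub>R jet (\<phi> k) x" for k x
    by (simp add: jet_def C1c_cmult(2)[OF \<phi>(1)])
  have "sqn (lebesgue_on \<Omega>) (\<lambda>x. c *\<^sub>R U x - jet (\<lambda>x. c * \<phi> k x) x) = c\<^sup>2 * sqn (lebesgue_on \<Omega>) (\<lambda>x. U x - jet (\<phi> k) x)" for k
    by (simp add: j sqn_def power_mult_distrib flip: scaleR_diff_right)
  with tendsto_mult_left[OF \<phi>(2), of "c\<^sup>2"]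
  have "(\<lambda>k. sqn (lebesgue_on \<Omega>) (\<lambda>x. c *\<^sub>R U x - jet (\<lambda>x. c * \<phi> k x) x)) \<longlonglongrightarrow> 0" by simp
  with C1c_cmult(1)[OF \<phi>(1)] L2_scaleR[OF H0_L2[OF assms]]
  show ?thesis unfolding H0_def by (intro CollectI conjI exI[of _ "\<lambda>k x. c * \<phi> k x"]) auto
qed

lemma H0_midhull: "y \<in> midhull U k \<Longrightarrow> (\<And>j. U j \<in> H0 \<Omega>) \<Longrightarrow> y \<in> H0 \<Omega>"
  by (induction rule: midhull.induct) (auto intro: H0_scaleR H0_add)

lemma H0_AE_cong:
  assumes "U \<in> H0 \<Omega>" "AE x in lebesgue_on \<Omega>. U x = V x"
  shows "V \<in> H0 \<Omega>"
proof (rule H0_closed)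
  have m: "V \<in> borel_measurable (lebesgue_on \<Omega>)"
    by (rule measurable_lebesgue_on_AE_eq[OF L2_measurable[OF H0_L2[OF assms(1)]] Om_sets assms(2)])
  show V: "V \<in> L2 (lebesgue_on \<Omega>)" by (rule L2_AE_cong(1)[OF H0_L2[OF assms(1)] m assms(2)])
  have "sqn (lebesgue_on \<Omega>) (\<lambda>x. U x - V x) = sqn (lebesgue_on \<Omega>) (\<lambda>x. 0 :: real \<times> (real^'N))"
  proof (rule L2_AE_cong(2))
    show "(\<lambda>x. 0) \<in> L2 (lebesgue_on \<Omega>)" by (simp add: L2_def)
    show "(\<lambda>x. U x - V x) \<in> borel_measurable (lebesgue_on \<Omega>)"
      using m L2_measurable[OF H0_L2[OF assms(1)]] by measurable
    show "AE x in lebesgue_on \<Omega>. 0 = U x - V x" using assms(2) by eventually_elim simp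
  qed
  then show "(\<lambda>k::nat. sqn (lebesgue_on \<Omega>) (\<lambda>x. U x - V x)) \<longlonglongrightarrow> 0" by (simp add: sqn_def)
qed (rule assms(1))

text \<open>The product rule, written as orthogonality of the pair \<open>(\<phi>, \<nabla>\<phi>)\<close> to a fixed field, so that it passes to \<open>L2\<close>-limits of \<open>\<phi>\<close>.\<close>

lemma C1c_by_parts:
  assumes "\<phi> \<in> C1c \<Omega>" "\<psi> \<in> C1c \<Omega>"
  shows "(\<integral>x. jet \<phi> x \<bullet> (grad \<psi> x \<bullet> b, \<psi> x *\<^sub>R b) \<partial>lebesgue_on \<Omega>) = 0"
proof -
  note p = C1c_mult[OF assms(1) C1c_has_derivative[OF assms(2)] C1c_continuous_grad[OF assms(2)]]
  have eq: "jet \<phi> x \<bullet> (grad \<psi> x \<bullet> b, \<psi> x *\<^sub>R b) = grad (\<lambda>x. \<phi> x * \<psi> x) x \<bullet> b" for x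
    unfolding p(2) by (simp add: jet_def inner_add_left)
  obtain K where K: "K \<subseteq> \<Omega>" "\<And>x. x \<notin> K \<Longrightarrow> grad (\<lambda>x. \<phi> x * \<psi> x) x = 0" by (rule C1c_support[OF p(1)]) blast
  have off: "grad (\<lambda>x. \<phi> x * \<psi> x) x = 0" if "x \<notin> \<Omega>" for x using K that by blast
  have "(\<integral>x. grad (\<lambda>x. \<phi> x * \<psi> x) x \<bullet> b \<partial>lebesgue_on \<Omega>) = (\<integral>x. grad (\<lambda>x. \<phi> x * \<psi> x) x \<bullet> b \<partial>lborel)"
    by (rule lebesgue_on_eq_lborel(1)[OF borel_measurable_continuous_onI Om_sets])
      (use off C1c_continuous_grad[OF p(1)] in \<open>auto intro!: continuous_intros\<close>)
  also have "\<dots> = 0"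
    using C1c_integral_grad_zero[OF p(1)] C1c_integrable(2)[OF p(1)] by simp
  finally show ?thesis by (simp add: eq)
qed

lemma test_field_L2:
  assumes "\<psi> \<in> C1c \<Omega>"
  shows "(\<lambda>x. (grad \<psi> x \<bullet> b, \<psi> x *\<^sub>R b)) \<in> L2 (lebesgue_on \<Omega>)"
proof -
  obtain B where B: "\<And>x. \<bar>\<psi> x\<bar> \<le> B" "\<And>x. norm (grad \<psi> x) \<le> B" by (rule C1c_bounded[OF assms]) blast
  have "(\<lambda>x. grad \<psi> x \<bullet> b) \<in> L2 (lebesgue_on \<Omega>)"
  proof (rule bounded_measurable_L2)
    show "(\<lambda>x. grad \<psi> x \<bullet> b) \<in> borel_measurable (lebesgue_on \<Omega>)"
      by (intro continuous_borel_lebesgue_on continuous_intros C1c_continuous_grad[OF assms])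
    have "norm (grad \<psi> x \<bullet> b) \<le> B * norm b" for x
      using Cauchy_Schwarz_ineq2[of "grad \<psi> x" b] mult_right_mono[OF B(2)[of x] norm_ge_zero[of b]] by simp
    then show "AE x in lebesgue_on \<Omega>. norm (grad \<psi> x \<bullet> b) \<le> B * norm b" by simp
  qed
  moreover have "(\<lambda>x. \<psi> x *\<^sub>R b) \<in> L2 (lebesgue_on \<Omega>)"
  proof (rule bounded_measurable_L2)
    show "(\<lambda>x. \<psi> x *\<^sub>R b) \<in> borel_measurable (lebesgue_on \<Omega>)"
      by (intro continuous_borel_lebesgue_on continuous_intros C1c_continuous[OF assms])
    show "AE x in lebesgue_on \<Omega>. norm (\<psi> x *\<^sub>R b) \<le> B * norm b"
      using B(1) by (simp add: mult_right_mono)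
  qed
  ultimately show ?thesis by (simp add: L2_pair)
qed

lemma L2_Lp_loc:
  fixes f :: "real^'N \<Rightarrow> 'b::euclidean_space"
  assumes "f \<in> L2 (lebesgue_on \<Omega>)"
  shows "f \<in> Lp_loc 1 \<Omega>"
proof (rule Lp_loc_1_I)
  fix K :: "(real^'N) set" assume K: "compact K" "K \<subseteq> \<Omega>"
  have "integrable (lebesgue_on \<Omega>) (\<lambda>x. indicator K x *\<^sub>R f x)"
    using K compact_sets_lebesgue[OF K(1)] Om_sets
    by (intro integrable_mult_indicator L2_integrable[OF assms]) (simp add: sets_restrict_space_iff)
  then have "integrable (lebesgue_on K) (\<lambda>x. indicator K x *\<^sub>R f x)"
    by (subst (asm) integral_lebesgue_on_subset(2)[OF K(2) compact_sets_lebesgue[OF K(1)] Om_sets]) auto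
  moreover have "integrable (lebesgue_on K) (\<lambda>x. indicator K x *\<^sub>R f x) \<longleftrightarrow> integrable (lebesgue_on K) f"
    by (rule Bochner_Integration.integrable_cong) auto
  ultimately show "integrable (lebesgue_on K) f" by simp
qed

lemma H0_has_weak_grad:
  assumes U: "U \<in> H0 \<Omega>"
  shows "has_weak_grad \<Omega> (\<lambda>x. fst (U x)) (\<lambda>x. snd (U x))"
  unfolding has_weak_grad_def
proof (intro conjI ballI)
  show f: "(\<lambda>x. fst (U x)) \<in> Lp_loc 1 \<Omega>" and g: "(\<lambda>x. snd (U x)) \<in> Lp_loc 1 \<Omega>"
    using H0_fst_L2[OF U] H0_snd_L2[OF U] by (auto intro: L2_Lp_loc)
  fix \<psi> assume \<psi>: "\<psi> \<in> C1c \<Omega>"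
  obtain \<phi> where \<phi>: "\<And>k. \<phi> k \<in> C1c \<Omega>" "(\<lambda>k::nat. sqn (lebesgue_on \<Omega>) (\<lambda>x. U x - jet (\<phi> k) x)) \<longlonglongrightarrow> 0"
    using U by (auto simp: H0_def)
  have lim: "(\<lambda>k. sqn (lebesgue_on \<Omega>) (\<lambda>x. jet (\<phi> k) x - U x)) \<longlonglongrightarrow> 0"
    using \<phi>(2) by (simp add: sqn_def norm_minus_commute)
  have z: "(\<integral>x. U x \<bullet> (grad \<psi> x \<bullet> b, \<psi> x *\<^sub>R b) \<partial>lebesgue_on \<Omega>) = 0" for b
    using L2_tendsto_inner[OF C1c_L2(3)[OF \<phi>(1)] H0_L2[OF U] test_field_L2[OF \<psi>, of b] lim]
    unfolding C1c_by_parts[OF \<phi>(1) \<psi>] by (simp only: LIMSEQ_const_iff)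
  have i1: "integrable (lebesgue_on \<Omega>) (\<lambda>x. fst (U x) *\<^sub>R grad \<psi> x)"
  proof -
    obtain B where B: "\<And>x. norm (grad \<psi> x) \<le> B" by (rule C1c_bounded[OF \<psi>]) blast
    show ?thesis
  proof (rule Bochner_Integration.integrable_bound)
    show "integrable (lebesgue_on \<Omega>) (\<lambda>x. B * norm (fst (U x)))"
      by (intro integrable_mult_right integrable_norm L2_integrable[OF H0_fst_L2[OF U]])
    show "(\<lambda>x. fst (U x) *\<^sub>R grad \<psi> x) \<in> borel_measurable (lebesgue_on \<Omega>)"
      by (intro borel_measurable_scaleR L2_measurable[OF H0_fst_L2[OF U]]
          continuous_borel_lebesgue_on C1c_continuous_grad[OF \<psi>])
    have "norm (fst (U x) *\<^sub>R grad \<psi> x) \<le> norm (B * norm (fst (U x)))" for x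
      using mult_left_mono[OF B[of x] abs_ge_zero[of "fst (U x)"]] abs_ge_self[of "B * \<bar>fst (U x)\<bar>"]
      by (simp add: mult.commute)
    then show "AE x in lebesgue_on \<Omega>. norm (fst (U x) *\<^sub>R grad \<psi> x) \<le> norm (B * norm (fst (U x)))"
      by simp
  qed
  qed
  have i2: "integrable (lebesgue_on \<Omega>) (\<lambda>x. \<psi> x *\<^sub>R snd (U x))"
    by (rule C1c_mult_integrable[OF Om_sets \<psi> g])
  have "((\<integral>x. fst (U x) *\<^sub>R grad \<psi> x \<partial>lebesgue_on \<Omega>) + (\<integral>x. \<psi> x *\<^sub>R snd (U x) \<partial>lebesgue_on \<Omega>)) \<bullet> b = 0" for b
  proof -
    have "((\<integral>x. fst (U x) *\<^sub>R grad \<psi> x \<partial>lebesgue_on \<Omega>) + (\<integral>x. \<psi> x *\<^sub>R snd (U x) \<partial>lebesgue_on \<Omega>)) \<bullet> b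
      = (\<integral>x. (fst (U x) *\<^sub>R grad \<psi> x + \<psi> x *\<^sub>R snd (U x)) \<bullet> b \<partial>lebesgue_on \<Omega>)"
      using i1 i2 by simp
    also have "\<dots> = (\<integral>x. U x \<bullet> (grad \<psi> x \<bullet> b, \<psi> x *\<^sub>R b) \<partial>lebesgue_on \<Omega>)"
      by (rule Bochner_Integration.integral_cong) (auto simp: inner_prod_def inner_add_left)
    finally show ?thesis using z by simp
  qed
  then have "(\<integral>x. fst (U x) *\<^sub>R grad \<psi> x \<partial>lebesgue_on \<Omega>) + (\<integral>x. \<psi> x *\<^sub>R snd (U x) \<partial>lebesgue_on \<Omega>) = 0"
    using inner_eq_zero_iff by blast
  then show "(\<integral>x. fst (U x) *\<^sub>R grad \<psi> x \<partial>lebesgue_on \<Omega>) = - (\<integral>x. \<psi> x *\<^sub>R snd (U x) \<partial>lebesgue_on \<Omega>)"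
    by (simp add: eq_neg_iff_add_eq_0)
qed

lemma Lp_2_iff_L2: "f \<in> Lp 2 \<Omega> \<longleftrightarrow> f \<in> L2 (lebesgue_on \<Omega>)"
  by (simp add: Lp_def L2_def)

lemma H0_weak_grad_AE:
  assumes "U \<in> H0 \<Omega>"
  shows "AE x in lebesgue_on \<Omega>. snd (U x) = weak_grad \<Omega> (\<lambda>x. fst (U x)) x"
  by (rule has_weak_grad_unique[OF open_Om H0_has_weak_grad[OF assms]
      has_weak_grad_weak_grad[OF H0_has_weak_grad[OF assms]]])

lemma W1p_0_imp_H0:
  assumes "u \<in> W1p_0 2 \<Omega>"
  shows "(\<lambda>x. (u x, weak_grad \<Omega> u x)) \<in> H0 \<Omega>"
proof -
  obtain g where u: "u \<in> L2 (lebesgue_on \<Omega>)" and g: "g \<in> L2 (lebesgue_on \<Omega>)" "has_weak_grad \<Omega> u g"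
  proof -
    obtain g where "u \<in> Lp 2 \<Omega>" "g \<in> Lp 2 \<Omega>" "has_weak_grad \<Omega> u g"
      using assms unfolding W1p_0_def W1p_def by blast
    then show ?thesis using that unfolding Lp_2_iff_L2 by blast
  qed
  obtain \<phi> where \<phi>: "\<And>k::nat. \<phi> k \<in> C1c \<Omega>"
    and l1: "(\<lambda>k. \<integral>x. \<bar>u x - \<phi> k x\<bar> powr 2 \<partial>lebesgue_on \<Omega>) \<longlonglongrightarrow> 0"
    and l2: "(\<lambda>k. \<integral>x. norm (weak_grad \<Omega> u x - grad (\<phi> k) x) powr 2 \<partial>lebesgue_on \<Omega>) \<longlonglongrightarrow> 0"
    using assms by (auto simp: W1p_0_def)
  have ae: "AE x in lebesgue_on \<Omega>. g x = weak_grad \<Omega> u x"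
    by (rule has_weak_grad_unique[OF open_Om g(2) has_weak_grad_weak_grad[OF g(2)]])
  have wg: "weak_grad \<Omega> u \<in> L2 (lebesgue_on \<Omega>)"
    by (rule L2_AE_cong(1)[OF g(1) measurable_lebesgue_on_AE_eq[OF L2_measurable[OF g(1)] Om_sets ae] ae])
  have UL: "(\<lambda>x. (u x, weak_grad \<Omega> u x)) \<in> L2 (lebesgue_on \<Omega>)"
    using u wg by (simp add: L2_pair)
  have "sqn (lebesgue_on \<Omega>) (\<lambda>x. (u x, weak_grad \<Omega> u x) - jet (\<phi> k) x)
     = (\<integral>x. \<bar>u x - \<phi> k x\<bar> powr 2 \<partial>lebesgue_on \<Omega>) + (\<integral>x. norm (weak_grad \<Omega> u x - grad (\<phi> k) x) powr 2 \<partial>lebesgue_on \<Omega>)" for k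
    by (subst sqn_pair[OF L2_diff[OF UL C1c_L2(3)[OF \<phi>]]]) (simp add: sqn_def jet_def)
  with tendsto_add[OF l1 l2]
  have "(\<lambda>k. sqn (lebesgue_on \<Omega>) (\<lambda>x. (u x, weak_grad \<Omega> u x) - jet (\<phi> k) x)) \<longlonglongrightarrow> 0" by simp
  with UL \<phi> show ?thesis unfolding H0_def by blast
qed

lemma H0_imp_W1p_0:
  assumes U: "U \<in> H0 \<Omega>"
  shows "(\<lambda>x. fst (U x)) \<in> W1p_0 2 \<Omega>"
proof -
  have ae: "AE x in lebesgue_on \<Omega>. snd (U x) = weak_grad \<Omega> (\<lambda>x. fst (U x)) x" by (rule H0_weak_grad_AE[OF U])
  define V where "V x = (fst (U x), weak_grad \<Omega> (\<lambda>x. fst (U x)) x)" for x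
  have "AE x in lebesgue_on \<Omega>. U x = V x" using ae by eventually_elim (simp add: V_def prod_eq_iff)
  then have V: "V \<in> H0 \<Omega>" by (rule H0_AE_cong[OF U])
  obtain \<phi> where \<phi>: "\<And>k. \<phi> k \<in> C1c \<Omega>" and lim: "(\<lambda>k::nat. sqn (lebesgue_on \<Omega>) (\<lambda>x. V x - jet (\<phi> k) x)) \<longlonglongrightarrow> 0"
    using V by (auto simp: H0_def)
  have eq: "sqn (lebesgue_on \<Omega>) (\<lambda>x. V x - jet (\<phi> k) x)
     = (\<integral>x. \<bar>fst (U x) - \<phi> k x\<bar> powr 2 \<partial>lebesgue_on \<Omega>)
     + (\<integral>x. norm (weak_grad \<Omega> (\<lambda>x. fst (U x)) x - grad (\<phi> k) x) powr 2 \<partial>lebesgue_on \<Omega>)" for k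
    by (subst sqn_pair[OF L2_diff[OF H0_L2[OF V] C1c_L2(3)[OF \<phi>]]]) (simp add: sqn_def jet_def V_def)
  have l1: "(\<lambda>k. \<integral>x. \<bar>fst (U x) - \<phi> k x\<bar> powr 2 \<partial>lebesgue_on \<Omega>) \<longlonglongrightarrow> 0"
    by (rule Lim_null_comparison[OF _ lim[unfolded eq]]) simp
  have l2: "(\<lambda>k. \<integral>x. norm (weak_grad \<Omega> (\<lambda>x. fst (U x)) x - grad (\<phi> k) x) powr 2 \<partial>lebesgue_on \<Omega>) \<longlonglongrightarrow> 0"
    by (rule Lim_null_comparison[OF _ lim[unfolded eq]]) simp
  have "(\<lambda>x. fst (U x)) \<in> W1p 2 \<Omega>"
    unfolding W1p_def using H0_has_weak_grad[OF U] H0_fst_L2[OF U] H0_snd_L2[OF U]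
    by (auto simp: Lp_2_iff_L2)
  then show ?thesis
    unfolding W1p_0_def using \<phi> l1 l2 by (intro CollectI conjI exI[of _ \<phi>]) auto
qed

text \<open>
  For test functions \<open>\<phi> k\<close> approximating \<open>U\<close>, the functions \<open>H \<circ> \<phi> k\<close> are test functions. The error of their
  gradients is a part \<open>z\<close>, controlled by \<open>C\<close> times the error of \<open>\<phi> k\<close>, and a part \<open>w\<close>, in which \<open>H'\<close> is compared at
  two points; the latter vanishes by dominated convergence along an almost everywhere convergent
  subsequence.
\<close>

lemma H0_compose:
  assumes U: "U \<in> H0 \<Omega>" and H: "\<And>t. (H has_real_derivative H' t) (at t)" and cont: "continuous_on UNIV H'"
    and "H 0 = 0" and C: "\<And>t. \<bar>H' t\<bar> \<le> C"
  shows "(\<lambda>x. (H (fst (U x)), H' (fst (U x)) *\<^sub>R snd (U x))) \<in> H0 \<Omega>"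
proof -
  let ?L = "lebesgue_on \<Omega>"
  define V where "V x = (H (fst (U x)), H' (fst (U x)) *\<^sub>R snd (U x))" for x
  have C0: "C \<ge> 0" using C[of 0] by linarith
  have Lip: "\<bar>H a - H b\<bar> \<le> C * \<bar>a - b\<bar>" for a b
    using field_differentiable_bound[of UNIV H H' C a b] H C by (auto simp: has_field_derivative_at_within)
  obtain \<phi>0 where \<phi>0: "\<And>k. \<phi>0 k \<in> C1c \<Omega>" "(\<lambda>k::nat. sqn ?L (\<lambda>x. U x - jet (\<phi>0 k) x)) \<longlonglongrightarrow> 0"
    using U by (auto simp: H0_def)
  have dL: "(\<lambda>x. U x - jet (\<phi>0 k) x) \<in> L2 ?L" for k
    by (intro L2_diff H0_L2[OF U] C1c_L2 \<phi>0)
  obtain r where r: "strict_mono r" "AE x in ?L. (\<lambda>k. U x - jet (\<phi>0 (r k)) x) \<longlonglongrightarrow> 0"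
    using tendsto_L1_AE_subseq[OF L2_integrable[OF dL] L2_tendsto_L1[OF dL \<phi>0(2)]] by auto
  define \<phi> where "\<phi> k = \<phi>0 (r k)" for k
  have \<phi>: "\<phi> k \<in> C1c \<Omega>" for k using \<phi>0 by (simp add: \<phi>_def)
  have lim: "(\<lambda>k. sqn ?L (\<lambda>x. U x - jet (\<phi> k) x)) \<longlonglongrightarrow> 0"
    using LIMSEQ_subseq_LIMSEQ[OF \<phi>0(2) r(1)] by (simp add: \<phi>_def o_def)
  note [measurable] = L2_measurable[OF H0_fst_L2[OF U]] L2_measurable[OF H0_snd_L2[OF U]]
    borel_measurable_continuous_onI[OF cont]
  have cH: "continuous_on UNIV H"
    using H by (intro continuous_at_imp_continuous_on ballI) (rule DERIV_isCont)
  note [measurable] = borel_measurable_continuous_onI[OF cH]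
  have H'm: "(\<lambda>x. H' (fst (U x))) \<in> borel_measurable ?L" by measurable
  have VL: "V \<in> L2 ?L"
    unfolding L2_pair
  proof
    show "(\<lambda>x. fst (V x)) \<in> L2 ?L"
    proof (rule L2_dominated)
      show "(\<lambda>x. fst (V x)) \<in> borel_measurable ?L" unfolding V_def fst_conv by measurable
      show "integrable ?L (\<lambda>x. C\<^sup>2 * (norm (fst (U x)))\<^sup>2)"
        using L2_integrable_sq[OF H0_fst_L2[OF U]] by auto
      show "(norm (fst (V x)))\<^sup>2 \<le> C\<^sup>2 * (norm (fst (U x)))\<^sup>2" for x
        using power_mono[OF Lip[of "fst (U x)" 0], of 2] \<open>H 0 = 0\<close> by (simp add: V_def power_mult_distrib)
    qed
    show "(\<lambda>x. snd (V x)) \<in> L2 ?L"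
    proof (rule L2_dominated)
      show "(\<lambda>x. snd (V x)) \<in> borel_measurable ?L" unfolding V_def snd_conv by measurable
      show "integrable ?L (\<lambda>x. C\<^sup>2 * (norm (snd (U x)))\<^sup>2)"
        using L2_integrable_sq[OF H0_snd_L2[OF U]] by auto
      show "(norm (snd (V x)))\<^sup>2 \<le> C\<^sup>2 * (norm (snd (U x)))\<^sup>2" for x
        using power_mono[OF C[of "fst (U x)"], of 2] by (simp add: V_def power_mult_distrib mult_right_mono)
    qed
  qed
  define w where "w k x = (H' (fst (U x)) - H' (\<phi> k x)) *\<^sub>R snd (U x)" for k x
  have \<phi>m[measurable]: "\<phi> k \<in> borel_measurable ?L" for k
    by (rule continuous_borel_lebesgue_on[OF C1c_continuous[OF \<phi>]])
  have wm[measurable]: "w k \<in> borel_measurable ?L" for k unfolding w_def by measurable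
  have w_le: "(norm (w k x))\<^sup>2 \<le> (2 * C)\<^sup>2 * (norm (snd (U x)))\<^sup>2" for k x
  proof -
    have "\<bar>H' (fst (U x)) - H' (\<phi> k x)\<bar> \<le> 2 * C" using C[of "fst (U x)"] C[of "\<phi> k x"] by linarith
    from power_mono[OF this, of 2] show ?thesis
      by (simp add: w_def power_mult_distrib mult_right_mono)
  qed
  have dom: "integrable ?L (\<lambda>x. (2 * C)\<^sup>2 * (norm (snd (U x)))\<^sup>2)"
    using L2_integrable_sq[OF H0_snd_L2[OF U]] by auto
  have wL: "w k \<in> L2 ?L" for k by (rule L2_dominated[OF wm dom w_le])
  have "(\<lambda>k. \<integral>x. (norm (w k x))\<^sup>2 \<partial>?L) \<longlonglongrightarrow> (\<integral>x. 0 \<partial>?L)"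
  proof (rule integral_dominated_convergence[OF _ _ dom])
    show "AE x in ?L. (\<lambda>k. (norm (w k x))\<^sup>2) \<longlonglongrightarrow> 0"
      using r(2)
    proof eventually_elim
      case (elim x)
      have "(\<lambda>k. fst (U x) - \<phi> k x) \<longlonglongrightarrow> 0"
        using tendsto_fst[OF elim] by (simp add: \<phi>_def jet_def)
      from tendsto_diff[OF tendsto_const[of "fst (U x)"] this] have "(\<lambda>k. \<phi> k x) \<longlonglongrightarrow> fst (U x)" by simp
      then have "(\<lambda>k. H' (\<phi> k x)) \<longlonglongrightarrow> H' (fst (U x))"
        using cont by (auto intro: isCont_tendsto_compose simp: continuous_on_eq_continuous_at)
      then have "(\<lambda>k. (norm (w k x))\<^sup>2) \<longlonglongrightarrow> (norm ((H' (fst (U x)) - H' (fst (U x))) *\<^sub>R snd (U x)))\<^sup>2"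
        unfolding w_def by (intro tendsto_intros)
      then show ?case by simp
    qed
  qed (use w_le in auto)
  then have wlim: "(\<lambda>k. sqn ?L (w k)) \<longlonglongrightarrow> 0" by (simp add: sqn_def)
  define \<eta> where "\<eta> k x = H (\<phi> k x)" for k x
  have \<eta>: "\<eta> k \<in> C1c \<Omega>" "jet (\<eta> k) = (\<lambda>x. (H (\<phi> k x), H' (\<phi> k x) *\<^sub>R grad (\<phi> k) x))" for k
    using C1c_compose[OF \<phi> H cont \<open>H 0 = 0\<close>, of k] by (auto simp: \<eta>_def[abs_def] jet_def)
  define z where "z k x = (H (fst (U x)) - H (\<phi> k x), H' (\<phi> k x) *\<^sub>R (snd (U x) - grad (\<phi> k) x))" for k x
  have Vz: "V x - jet (\<eta> k) x = z k x + (0, w k x)" for k x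
    by (simp add: V_def \<eta>(2) z_def w_def algebra_simps)
  have zd: "(norm (z k x))\<^sup>2 \<le> C\<^sup>2 * (norm (U x - jet (\<phi> k) x))\<^sup>2" for k x
  proof -
    have "(norm (z k x))\<^sup>2 = (H (fst (U x)) - H (\<phi> k x))\<^sup>2 + \<bar>H' (\<phi> k x)\<bar>\<^sup>2 * (norm (snd (U x) - grad (\<phi> k) x))\<^sup>2"
      by (simp add: z_def norm_prod_def power_mult_distrib)
    also have "\<dots> \<le> C\<^sup>2 * (fst (U x) - \<phi> k x)\<^sup>2 + C\<^sup>2 * (norm (snd (U x) - grad (\<phi> k) x))\<^sup>2"
      using power_mono[OF Lip[of "fst (U x)" "\<phi> k x"], of 2] power_mono[OF C[of "\<phi> k x"], of 2]
      by (intro add_mono mult_right_mono) (auto simp: power_mult_distrib)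
    also have "\<dots> = C\<^sup>2 * (norm (U x - jet (\<phi> k) x))\<^sup>2"
      by (simp add: jet_def norm_prod_def distrib_left)
    finally show ?thesis .
  qed
  have w0L: "(\<lambda>x. (0::real, w k x)) \<in> L2 ?L" for k using wL[of k] by (simp add: L2_pair) (simp add: L2_def)
  have diffL: "(\<lambda>x. U x - jet (\<phi> k) x) \<in> L2 ?L" for k
    by (intro L2_diff H0_L2[OF U] C1c_L2 \<phi>)
  have zL: "z k \<in> L2 ?L" for k
  proof -
    have "(\<lambda>x. (V x - jet (\<eta> k) x) - (0, w k x)) \<in> L2 ?L"
      by (intro L2_diff VL C1c_L2 \<eta> w0L)
    then show ?thesis by (simp add: Vz)
  qed
  have "(\<lambda>k. sqn ?L (\<lambda>x. V x - jet (\<eta> k) x)) \<longlonglongrightarrow> 0"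
  proof (rule Lim_null_comparison)
    have "sqn ?L (\<lambda>x. V x - jet (\<eta> k) x) \<le> 2 * (C\<^sup>2 * sqn ?L (\<lambda>x. U x - jet (\<phi> k) x)) + 2 * sqn ?L (w k)" for k
    proof -
      have "sqn ?L (z k) \<le> C\<^sup>2 * sqn ?L (\<lambda>x. U x - jet (\<phi> k) x)"
      proof -
        have "sqn ?L (z k) \<le> (\<integral>x. C\<^sup>2 * (norm (U x - jet (\<phi> k) x))\<^sup>2 \<partial>?L)"
          unfolding sqn_def
          using L2_integrable_sq[OF zL] L2_integrable_sq[OF diffL] zd by (intro integral_mono) auto
        then show ?thesis by (simp add: sqn_def)
      qed
      moreover have "sqn ?L (\<lambda>x. (0::real, w k x)) = sqn ?L (w k)" by (simp add: sqn_def norm_Pair)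
      ultimately show ?thesis
        using sqn_add_le[OF zL[of k] w0L[of k]] by (simp add: Vz)
    qed
    then show "\<forall>\<^sub>F k in sequentially. norm (sqn ?L (\<lambda>x. V x - jet (\<eta> k) x))
        \<le> 2 * (C\<^sup>2 * sqn ?L (\<lambda>x. U x - jet (\<phi> k) x)) + 2 * sqn ?L (w k)"
      by (simp add: sqn_nonneg)
    show "(\<lambda>k. 2 * (C\<^sup>2 * sqn ?L (\<lambda>x. U x - jet (\<phi> k) x)) + 2 * sqn ?L (w k)) \<longlonglongrightarrow> 0"
      using tendsto_add[OF tendsto_mult_left[OF tendsto_mult_left[OF lim, of "C\<^sup>2"], of 2] tendsto_mult_left[OF wlim, of 2]]
      by simp
  qed
  with \<eta>(1) VL have "V \<in> H0 \<Omega>" by (auto simp: H0_def)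
  then show ?thesis by (simp add: V_def[abs_def])
qed

lemma H0_Nash:
  assumes U: "U \<in> H0 \<Omega>" and "R > 0"
  shows "sqn (lebesgue_on \<Omega>) (\<lambda>x. fst (U x)) \<le> R\<^sup>2 * sqn (lebesgue_on \<Omega>) (\<lambda>x. snd (U x))
     + 2 * (\<integral>x. \<bar>fst (U x)\<bar> \<partial>lebesgue_on \<Omega>)\<^sup>2 / measure lborel (ball (0::real^'N) R)"
proof -
  let ?L = "lebesgue_on \<Omega>"
  obtain \<phi> where \<phi>: "\<And>k. \<phi> k \<in> C1c \<Omega>" "(\<lambda>k::nat. sqn ?L (\<lambda>x. U x - jet (\<phi> k) x)) \<longlonglongrightarrow> 0"
    using U by (auto simp: H0_def)
  have eq: "sqn ?L (\<lambda>x. U x - jet (\<phi> k) x) = sqn ?L (\<lambda>x. \<phi> k x - fst (U x)) + sqn ?L (\<lambda>x. grad (\<phi> k) x - snd (U x))" for k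
    by (subst sqn_pair[OF L2_diff[OF H0_L2[OF U] C1c_L2(3)[OF \<phi>(1)]]])
      (simp add: sqn_def jet_def norm_minus_commute power2_commute)
  have l1: "(\<lambda>k. sqn ?L (\<lambda>x. \<phi> k x - fst (U x))) \<longlonglongrightarrow> 0"
    by (rule Lim_null_comparison[OF _ \<phi>(2)[unfolded eq]]) (simp add: sqn_nonneg)
  have l2: "(\<lambda>k. sqn ?L (\<lambda>x. grad (\<phi> k) x - snd (U x))) \<longlonglongrightarrow> 0"
    by (rule Lim_null_comparison[OF _ \<phi>(2)[unfolded eq]]) (simp add: sqn_nonneg)
  note s1 = L2_tendsto_sqn[OF C1c_L2(1)[OF \<phi>(1)] H0_fst_L2[OF U] l1]
  note s2 = L2_tendsto_sqn[OF C1c_L2(2)[OF \<phi>(1)] H0_snd_L2[OF U] l2]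
  have s3: "(\<lambda>k. \<integral>x. \<bar>\<phi> k x\<bar> \<partial>?L) \<longlonglongrightarrow> (\<integral>x. \<bar>fst (U x)\<bar> \<partial>?L)"
  proof (rule LIM_zero_cancel, rule Lim_null_comparison)
    have L: "(\<lambda>x. \<phi> k x - fst (U x)) \<in> L2 ?L" for k by (intro L2_diff C1c_L2 \<phi> H0_fst_L2[OF U])
    show "(\<lambda>k. \<integral>x. norm (\<phi> k x - fst (U x)) \<partial>?L) \<longlonglongrightarrow> 0"
      by (rule L2_tendsto_L1[OF L l1])
    have "norm ((\<integral>x. \<bar>\<phi> k x\<bar> \<partial>?L) - (\<integral>x. \<bar>fst (U x)\<bar> \<partial>?L)) \<le> (\<integral>x. norm (\<phi> k x - fst (U x)) \<partial>?L)" for k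
    proof -
      have i: "integrable ?L (\<lambda>x. \<bar>\<phi> k x\<bar>)" "integrable ?L (\<lambda>x. \<bar>fst (U x)\<bar>)"
        using L2_integrable[OF C1c_L2(1)[OF \<phi>(1)], of k] L2_integrable[OF H0_fst_L2[OF U]]
        by (auto intro: integrable_abs)
      then have "(\<integral>x. \<bar>\<phi> k x\<bar> \<partial>?L) - (\<integral>x. \<bar>fst (U x)\<bar> \<partial>?L) = (\<integral>x. \<bar>\<phi> k x\<bar> - \<bar>fst (U x)\<bar> \<partial>?L)" by simp
      also have "norm \<dots> \<le> (\<integral>x. norm (\<bar>\<phi> k x\<bar> - \<bar>fst (U x)\<bar>) \<partial>?L)" by (rule integral_norm_bound)
      also have "\<dots> \<le> (\<integral>x. norm (\<phi> k x - fst (U x)) \<partial>?L)"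
        using i L2_integrable[OF L] by (intro integral_mono integrable_norm[OF Bochner_Integration.integrable_diff] integrable_norm) auto
      finally show ?thesis .
    qed
    then show "\<forall>\<^sub>F k in sequentially. norm ((\<integral>x. \<bar>\<phi> k x\<bar> \<partial>?L) - (\<integral>x. \<bar>fst (U x)\<bar> \<partial>?L)) \<le> (\<integral>x. norm (\<phi> k x - fst (U x)) \<partial>?L)"
      by simp
  qed
  have ineq: "sqn ?L (\<phi> k) \<le> R\<^sup>2 * sqn ?L (grad (\<phi> k)) + 2 * (\<integral>x. \<bar>\<phi> k x\<bar> \<partial>?L)\<^sup>2 / measure lborel (ball (0::real^'N) R)" for k
  proof -
    obtain K where K: "K \<subseteq> \<Omega>" "\<And>x. x \<notin> K \<Longrightarrow> \<phi> k x = 0" "\<And>x. x \<notin> K \<Longrightarrow> grad (\<phi> k) x = 0"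
      by (rule C1c_support[OF \<phi>(1)[of k]]) blast
    then have off: "\<And>x. x \<notin> \<Omega> \<Longrightarrow> \<phi> k x = 0" "\<And>x. x \<notin> \<Omega> \<Longrightarrow> grad (\<phi> k) x = 0" by blast+
    note [measurable] = borel_measurable_continuous_onI[OF C1c_continuous[OF \<phi>(1)]]
      borel_measurable_continuous_onI[OF C1c_continuous_grad[OF \<phi>(1)]]
    have "sqn ?L (\<phi> k) = (\<integral>x. (\<phi> k x)\<^sup>2 \<partial>lborel)"
      unfolding sqn_def by (subst lebesgue_on_eq_lborel(1)[OF _ Om_sets]) (auto simp: off)
    moreover have "sqn ?L (grad (\<phi> k)) = (\<integral>x. (norm (grad (\<phi> k) x))\<^sup>2 \<partial>lborel)"
      unfolding sqn_def by (subst lebesgue_on_eq_lborel(1)[OF _ Om_sets]) (auto simp: off)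
    moreover have "(\<integral>x. \<bar>\<phi> k x\<bar> \<partial>?L) = (\<integral>x. \<bar>\<phi> k x\<bar> \<partial>lborel)"
      by (subst lebesgue_on_eq_lborel(1)[OF _ Om_sets]) (auto simp: off)
    ultimately show ?thesis using C1c_Nash[OF \<phi>(1) \<open>R > 0\<close>] by simp
  qed
  have "(\<lambda>k. R\<^sup>2 * sqn ?L (grad (\<phi> k)) + 2 * (\<integral>x. \<bar>\<phi> k x\<bar> \<partial>?L)\<^sup>2 / measure lborel (ball (0::real^'N) R))
    \<longlonglongrightarrow> R\<^sup>2 * sqn ?L (\<lambda>x. snd (U x)) + 2 * (\<integral>x. \<bar>fst (U x)\<bar> \<partial>?L)\<^sup>2 / measure lborel (ball (0::real^'N) R)"
    using \<open>R > 0\<close> by (intro tendsto_intros s2 s3) auto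
  from LIMSEQ_le[OF s1 this] ineq show ?thesis by blast
qed

text \<open>
  By Cauchy-Schwarz the \<open>L1\<close> term of the Nash inequality is at most half of the left-hand side as soon as the
  ball has four times the measure of the support. The radius is kept instead of a fractional power of
  that measure.
\<close>

lemma H0_Faber_Krahn:
  assumes U: "U \<in> H0 \<Omega>" and "R > 0" and A: "A \<in> sets (lebesgue_on \<Omega>)" "\<And>x. x \<in> \<Omega> \<Longrightarrow> x \<notin> A \<Longrightarrow> fst (U x) = 0"
    and R: "4 * measure (lebesgue_on \<Omega>) A \<le> measure lborel (ball (0::real^'N) R)"
  shows "sqn (lebesgue_on \<Omega>) (\<lambda>x. fst (U x)) \<le> 2 * R\<^sup>2 * sqn (lebesgue_on \<Omega>) (\<lambda>x. snd (U x))"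
proof -
  let ?L = "lebesgue_on \<Omega>" and ?s = "sqn (lebesgue_on \<Omega>) (\<lambda>x. fst (U x))"
  define V where "V = measure lborel (ball (0::real^'N) R)"
  have V: "V > 0" unfolding V_def using \<open>R > 0\<close> by simp
  have "(\<integral>x. \<bar>fst (U x)\<bar> \<partial>?L)\<^sup>2 \<le> measure ?L A * ?s"
    using L1_sq_le[OF H0_fst_L2[OF U] A(1)] A(2) by simp
  also have "\<dots> \<le> V / 4 * ?s"
    using R by (intro mult_right_mono sqn_nonneg) (simp add: V_def)
  finally have "2 * (\<integral>x. \<bar>fst (U x)\<bar> \<partial>?L)\<^sup>2 / V \<le> ?s / 2"
    using V by (simp add: field_simps)
  with H0_Nash[OF U \<open>R > 0\<close>] show ?thesis by (simp add: V_def)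
qed

end

lemma midhull_functional_limit:
  assumes U: "\<And>j. U j \<in> L2 M" and \<Phi>: "\<Phi> \<in> L2 M"
    and lim: "(\<lambda>k. \<integral>x. U k x \<bullet> \<Phi> x \<partial>M) \<longlonglongrightarrow> l" and y: "\<And>k. y k \<in> midhull U k"
  shows "(\<lambda>k. \<integral>x. y k x \<bullet> \<Phi> x \<partial>M) \<longlonglongrightarrow> l"
proof (rule LIMSEQ_I)
  fix e :: real assume "e > 0"
  then obtain N where N: "\<And>j. j \<ge> N \<Longrightarrow> norm ((\<integral>x. U j x \<bullet> \<Phi> x \<partial>M) - l) < e"
    using LIMSEQ_D[OF lim] by blast
  have "norm ((\<integral>x. a x \<bullet> \<Phi> x \<partial>M) - l) < e" if "a \<in> midhull U N" for a
    using that
  proof (induction rule: midhull.induct)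
    case (base j)
    then show ?case by (rule N)
  next
    case (mid a b)
    note i = L2_inner_integrable[OF midhull_L2[OF mid.hyps(1) U] \<Phi>] L2_inner_integrable[OF midhull_L2[OF mid.hyps(2) U] \<Phi>]
    have "(\<integral>x. ((1/2) *\<^sub>R (a x + b x)) \<bullet> \<Phi> x \<partial>M) = ((\<integral>x. a x \<bullet> \<Phi> x \<partial>M) + (\<integral>x. b x \<bullet> \<Phi> x \<partial>M)) / 2"
      using i by (simp add: inner_add_left)
    with mid.IH show ?case by (simp add: field_simps abs_less_iff)
  qed
  then show "\<exists>no. \<forall>n\<ge>no. norm ((\<integral>x. y n x \<bullet> \<Phi> x \<partial>M) - l) < e"
    using midhull_mono[OF y] by blast
qed

text \<open>The strong limit of the midpoints is a weak limit in the sense of every functional that converges along the sequence.\<close>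

lemma (in finite_measure) L2_weak_limit:
  fixes U :: "nat \<Rightarrow> 'a \<Rightarrow> 'b::euclidean_space"
  assumes U: "\<And>j. U j \<in> L2 M" and C: "\<And>j. sqn M (U j) \<le> C"
  obtains y Y where "Y \<in> L2 M" "\<And>k. y k \<in> midhull U k" "(\<lambda>k. sqn M (\<lambda>x. y k x - Y x)) \<longlonglongrightarrow> 0"
    "sqn M Y \<le> C" "\<And>\<Phi> l. \<Phi> \<in> L2 M \<Longrightarrow> (\<lambda>k. \<integral>x. U k x \<bullet> \<Phi> x \<partial>M) \<longlonglongrightarrow> l \<Longrightarrow> (\<integral>x. Y x \<bullet> \<Phi> x \<partial>M) = l"
proof -
  obtain y Y where Y: "Y \<in> L2 M" and y: "\<And>k. y k \<in> midhull U k" and lim: "(\<lambda>k. sqn M (\<lambda>x. y k x - Y x)) \<longlonglongrightarrow> 0"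
    using strongly_convergent_midpoints[of U C] U C by blast
  have yL: "y k \<in> L2 M" for k by (rule midhull_L2[OF y U])
  have "sqn M Y \<le> C"
    by (rule LIMSEQ_le_const2[OF L2_tendsto_sqn[OF yL Y lim]]) (use midhull_sqn_le[OF y U C] in blast)
  moreover have "(\<integral>x. Y x \<bullet> \<Phi> x \<partial>M) = l"
    if "\<Phi> \<in> L2 M" "(\<lambda>k. \<integral>x. U k x \<bullet> \<Phi> x \<partial>M) \<longlonglongrightarrow> l" for \<Phi> l
    by (rule LIMSEQ_unique[OF L2_tendsto_inner[OF yL Y that(1) lim] midhull_functional_limit[OF U that y]])
  ultimately show ?thesis using Y y lim by (intro that)
qed

lemma (in finite_measure) L2_limit_AE_closed:
  fixes y :: "nat \<Rightarrow> 'a \<Rightarrow> 'b::euclidean_space"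
  assumes "\<And>k. y k \<in> L2 M" "Y \<in> L2 M" "(\<lambda>k. sqn M (\<lambda>x. y k x - Y x)) \<longlonglongrightarrow> 0"
    and S: "closed S" "\<And>k. AE x in M. y k x \<in> S"
  shows "AE x in M. Y x \<in> S"
proof -
  have dL: "(\<lambda>x. y k x - Y x) \<in> L2 M" for k by (intro L2_diff assms)
  obtain r where r: "strict_mono (r::nat\<Rightarrow>nat)" "AE x in M. (\<lambda>k. y (r k) x - Y x) \<longlonglongrightarrow> 0"
    using tendsto_L1_AE_subseq[OF L2_integrable[OF dL] L2_tendsto_L1[OF dL assms(3)]] by auto
  have "AE x in M. \<forall>k. y k x \<in> S" using S(2) by (simp add: AE_all_countable)
  with r(2) show ?thesis
  proof eventually_elim
    case (elim x)
    have "(\<lambda>k. y (r k) x) \<longlonglongrightarrow> Y x" using elim(1) by (simp add: LIM_zero_iff)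
    with elim(2) show ?case by (intro Lim_in_closed_set[OF S(1)]) auto
  qed
qed

lemma midhull_AE_convex:
  assumes "a \<in> midhull U k" "convex S" "\<And>j. AE x in M. U j x \<in> S"
  shows "AE x in M. a x \<in> S"
  using assms(1)
proof (induction rule: midhull.induct)
  case (base j)
  show ?case by (rule assms(3))
next
  case (mid a b)
  from mid.IH show ?case
  proof eventually_elim
    case (elim x)
    from convexD[OF assms(2) elim, of "1/2" "1/2"] show ?case by (simp add: scaleR_add_right)
  qed
qed

text \<open>The weak limit of the pairs is again in \<open>H0 \<Omega>\<close>, which is closed; its first component is identified with \<open>w\<close> by testing.\<close>

lemma (in bounded_open_set) H0_weak_limit:
  assumes V: "\<And>k. V k \<in> H0 \<Omega>" and C: "\<And>k. sqn (lebesgue_on \<Omega>) (V k) \<le> C"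
    and w: "w \<in> Lp_loc 1 \<Omega>"
    and lim: "\<And>\<psi>. \<psi> \<in> C1c \<Omega> \<Longrightarrow> (\<lambda>k. \<integral>x. fst (V k x) * \<psi> x \<partial>lebesgue_on \<Omega>) \<longlonglongrightarrow> (\<integral>x. w x * \<psi> x \<partial>lebesgue_on \<Omega>)"
  obtains g where "(\<lambda>x. (w x, g x)) \<in> H0 \<Omega>" "sqn (lebesgue_on \<Omega>) (\<lambda>x. (w x, g x)) \<le> C"
    "\<And>\<Phi> l. \<Phi> \<in> L2 (lebesgue_on \<Omega>) \<Longrightarrow> (\<lambda>k. \<integral>x. \<Phi> x \<bullet> snd (V k x) \<partial>lebesgue_on \<Omega>) \<longlonglongrightarrow> l
      \<Longrightarrow> (\<integral>x. \<Phi> x \<bullet> g x \<partial>lebesgue_on \<Omega>) = l"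
proof -
  let ?L = "lebesgue_on \<Omega>"
  obtain y Y where Y: "Y \<in> L2 ?L" and y: "\<And>k. y k \<in> midhull V k" and yY: "(\<lambda>k. sqn ?L (\<lambda>x. y k x - Y x)) \<longlonglongrightarrow> 0"
    and YC: "sqn ?L Y \<le> C"
    and Yl: "\<And>\<Phi> l. \<Phi> \<in> L2 ?L \<Longrightarrow> (\<lambda>k. \<integral>x. V k x \<bullet> \<Phi> x \<partial>?L) \<longlonglongrightarrow> l \<Longrightarrow> (\<integral>x. Y x \<bullet> \<Phi> x \<partial>?L) = l"
    by (rule L2_weak_limit[OF H0_L2[OF V] C], rule that, assumption+)
  have YH: "Y \<in> H0 \<Omega>"
    by (rule H0_closed[OF H0_midhull[OF y V] Y yY])
  have "AE x in ?L. fst (Y x) - w x = 0"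
  proof (rule fundamental_lemma[OF open_Om])
    have fl: "(\<lambda>x. fst (Y x)) \<in> Lp_loc 1 \<Omega>" by (rule L2_Lp_loc[OF H0_fst_L2[OF YH]])
    show "(\<lambda>x. fst (Y x) - w x) \<in> Lp_loc 1 \<Omega>"
      by (rule Lp_loc_1_I) (intro Bochner_Integration.integrable_diff Lp_loc_1_integrable[OF fl] Lp_loc_1_integrable[OF w])
    fix \<psi> assume \<psi>: "\<psi> \<in> C1c \<Omega>"
    have L: "(\<lambda>x. (\<psi> x, 0)) \<in> L2 ?L" using C1c_L2(1)[OF \<psi>] by (simp add: L2_pair) (simp add: L2_def)
    have "(\<integral>x. Y x \<bullet> (\<psi> x, 0) \<partial>?L) = (\<integral>x. w x * \<psi> x \<partial>?L)"
      using lim[OF \<psi>] by (intro Yl[OF L]) (simp add: inner_prod_def)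
    then have "(\<integral>x. \<psi> x * fst (Y x) \<partial>?L) = (\<integral>x. \<psi> x * w x \<partial>?L)"
      by (simp add: inner_prod_def mult.commute)
    then show "(\<integral>x. \<psi> x * (fst (Y x) - w x) \<partial>?L) = 0"
      using C1c_mult_integrable[OF Om_sets \<psi> fl] C1c_mult_integrable[OF Om_sets \<psi> w]
      by (simp add: right_diff_distrib)
  qed
  then have ae: "AE x in ?L. Y x = (w x, snd (Y x))" by eventually_elim (simp add: prod_eq_iff)
  have wH: "(\<lambda>x. (w x, snd (Y x))) \<in> H0 \<Omega>" by (rule H0_AE_cong[OF YH ae])
  show ?thesis
  proof (rule that[OF wH])
    show "sqn ?L (\<lambda>x. (w x, snd (Y x))) \<le> C"
      using L2_AE_cong(2)[OF Y L2_measurable[OF H0_L2[OF wH]] ae] YC by simp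
    fix \<Phi> :: "real^'N \<Rightarrow> real^'N" and l
    assume \<Phi>: "\<Phi> \<in> L2 ?L" and l: "(\<lambda>k. \<integral>x. \<Phi> x \<bullet> snd (V k x) \<partial>?L) \<longlonglongrightarrow> l"
    have L: "(\<lambda>x. (0::real, \<Phi> x)) \<in> L2 ?L" using \<Phi> by (simp add: L2_pair) (simp add: L2_def)
    show "(\<integral>x. \<Phi> x \<bullet> snd (Y x) \<partial>?L) = l"
      using Yl[OF L, of l] l by (simp add: inner_prod_def inner_commute)
  qed
qed

section \<open>Elliptic equations with bounded measurable coefficients\<close>

lemma norm_matrix_vector_le:
  fixes A :: "real^'n^'m"
  shows "norm (A *v x) \<le> norm A * norm x"
proof -
  have "(norm (A *v x))\<^sup>2 = (\<Sum>i\<in>UNIV. ((A *v x) $ i)\<^sup>2)"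
    by (simp add: norm_vec_def L2_set_def sum_nonneg)
  also have "\<dots> = (\<Sum>i\<in>UNIV. (A $ i \<bullet> x)\<^sup>2)"
    by (simp only: matrix_vector_mul_component)
  also have "\<dots> \<le> (\<Sum>i\<in>UNIV. (norm (A $ i))\<^sup>2 * (norm x)\<^sup>2)"
  proof (rule sum_mono)
    fix i
    show "(A $ i \<bullet> x)\<^sup>2 \<le> (norm (A $ i))\<^sup>2 * (norm x)\<^sup>2"
      using Cauchy_Schwarz_ineq[of "A $ i" x] by (simp add: power2_norm_eq_inner)
  qed
  also have "\<dots> = (\<Sum>i\<in>UNIV. (norm (A $ i))\<^sup>2) * (norm x)\<^sup>2" by (rule sum_distrib_right[symmetric])
  also have "(\<Sum>i\<in>UNIV. (norm (A $ i))\<^sup>2) = (norm A)\<^sup>2"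
    by (simp add: norm_vec_def L2_set_def sum_nonneg)
  also have "(norm A)\<^sup>2 * (norm x)\<^sup>2 = (norm A * norm x)\<^sup>2" by (simp only: power_mult_distrib)
  finally show ?thesis by (rule power2_le_imp_le) simp
qed

lemma borel_measurable_matrix_vector:
  fixes A :: "'a \<Rightarrow> real^'n^'m"
  assumes "A \<in> borel_measurable M" "g \<in> borel_measurable M"
  shows "(\<lambda>x. A x *v g x) \<in> borel_measurable M"
proof -
  have "bounded_bilinear (\<lambda>(A::real^'n^'m) x. A *v x)"
  proof
    show "\<exists>K. \<forall>(A::real^'n^'m) x. norm (A *v x) \<le> norm A * norm x * K"
      by (rule exI[of _ 1]) (simp add: norm_matrix_vector_le)
  qed (auto simp: matrix_vector_mult_def vec_eq_iff algebra_simps sum.distrib sum_distrib_left)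
  then have "continuous_on UNIV (\<lambda>p::(real^'n^'m) \<times> (real^'n). fst p *v snd p)"
    by (rule bounded_bilinear.continuous_on[OF _ continuous_on_fst[OF continuous_on_id] continuous_on_snd[OF continuous_on_id]])
  from borel_measurable_continuous_Pair[OF assms this] show ?thesis .
qed

text \<open>
  A continuously differentiable version of the truncation \<open>max 0 (t - k)\<close>, within \<open>\<epsilon>\<close> of it. Its derivative
  lies between 0 and 1, so it dominates its own square; this is why testing with the truncation
  controls the full energy of the truncation.
\<close>

definition soft_pos :: "real \<Rightarrow> real \<Rightarrow> real \<Rightarrow> real"
  where "soft_pos \<epsilon> k t = sqrt ((max 0 (t - k))\<^sup>2 + \<epsilon>\<^sup>2) - \<epsilon>"

definition soft_pos_deriv :: "real \<Rightarrow> real \<Rightarrow> real \<Rightarrow> real"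
  where "soft_pos_deriv \<epsilon> k t = max 0 (t - k) / sqrt ((max 0 (t - k))\<^sup>2 + \<epsilon>\<^sup>2)"

context fixes \<epsilon> k :: real assumes eps: "\<epsilon> > 0"
begin

lemma soft_pos_sqrt_pos: "sqrt ((max 0 (t - k))\<^sup>2 + \<epsilon>\<^sup>2) > 0"
  using eps by (simp add: add_nonneg_pos)

lemma soft_pos_has_derivative: "(soft_pos \<epsilon> k has_real_derivative soft_pos_deriv \<epsilon> k t) (at t)"
proof -
  have "((\<lambda>t. (max 0 (t - k))\<^sup>2) has_real_derivative 2 * max 0 (t - k) * (1 - 0)) (at t)"
    by (rule DERIV_chain2[OF pos_part_sq_derivative]) (intro derivative_intros)
  then have "((\<lambda>t. (max 0 (t - k))\<^sup>2 + \<epsilon>\<^sup>2) has_real_derivative 2 * max 0 (t - k)) (at t)"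
    using DERIV_add[OF _ DERIV_const[of "\<epsilon>\<^sup>2"]] by fastforce
  moreover have "(max 0 (t - k))\<^sup>2 + \<epsilon>\<^sup>2 > 0" using eps by (simp add: add_nonneg_pos)
  ultimately have "((\<lambda>t. sqrt ((max 0 (t - k))\<^sup>2 + \<epsilon>\<^sup>2)) has_real_derivative
      inverse (sqrt ((max 0 (t - k))\<^sup>2 + \<epsilon>\<^sup>2)) / 2 * (2 * max 0 (t - k))) (at t)"
    by (intro DERIV_chain2[of sqrt, OF DERIV_real_sqrt])
  from DERIV_diff[OF this DERIV_const[of \<epsilon>]] have D: "(soft_pos \<epsilon> k has_real_derivative
      inverse (sqrt ((max 0 (t - k))\<^sup>2 + \<epsilon>\<^sup>2)) / 2 * (2 * max 0 (t - k)) - 0) (at t)"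
    unfolding soft_pos_def[abs_def] .
  show ?thesis by (rule DERIV_cong[OF D]) (simp only: soft_pos_deriv_def divide_inverse, simp)
qed

lemma soft_pos_deriv_continuous: "continuous_on UNIV (soft_pos_deriv \<epsilon> k)"
  unfolding soft_pos_deriv_def[abs_def]
  using soft_pos_sqrt_pos by (intro continuous_intros) (auto simp: less_imp_neq[symmetric])

lemma soft_pos_deriv_bounds: "0 \<le> soft_pos_deriv \<epsilon> k t" "soft_pos_deriv \<epsilon> k t \<le> 1"
proof -
  show "0 \<le> soft_pos_deriv \<epsilon> k t" unfolding soft_pos_deriv_def by simp
  have "max 0 (t - k) \<le> sqrt ((max 0 (t - k))\<^sup>2 + \<epsilon>\<^sup>2)" by (rule real_le_rsqrt) simp
  then show "soft_pos_deriv \<epsilon> k t \<le> 1"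
    unfolding soft_pos_deriv_def using soft_pos_sqrt_pos by (simp add: divide_le_eq_1_pos)
qed

lemma soft_pos_zero: "t \<le> k \<Longrightarrow> soft_pos \<epsilon> k t = 0"
  using eps by (simp add: soft_pos_def)

lemma soft_pos_nonneg: "0 \<le> soft_pos \<epsilon> k t"
proof -
  have "\<epsilon> \<le> sqrt ((max 0 (t - k))\<^sup>2 + \<epsilon>\<^sup>2)" by (rule real_le_rsqrt) simp
  then show ?thesis by (simp add: soft_pos_def)
qed

lemma soft_pos_lower: "t - k - \<epsilon> \<le> soft_pos \<epsilon> k t"
proof -
  have "max 0 (t - k) \<le> sqrt ((max 0 (t - k))\<^sup>2 + \<epsilon>\<^sup>2)" by (rule real_le_rsqrt) simp
  moreover have "t - k \<le> max 0 (t - k)" by simp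
  ultimately have "t - k \<le> sqrt ((max 0 (t - k))\<^sup>2 + \<epsilon>\<^sup>2)" by (rule order_trans[rotated])
  then show ?thesis by (simp add: soft_pos_def)
qed

end

text \<open>A function that is not integrable has integral 0 by convention, which the last hypothesis covers.\<close>

lemma integral_le_integrable_bound:
  fixes f g :: "'a \<Rightarrow> real"
  assumes "integrable M g" "AE x in M. f x \<le> g x" "0 \<le> integral\<^sup>L M g"
  shows "integral\<^sup>L M f \<le> integral\<^sup>L M g"
proof (cases "integrable M f")
  case True
  then show ?thesis using assms by (intro integral_mono_AE)
qed (use assms(3) in \<open>simp add: not_integrable_integral_eq\<close>)

locale elliptic_problem = bounded_open_set \<Omega> for \<Omega> :: "(real^'N) set" +
  fixes M :: "real^'N \<Rightarrow> real^'N^'N" and \<alpha> \<beta> :: real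
  assumes elliptic: "elliptic_matrix \<Omega> \<alpha> \<beta> M"
begin

lemma alpha_pos: "\<alpha> > 0" and beta_pos: "\<beta> > 0"
  and M_measurable: "M \<in> borel_measurable (lebesgue_on \<Omega>)"
  and M_coercive: "AE x in lebesgue_on \<Omega>. \<forall>\<xi>. \<alpha> * (norm \<xi>)\<^sup>2 \<le> (M x *v \<xi>) \<bullet> \<xi>"
  and M_bounded: "AE x in lebesgue_on \<Omega>. norm (M x) \<le> \<beta>"
  using elliptic unfolding elliptic_matrix_def by auto

lemma flux_bound: "AE x in lebesgue_on \<Omega>. \<forall>\<xi>. norm (M x *v \<xi>) \<le> \<beta> * norm \<xi>"
  using M_bounded
proof eventually_elim
  case (elim x)
  show ?case using norm_matrix_vector_le[of "M x"] mult_right_mono[OF elim norm_ge_zero] by (blast intro: order_trans)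
qed

lemma flux_L2:
  assumes "g \<in> L2 (lebesgue_on \<Omega>)"
  shows "(\<lambda>x. M x *v g x) \<in> L2 (lebesgue_on \<Omega>)"
proof -
  have m: "(\<lambda>x. M x *v g x) \<in> borel_measurable (lebesgue_on \<Omega>)"
    by (rule borel_measurable_matrix_vector[OF M_measurable L2_measurable[OF assms]])
  have "integrable (lebesgue_on \<Omega>) (\<lambda>x. (norm (M x *v g x))\<^sup>2)"
  proof (rule Bochner_Integration.integrable_bound)
    show "integrable (lebesgue_on \<Omega>) (\<lambda>x. \<beta>\<^sup>2 * (norm (g x))\<^sup>2)" using L2_integrable_sq[OF assms] by auto
    show "(\<lambda>x. (norm (M x *v g x))\<^sup>2) \<in> borel_measurable (lebesgue_on \<Omega>)" using m by measurable
    show "AE x in lebesgue_on \<Omega>. norm ((norm (M x *v g x))\<^sup>2) \<le> norm (\<beta>\<^sup>2 * (norm (g x))\<^sup>2)"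
      using flux_bound
    proof eventually_elim
      case (elim x)
      from power_mono[OF spec[OF elim] norm_ge_zero, of "g x" 2] show ?case by (simp add: power_mult_distrib)
    qed
  qed
  with m show ?thesis by (simp add: L2_def)
qed

lemma flux_coercive:
  assumes g: "g \<in> L2 (lebesgue_on \<Omega>)" and h: "(\<lambda>x. \<theta> x *\<^sub>R g x) \<in> L2 (lebesgue_on \<Omega>)"
    and \<theta>: "\<And>x. 0 \<le> \<theta> x" "\<And>x. \<theta> x \<le> 1"
  shows "\<alpha> * sqn (lebesgue_on \<Omega>) (\<lambda>x. \<theta> x *\<^sub>R g x) \<le> (\<integral>x. (M x *v g x) \<bullet> (\<theta> x *\<^sub>R g x) \<partial>lebesgue_on \<Omega>)"
proof -
  have "\<alpha> * sqn (lebesgue_on \<Omega>) (\<lambda>x. \<theta> x *\<^sub>R g x) = (\<integral>x. \<alpha> * (norm (\<theta> x *\<^sub>R g x))\<^sup>2 \<partial>lebesgue_on \<Omega>)"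
    by (simp add: sqn_def)
  also have "\<dots> \<le> (\<integral>x. (M x *v g x) \<bullet> (\<theta> x *\<^sub>R g x) \<partial>lebesgue_on \<Omega>)"
  proof (rule integral_mono_AE)
    show "integrable (lebesgue_on \<Omega>) (\<lambda>x. \<alpha> * (norm (\<theta> x *\<^sub>R g x))\<^sup>2)" using L2_integrable_sq[OF h] by auto
    show "integrable (lebesgue_on \<Omega>) (\<lambda>x. (M x *v g x) \<bullet> (\<theta> x *\<^sub>R g x))"
      by (rule L2_inner_integrable[OF flux_L2[OF g] h])
    show "AE x in lebesgue_on \<Omega>. \<alpha> * (norm (\<theta> x *\<^sub>R g x))\<^sup>2 \<le> (M x *v g x) \<bullet> (\<theta> x *\<^sub>R g x)"
      using M_coercive
    proof eventually_elim
      case (elim x)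
      have "(\<theta> x)\<^sup>2 \<le> \<theta> x" using \<theta>[of x] by (simp add: power2_eq_square mult_left_le_one_le)
      then have "\<alpha> * ((\<theta> x)\<^sup>2 * (norm (g x))\<^sup>2) \<le> \<alpha> * (\<theta> x * (norm (g x))\<^sup>2)"
        using alpha_pos by (intro mult_left_mono mult_right_mono) auto
      also have "\<dots> = \<theta> x * (\<alpha> * (norm (g x))\<^sup>2)" by simp
      also have "\<dots> \<le> \<theta> x * ((M x *v g x) \<bullet> g x)" using elim \<theta>(1) by (intro mult_left_mono) auto
      finally show ?case using \<theta>(1)[of x] by (simp add: power_mult_distrib)
    qed
  qed
  finally show ?thesis .
qed

definition weak_solution :: "(real^'N \<Rightarrow> real \<times> (real^'N)) \<Rightarrow> (real^'N \<Rightarrow> real) \<Rightarrow> bool"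
  where "weak_solution V G \<longleftrightarrow> V \<in> H0 \<Omega> \<and>
    (\<forall>W\<in>H0 \<Omega>. (\<integral>x. (M x *v snd (V x)) \<bullet> snd (W x) \<partial>lebesgue_on \<Omega>) = (\<integral>x. G x * fst (W x) \<partial>lebesgue_on \<Omega>))"

lemma superlevel_sets:
  assumes "V \<in> H0 \<Omega>"
  shows "{x \<in> \<Omega>. fst (V x) > k} \<in> sets (lebesgue_on \<Omega>)"
proof -
  have "{x \<in> space (lebesgue_on \<Omega>). k < fst (V x)} \<in> sets (lebesgue_on \<Omega>)"
    using L2_measurable[OF H0_fst_L2[OF assms]] by measurable
  then show ?thesis by simp
qed

text \<open>
  One step of Stampacchia's iteration. Let \<open>l\<close> be the integral of the truncation at level \<open>k\<close> and \<open>a k\<close> the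
  measure of its support. Testing with the truncation bounds its energy by \<open>\<Lambda> l / \<alpha>\<close>; with Faber-Krahn and
  \<open>l\<^sup>2 \<le> a k \<parallel>\<cdot>\<parallel>\<^sup>2\<close> this becomes \<open>l \<le> 2 \<Lambda> R\<^sup>2 a k / \<alpha>\<close>, and \<open>l \<ge> (h - k) a h\<close> by Chebyshev.
\<close>

lemma superlevel_decay:
  assumes V: "weak_solution V G" and k: "0 \<le> k" and \<Lambda>: "0 \<le> \<Lambda>"
    and G: "AE x in lebesgue_on \<Omega>. fst (V x) > k \<longrightarrow> G x \<le> \<Lambda>"
    and R: "R > 0" "4 * measure (lebesgue_on \<Omega>) {x \<in> \<Omega>. fst (V x) > k} \<le> measure lborel (ball (0::real^'N) R)"
    and h: "h > k"
  shows "(h - k) * measure (lebesgue_on \<Omega>) {x \<in> \<Omega>. fst (V x) > h}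
    \<le> 2 * \<Lambda> / \<alpha> * R\<^sup>2 * measure (lebesgue_on \<Omega>) {x \<in> \<Omega>. fst (V x) > k}"
proof -
  let ?L = "lebesgue_on \<Omega>"
  define a where "a k = measure ?L {x \<in> \<Omega>. fst (V x) > k}" for k
  have VH: "V \<in> H0 \<Omega>" using V by (simp add: weak_solution_def)
  have eps: "(h - k - \<epsilon>) * a h \<le> 2 * \<Lambda> / \<alpha> * R\<^sup>2 * a k" if "\<epsilon> > 0" for \<epsilon>
  proof -
    define W where "W x = (soft_pos \<epsilon> k (fst (V x)), soft_pos_deriv \<epsilon> k (fst (V x)) *\<^sub>R snd (V x))" for x
    have WH: "W \<in> H0 \<Omega>"
      unfolding W_def[abs_def]
    proof (rule H0_compose[OF VH soft_pos_has_derivative[OF that] soft_pos_deriv_continuous[OF that]])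
      show "soft_pos \<epsilon> k 0 = 0" by (rule soft_pos_zero[OF that k])
      show "\<bar>soft_pos_deriv \<epsilon> k t\<bar> \<le> 1" for t using soft_pos_deriv_bounds[OF that, of k t] by simp
    qed
    have W0: "fst (W x) \<ge> 0" for x by (simp add: W_def soft_pos_nonneg[OF that])
    have Wi: "integrable ?L (\<lambda>x. fst (W x))" by (rule L2_integrable[OF H0_fst_L2[OF WH]])
    define l where "l = (\<integral>x. fst (W x) \<partial>?L)"
    have l0: "l \<ge> 0" unfolding l_def using W0 by simp
    have off: "fst (W x) = 0" if "x \<in> \<Omega>" "x \<notin> {x \<in> \<Omega>. fst (V x) > k}" for x
      using that soft_pos_zero[OF \<open>\<epsilon> > 0\<close>, of "fst (V x)" k] by (simp add: W_def)
    have FK: "sqn ?L (\<lambda>x. fst (W x)) \<le> 2 * R\<^sup>2 * sqn ?L (\<lambda>x. snd (W x))"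
      by (rule H0_Faber_Krahn[OF WH R(1) superlevel_sets[OF VH] off R(2)])
    have "\<alpha> * sqn ?L (\<lambda>x. snd (W x)) \<le> (\<integral>x. (M x *v snd (V x)) \<bullet> snd (W x) \<partial>?L)"
      using flux_coercive[OF H0_snd_L2[OF VH], of "\<lambda>x. soft_pos_deriv \<epsilon> k (fst (V x))"] H0_snd_L2[OF WH]
        soft_pos_deriv_bounds[OF that] by (simp add: W_def)
    also have "\<dots> = (\<integral>x. G x * fst (W x) \<partial>?L)" using V WH by (simp add: weak_solution_def)
    also have "\<dots> \<le> (\<integral>x. \<Lambda> * fst (W x) \<partial>?L)"
    proof (rule integral_le_integrable_bound)
      show "integrable ?L (\<lambda>x. \<Lambda> * fst (W x))" using Wi by auto
      show "0 \<le> (\<integral>x. \<Lambda> * fst (W x) \<partial>?L)" using l0 \<Lambda> by (simp add: l_def)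
      show "AE x in ?L. G x * fst (W x) \<le> \<Lambda> * fst (W x)"
        using G
      proof eventually_elim
        case (elim x)
        show ?case
        proof (cases "fst (V x) > k")
          case True
          with elim W0[of x] show ?thesis by (intro mult_right_mono) auto
        next
          case False
          then show ?thesis using soft_pos_zero[OF \<open>\<epsilon> > 0\<close>, of "fst (V x)" k] by (simp add: W_def)
        qed
      qed
    qed
    also have "\<dots> = \<Lambda> * l" by (simp add: l_def)
    finally have en: "sqn ?L (\<lambda>x. snd (W x)) \<le> \<Lambda> * l / \<alpha>" using alpha_pos by (simp add: field_simps)
    have ak: "a k \<ge> 0" by (simp add: a_def)
    have "l\<^sup>2 \<le> a k * sqn ?L (\<lambda>x. fst (W x))"
      using L1_sq_le[OF H0_fst_L2[OF WH] superlevel_sets[OF VH, of k]] off W0 by (simp add: a_def l_def)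
    also have "\<dots> \<le> a k * (2 * R\<^sup>2 * (\<Lambda> * l / \<alpha>))"
      using FK mult_left_mono[OF en, of "2 * R\<^sup>2"] ak by (intro mult_left_mono) auto
    finally have "l * l \<le> (2 * \<Lambda> / \<alpha> * R\<^sup>2 * a k) * l" by (simp add: power2_eq_square field_simps)
    have lb: "l \<le> 2 * \<Lambda> / \<alpha> * R\<^sup>2 * a k"
    proof (cases "l = 0")
      case True
      then show ?thesis using ak \<Lambda> alpha_pos by simp
    next
      case False
      with l0 have "l > 0" by simp
      with \<open>l * l \<le> _\<close> show ?thesis by (rule mult_right_le_imp_le)
    qed
    show ?thesis
    proof (cases "h - k - \<epsilon> \<ge> 0")
      case True
      have "(h - k - \<epsilon>) * a h = (\<integral>x. (h - k - \<epsilon>) * indicator {x \<in> \<Omega>. fst (V x) > h} x \<partial>?L)"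
      proof -
        have "{x \<in> \<Omega>. fst (V x) > h} \<inter> \<Omega> = {x \<in> \<Omega>. fst (V x) > h}" by auto
        then show ?thesis using superlevel_sets[OF VH, of h] by (simp add: a_def)
      qed
      also have "\<dots> \<le> l"
        unfolding l_def
      proof (rule integral_mono)
        show "integrable ?L (\<lambda>x. (h - k - \<epsilon>) * indicator {x \<in> \<Omega>. fst (V x) > h} x)"
          using superlevel_sets[OF VH, of h] by (intro integrable_mult_right integrable_real_indicator) (auto simp: emeasure_eq_measure)
        show "(h - k - \<epsilon>) * indicator {x \<in> \<Omega>. fst (V x) > h} x \<le> fst (W x)" for x
          using soft_pos_lower[OF that, of "fst (V x)" k] W0[of x] by (auto simp: indicator_def W_def)
      qed (rule Wi)
      finally show ?thesis using lb by simp
    next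
      case False
      then have "(h - k - \<epsilon>) * a h \<le> 0" by (simp add: a_def mult_nonpos_nonneg)
      then show ?thesis using lb l0 by linarith
    qed
  qed
  have "(\<lambda>i. (h - k - inverse (real (Suc i))) * a h) \<longlonglongrightarrow> (h - k - 0) * a h"
    by (intro tendsto_intros LIMSEQ_inverse_real_of_nat)
  from LIMSEQ_le_const2[OF this] eps have "(h - k - 0) * a h \<le> 2 * \<Lambda> / \<alpha> * R\<^sup>2 * a k" by force
  then show ?thesis by (simp add: a_def)
qed

lemma ball_measure_half_power:
  assumes "R > 0"
  shows "measure lborel (ball (0::real^'N) (R / 2^j)) = measure lborel (ball (0::real^'N) R) / 2^(j * CARD('N))"
  using assms by (simp add: content_ball power_divide power_mult)

lemma ex_large_ball: "\<exists>R>0. 4 * measure (lebesgue_on \<Omega>) \<Omega> \<le> measure lborel (ball (0::real^'N) R)"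
proof -
  define c where "c = unit_ball_vol (real (CARD('N)))"
  have c: "c > 0" by (simp add: c_def)
  define R where "R = max 1 (4 * measure (lebesgue_on \<Omega>) \<Omega> / c)"
  have R1: "R \<ge> 1" by (simp add: R_def)
  have "4 * measure (lebesgue_on \<Omega>) \<Omega> \<le> c * R"
    using c by (auto simp: R_def field_simps max_def)
  also have "\<dots> \<le> c * R ^ CARD('N)"
    using c R1 self_le_power[OF R1, of "CARD('N)"] by (intro mult_left_mono) auto
  also have "\<dots> = measure lborel (ball (0::real^'N) R)"
    using R1 by (simp add: content_ball c_def)
  finally show ?thesis using R1 by (intro exI[of _ R]) auto
qed

text \<open>
  Iterating along levels \<open>\<kappa> j\<close> that increase to \<open>k + d\<close>, with increments \<open>d / 2 ^ (j + 1)\<close>. The measures of the superlevel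
  sets decay like \<open>2 ^ (- j N)\<close>, which is exactly the rate at which the volume of balls of radius \<open>R / 2 ^ j\<close>
  decays; the factor \<open>4 ^ (- j)\<close> from the squared radii beats the loss \<open>2 ^ j\<close> from the increments.
\<close>

lemma weak_solution_upper_bound:
  assumes V: "weak_solution V G" and k: "0 \<le> k" and \<Lambda>: "0 < \<Lambda>"
    and G: "AE x in lebesgue_on \<Omega>. fst (V x) > k \<longrightarrow> G x \<le> \<Lambda>"
    and R: "R > 0" "4 * measure (lebesgue_on \<Omega>) \<Omega> \<le> measure lborel (ball (0::real^'N) R)"
  shows "AE x in lebesgue_on \<Omega>. fst (V x) \<le> k + 2^(CARD('N) + 1) * (2 * \<Lambda> / \<alpha>) * R\<^sup>2"
proof -
  let ?L = "lebesgue_on \<Omega>" and ?n = "CARD('N)"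
  define a where "a k = measure ?L {x \<in> \<Omega>. fst (V x) > k}" for k
  define c where "c = 2 * \<Lambda> / \<alpha>"
  have c: "c > 0" using \<Lambda> alpha_pos by (simp add: c_def)
  \<comment> \<open>the smallest \<open>d\<close> for which the first step gains the factor \<open>2 ^ (- N)\<close>\<close>
  define d where "d = 2^(?n + 1) * c * R\<^sup>2"
  have d: "d > 0" using c R by (simp add: d_def)
  define \<kappa> where "\<kappa> j = k + d * (1 - 1 / 2^j)" for j :: nat
  have VH: "V \<in> H0 \<Omega>" using V by (simp add: weak_solution_def)
  have \<kappa>k: "\<kappa> j \<ge> k" for j using d by (simp add: \<kappa>_def)
  have a0: "a t \<ge> 0" for t by (simp add: a_def)
  have aOm: "a t \<le> measure ?L \<Omega>" for t
    unfolding a_def by (rule finite_measure_mono) auto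
  have dec: "a (\<kappa> j) \<le> measure ?L \<Omega> / 2^(j * ?n)" for j
  proof (induction j)
    case 0
    show ?case using aOm by simp
  next
    case (Suc j)
    have step: "\<kappa> (Suc j) - \<kappa> j = d / 2^(Suc j)" by (simp add: \<kappa>_def field_simps)
    have "(\<kappa> (Suc j) - \<kappa> j) * a (\<kappa> (Suc j)) \<le> c * (R / 2^j)\<^sup>2 * a (\<kappa> j)"
      unfolding a_def c_def
    proof (rule superlevel_decay[OF V])
      show "0 \<le> \<kappa> j" using \<kappa>k[of j] k by linarith
      show "0 \<le> \<Lambda>" using \<Lambda> by simp
      show "AE x in ?L. fst (V x) > \<kappa> j \<longrightarrow> G x \<le> \<Lambda>"
        using G by eventually_elim (use \<kappa>k[of j] in auto)
      show "R / 2^j > 0" using R by simp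
      have "4 * a (\<kappa> j) \<le> 4 * measure ?L \<Omega> / 2^(j * ?n)" using Suc.IH by simp
      also have "\<dots> \<le> measure lborel (ball (0::real^'N) R) / 2^(j * ?n)"
        using R(2) by (intro divide_right_mono) auto
      finally show "4 * measure ?L {x \<in> \<Omega>. \<kappa> j < fst (V x)} \<le> measure lborel (ball (0::real^'N) (R / 2^j))"
        using ball_measure_half_power[OF R(1), of j] by (simp add: a_def)
      show "\<kappa> j < \<kappa> (Suc j)" using step d by (smt (verit) divide_pos_pos zero_less_power)
    qed
    then have "d * a (\<kappa> (Suc j)) \<le> 2^(Suc j) * (c * (R / 2^j)\<^sup>2 * a (\<kappa> j))"
      unfolding step by (simp add: field_simps)
    also have "\<dots> = 2 * c * R\<^sup>2 * (a (\<kappa> j) / 2^j)"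
      by (simp add: power_divide power2_eq_square)
    also have "\<dots> \<le> 2 * c * R\<^sup>2 * (measure ?L \<Omega> / 2^(j * ?n))"
    proof (rule mult_left_mono)
      have "a (\<kappa> j) / 2^j \<le> a (\<kappa> j)" using a0[of "\<kappa> j"] by (simp add: divide_le_eq mult_le_cancel_left1)
      then show "a (\<kappa> j) / 2^j \<le> measure ?L \<Omega> / 2^(j * ?n)" using Suc.IH by linarith
    qed (use c in auto)
    also have "\<dots> = d * (measure ?L \<Omega> / 2^(Suc j * ?n))"
      by (simp add: d_def power_add)
    finally show ?case using d by (rule mult_left_le_imp_le)
  qed
  have n1: "?n \<ge> 1" by (simp add: Suc_leI)
  have "a (k + d) \<le> measure ?L \<Omega> * (1/2)^j" for j
  proof -
    have "d * (1 - 1 / 2^j) \<le> d * 1" using d by (intro mult_left_mono) auto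
    then have "\<kappa> j \<le> k + d" by (simp add: \<kappa>_def)
    then have "a (k + d) \<le> a (\<kappa> j)"
      unfolding a_def by (intro finite_measure_mono superlevel_sets[OF VH]) auto
    also have "\<dots> \<le> measure ?L \<Omega> / 2^(j * ?n)" by (rule dec)
    also have "\<dots> \<le> measure ?L \<Omega> / 2^j"
      using n1 by (intro divide_left_mono power_increasing) auto
    finally show ?thesis by (simp add: power_divide)
  qed
  moreover have "(\<lambda>j. measure ?L \<Omega> * (1/2)^j) \<longlonglongrightarrow> measure ?L \<Omega> * 0"
    by (intro tendsto_intros LIMSEQ_power_zero) auto
  ultimately have "a (k + d) \<le> measure ?L \<Omega> * 0"
    by (intro LIMSEQ_le_const) auto
  then have "a (k + d) = 0" using a0[of "k + d"] by simp
  then have "emeasure ?L {x \<in> space ?L. \<not> fst (V x) \<le> k + d} = 0"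
    by (simp add: a_def emeasure_eq_measure not_le)
  then have "AE x in ?L. fst (V x) \<le> k + d"
    using superlevel_sets[OF VH, of "k + d"] by (subst AE_iff_measurable[OF _ refl]) (simp_all add: not_le)
  then show ?thesis by (simp add: d_def c_def)
qed

text \<open>Young's inequality, weighted so that half of the coercivity constant is left over for absorption.\<close>

lemma flux_test_bound:
  assumes gL: "g \<in> L2 (lebesgue_on \<Omega>)" and \<phi>: "\<phi> \<in> C1c \<Omega>"
  shows "(\<integral>x. (M x *v g x) \<bullet> grad \<phi> x \<partial>lebesgue_on \<Omega>)
    \<le> \<alpha> / 2 * sqn (lebesgue_on \<Omega>) g + \<beta>\<^sup>2 / (2 * \<alpha>) * sqn (lebesgue_on \<Omega>) (grad \<phi>)"
proof -
  let ?L = "lebesgue_on \<Omega>"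
  have "(\<integral>x. (M x *v g x) \<bullet> grad \<phi> x \<partial>?L) \<le> (\<integral>x. \<alpha> / 2 * (norm (g x))\<^sup>2 + \<beta>\<^sup>2 / (2 * \<alpha>) * (norm (grad \<phi> x))\<^sup>2 \<partial>?L)"
  proof (rule integral_mono_AE)
    show "integrable ?L (\<lambda>x. (M x *v g x) \<bullet> grad \<phi> x)"
      by (rule L2_inner_integrable[OF flux_L2[OF gL] C1c_L2(2)[OF \<phi>]])
    show "integrable ?L (\<lambda>x. \<alpha> / 2 * (norm (g x))\<^sup>2 + \<beta>\<^sup>2 / (2 * \<alpha>) * (norm (grad \<phi> x))\<^sup>2)"
      using L2_integrable_sq[OF gL] L2_integrable_sq[OF C1c_L2(2)[OF \<phi>]] by auto
    show "AE x in ?L. (M x *v g x) \<bullet> grad \<phi> x \<le> \<alpha> / 2 * (norm (g x))\<^sup>2 + \<beta>\<^sup>2 / (2 * \<alpha>) * (norm (grad \<phi> x))\<^sup>2"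
      using flux_bound
    proof eventually_elim
      case (elim x)
      define s t where "s = norm (g x)" and "t = norm (grad \<phi> x)"
      have "(M x *v g x) \<bullet> grad \<phi> x \<le> norm (M x *v g x) * t"
        unfolding t_def by (rule norm_cauchy_schwarz)
      also have "\<dots> \<le> \<beta> * s * t" using elim by (intro mult_right_mono) (auto simp: s_def t_def)
      also have "\<dots> \<le> \<alpha> / 2 * s\<^sup>2 + \<beta>\<^sup>2 / (2 * \<alpha>) * t\<^sup>2"
      proof -
        have "0 \<le> (\<alpha> * s - \<beta> * t)\<^sup>2" by simp
        then have "2 * \<alpha> * (\<beta> * s * t) \<le> \<alpha>\<^sup>2 * s\<^sup>2 + \<beta>\<^sup>2 * t\<^sup>2"
          by (simp add: power2_eq_square algebra_simps)
        then show ?thesis using alpha_pos by (simp add: field_simps power2_eq_square)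
      qed
      finally show ?case by (simp add: s_def t_def)
    qed
  qed
  also have "\<dots> = \<alpha> / 2 * sqn ?L g + \<beta>\<^sup>2 / (2 * \<alpha>) * sqn ?L (grad \<phi>)"
    using L2_integrable_sq[OF gL] L2_integrable_sq[OF C1c_L2(2)[OF \<phi>]] by (simp add: sqn_def)
  finally show ?thesis .
qed

text \<open>
  Testing with \<open>V\<close> gives \<open>\<alpha> E \<le> F + X\<close>, testing with the cutoff \<open>\<phi>\<close> gives \<open>X \<le> \<alpha> E / 2 + D\<close>. Adding the two
  absorbs \<open>X\<close> and half of the energy.
\<close>

lemma weak_solution_energy:
  assumes V: "weak_solution V G" and G: "integrable (lebesgue_on \<Omega>) G" "AE x in lebesgue_on \<Omega>. 0 \<le> G x"
    and f: "integrable (lebesgue_on \<Omega>) f" "AE x in lebesgue_on \<Omega>. 0 \<le> f x"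
    and GV: "AE x in lebesgue_on \<Omega>. G x * fst (V x) \<le> f x + G x"
    and \<phi>: "\<phi> \<in> C1c \<Omega>" and supp: "AE x in lebesgue_on \<Omega>. G x \<le> G x * \<phi> x"
  defines "D \<equiv> \<beta>\<^sup>2 / (2 * \<alpha>) * sqn (lebesgue_on \<Omega>) (grad \<phi>)"
  shows "sqn (lebesgue_on \<Omega>) (\<lambda>x. snd (V x)) \<le> 2 * ((\<integral>x. f x \<partial>lebesgue_on \<Omega>) + D) / \<alpha>"
    and "(\<integral>x. G x \<partial>lebesgue_on \<Omega>) \<le> (\<integral>x. f x \<partial>lebesgue_on \<Omega>) + 2 * D"
proof -
  let ?L = "lebesgue_on \<Omega>"
  define E where "E = sqn ?L (\<lambda>x. snd (V x))"
  define X where "X = (\<integral>x. G x \<partial>?L)"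
  define F where "F = (\<integral>x. f x \<partial>?L)"
  have VH: "V \<in> H0 \<Omega>" using V by (simp add: weak_solution_def)
  note gL = H0_snd_L2[OF VH]
  have "\<alpha> * E \<le> (\<integral>x. (M x *v snd (V x)) \<bullet> snd (V x) \<partial>?L)"
    using flux_coercive[OF gL, of "\<lambda>_. 1"] gL by (simp add: E_def)
  also have "\<dots> = (\<integral>x. G x * fst (V x) \<partial>?L)" using V VH by (simp add: weak_solution_def)
  also have "\<dots> \<le> (\<integral>x. f x + G x \<partial>?L)"
  proof (rule integral_le_integrable_bound[OF _ GV])
    show "0 \<le> (\<integral>x. f x + G x \<partial>?L)"
      by (rule integral_nonneg_AE) (use f(2) G(2) in \<open>eventually_elim, simp\<close>)
  qed (use f G in auto)
  also have "\<dots> = F + X" using f G by (simp add: F_def X_def)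
  finally have 1: "\<alpha> * E \<le> F + X" .
  obtain B where B: "\<And>x. \<bar>\<phi> x\<bar> \<le> B" by (rule C1c_bounded[OF \<phi>]) blast
  have Gphi: "integrable ?L (\<lambda>x. G x * \<phi> x)"
  proof (rule Bochner_Integration.integrable_bound)
    show "integrable ?L (\<lambda>x. B * G x)" using G by auto
    show "(\<lambda>x. G x * \<phi> x) \<in> borel_measurable ?L"
      by (intro borel_measurable_times borel_measurable_integrable[OF G(1)] continuous_borel_lebesgue_on C1c_continuous[OF \<phi>])
    have "norm (G x * \<phi> x) \<le> norm (B * G x)" for x
    proof -
      have "\<bar>\<phi> x\<bar> \<le> \<bar>B\<bar>" using B[of x] by linarith
      then show ?thesis using mult_right_mono[of "\<bar>\<phi> x\<bar>" "\<bar>B\<bar>" "\<bar>G x\<bar>"] by (simp add: abs_mult mult.commute)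
    qed
    then show "AE x in ?L. norm (G x * \<phi> x) \<le> norm (B * G x)" by simp
  qed
  have "X \<le> (\<integral>x. G x * \<phi> x \<partial>?L)" unfolding X_def by (rule integral_mono_AE[OF G(1) Gphi supp])
  also have "\<dots> = (\<integral>x. (M x *v snd (V x)) \<bullet> grad \<phi> x \<partial>?L)"
    using V jet_H0[OF \<phi>] unfolding weak_solution_def by (auto simp: jet_def dest: bspec[of _ _ "jet \<phi>"])
  also have "\<dots> \<le> \<alpha> / 2 * E + D"
    unfolding E_def D_def by (rule flux_test_bound[OF gL \<phi>])
  finally have 2: "X \<le> \<alpha> / 2 * E + D" .
  from 1 2 have 3: "\<alpha> * E \<le> 2 * (F + D)" by simp
  then have "E \<le> 2 * (F + D) / \<alpha>" using alpha_pos by (simp add: field_simps)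
  then show "sqn ?L (\<lambda>x. snd (V x)) \<le> 2 * ((\<integral>x. f x \<partial>?L) + D) / \<alpha>" by (simp add: E_def F_def)
  from 2 3 have "X \<le> F + 2 * D" by simp
  then show "(\<integral>x. G x \<partial>?L) \<le> (\<integral>x. f x \<partial>?L) + 2 * D" by (simp add: X_def F_def)
qed

end

section \<open>Weak compactness of measures\<close>

text \<open>
  The point of the Cantor set whose ternary digits record the membership in the sets \<open>D i\<close>. Digits 0 and 2
  make nearby codes agree in their first digits.
\<close>

definition ternary_code :: "(nat \<Rightarrow> 'a set) \<Rightarrow> 'a \<Rightarrow> real"
  where "ternary_code D x = (\<Sum>i. indicator (D i) x * (2 / 3 ^ Suc i))"

lemma ternary_code_summable: "summable (\<lambda>i. indicator (D i) x * (2 / 3 ^ Suc i) :: real)"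
proof (rule summable_comparison_test[OF _ summable_mult[OF summable_geometric, of "1/3" "2/3"]])
  show "\<exists>N. \<forall>n\<ge>N. norm (indicator (D n) x * (2 / 3 ^ Suc n) :: real) \<le> 2 / 3 * (1/3)^n"
    by (auto simp: indicator_def power_divide)
qed auto

lemma ternary_tail: "(\<lambda>j. 2 / 3 ^ Suc (j + Suc i) :: real) sums (1 / 3 ^ Suc i)"
proof -
  have "(\<lambda>j. 2 / 3 ^ Suc (Suc i) * (1/3)^j :: real) sums (2 / 3 ^ Suc (Suc i) * (1 / (1 - 1/3)))"
    by (intro sums_mult geometric_sums) simp
  moreover have "2 / 3 ^ Suc (Suc i) * (1/3)^j = (2 / 3 ^ Suc (j + Suc i) :: real)" for j
    by (simp add: power_divide power_add)
  moreover have "2 / 3 ^ Suc (Suc i) * (1 / (1 - 1/3)) = (1 / 3 ^ Suc i :: real)" by simp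
  ultimately show ?thesis by simp
qed

lemma ternary_code_bounds: "0 \<le> ternary_code D x" "ternary_code D x \<le> 1"
proof -
  show "0 \<le> ternary_code D x" unfolding ternary_code_def by (intro suminf_nonneg ternary_code_summable) simp
  have s: "(\<lambda>j. 2 / 3 * (1/3)^j :: real) sums (2 / 3 * (1 / (1 - 1/3)))"
    by (intro sums_mult geometric_sums) simp
  have "ternary_code D x \<le> (\<Sum>j. 2 / 3 * (1/3)^j)"
    unfolding ternary_code_def by (intro suminf_le ternary_code_summable sums_summable[OF s]) (auto simp: indicator_def power_divide)
  also have "\<dots> = 1" using sums_unique[OF s] by simp
  finally show "ternary_code D x \<le> 1" .
qed

lemma ternary_code_near_imp_same_digits:
  assumes near: "\<bar>ternary_code D x - ternary_code D y\<bar> < 1 / 3 ^ n" and "i < n"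
  shows "x \<in> D i \<longleftrightarrow> y \<in> D i"
proof (rule ccontr)
  assume "\<not> (x \<in> D i \<longleftrightarrow> y \<in> D i)"
  \<comment> \<open>at the first digit that differs the codes separate by more than all later digits can repair\<close>
  define l where "l = (LEAST i. \<not> (x \<in> D i \<longleftrightarrow> y \<in> D i))"
  have l: "\<not> (x \<in> D l \<longleftrightarrow> y \<in> D l)" unfolding l_def by (rule LeastI) fact
  have "l \<le> i" unfolding l_def by (rule Least_le) fact
  with \<open>i < n\<close> have ln: "Suc l \<le> n" by simp
  have below: "x \<in> D j \<longleftrightarrow> y \<in> D j" if "j < l" for j
    using not_less_Least[of j "\<lambda>i. \<not> (x \<in> D i \<longleftrightarrow> y \<in> D i)"] that by (auto simp: l_def)
  define c where "c j = (indicator (D j) x - indicator (D j) y) * (2 / 3 ^ Suc j :: real)" for j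
  have cs: "summable c" and ceq: "ternary_code D x - ternary_code D y = suminf c"
    unfolding c_def ternary_code_def left_diff_distrib
    by (rule summable_diff[OF ternary_code_summable ternary_code_summable], rule suminf_diff[OF ternary_code_summable ternary_code_summable])
  have "suminf c = (\<Sum>j. c (j + Suc l)) + (\<Sum>j<Suc l. c j)"
    by (rule suminf_split_initial_segment[OF cs])
  also have "(\<Sum>j<Suc l. c j) = c l"
    using below by (simp add: c_def indicator_def)
  finally have split: "ternary_code D x - ternary_code D y = (\<Sum>j. c (j + Suc l)) + c l" using ceq by simp
  have cabs: "norm (c (j + Suc l)) \<le> 2 / 3 ^ Suc (j + Suc l)" for j
    by (auto simp: c_def indicator_def)
  have "norm (\<Sum>j. c (j + Suc l)) \<le> (\<Sum>j. 2 / 3 ^ Suc (j + Suc l))"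
    by (rule norm_suminf_le[OF cabs sums_summable[OF ternary_tail]])
  also have "\<dots> = 1 / 3 ^ Suc l" by (rule sums_unique[OF ternary_tail, symmetric])
  finally have tail: "\<bar>\<Sum>j. c (j + Suc l)\<bar> \<le> 1 / 3 ^ Suc l" by simp
  have "\<bar>c l\<bar> = 2 / 3 ^ Suc l" using l by (auto simp: c_def indicator_def)
  with tail split have "\<bar>ternary_code D x - ternary_code D y\<bar> \<ge> 2 / 3 ^ Suc l - 1 / 3 ^ Suc l" by linarith
  then have "\<bar>ternary_code D x - ternary_code D y\<bar> \<ge> 1 / 3 ^ Suc l" by (simp add: diff_divide_distrib[symmetric])
  moreover have "(1 / 3 ^ n :: real) \<le> 1 / 3 ^ Suc l"
    using power_increasing[OF ln, of "3::real"] by (simp add: field_simps)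
  ultimately show False using near by linarith
qed

text \<open>
  With countably many balls that cover \<open>B\<close> at every scale as the sets \<open>D i\<close>, finitely many digits locate a
  point of \<open>B\<close> up to a prescribed error. So the code is injective with a uniformly continuous inverse, which
  extends to the closure of the set of codes and then, by Dugundji's theorem, to the whole line.
\<close>

lemma bounded_set_coding:
  fixes B :: "'a::euclidean_space set"
  assumes "bounded B" "B \<noteq> {}"
  obtains T :: "'a \<Rightarrow> real" and S :: "real \<Rightarrow> 'a"
  where "T \<in> borel_measurable borel" "\<And>x. 0 \<le> T x" "\<And>x. T x \<le> 1" "continuous_on UNIV S" "\<And>x. x \<in> B \<Longrightarrow> S (T x) = x"
proof -
  have "\<exists>F. finite F \<and> B \<subseteq> (\<Union>c\<in>F. ball c (inverse (real (Suc b))))" for b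
  proof -
    have "compact (closure B)" using assms(1) by (simp add: compact_closure)
    then have "\<forall>e>0. \<exists>k. finite k \<and> closure B \<subseteq> (\<Union>x\<in>k. ball x e)"
      unfolding compact_eq_totally_bounded by (rule conjunct2)
    moreover have "inverse (real (Suc b)) > 0" by simp
    ultimately have "\<exists>k. finite k \<and> closure B \<subseteq> (\<Union>x\<in>k. ball x (inverse (real (Suc b))))" by blast
    then show ?thesis using closure_subset[of B] by blast
  qed
  then obtain F where F: "\<And>b. finite (F b)" "\<And>b. B \<subseteq> (\<Union>c\<in>F b. ball c (inverse (real (Suc b))))" by metis
  define \<B> where "\<B> = (\<Union>b. (\<lambda>c. ball c (inverse (real (Suc b)))) ` F b)"
  have cB: "countable \<B>" unfolding \<B>_def by (rule countable_UN[OF countableI_type]) (intro countable_image countable_finite F(1))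
  have neB: "\<B> \<noteq> {}" proof -
    obtain x where "x \<in> B" using assms(2) by blast
    then obtain c where "c \<in> F 0" using F(2)[of 0] by blast
    then show ?thesis unfolding \<B>_def by blast
  qed
  define D where "D = from_nat_into \<B>"
  have rD: "range D = \<B>" unfolding D_def by (rule range_from_nat_into[OF neB cB])
  have Dopen: "open (D i)" for i
  proof -
    have "D i \<in> \<B>" using rD by blast
    then show ?thesis by (auto simp: \<B>_def)
  qed
  define T where "T = ternary_code D"
  have Tm: "T \<in> borel_measurable borel"
    unfolding T_def ternary_code_def[abs_def]
    by (intro borel_measurable_suminf borel_measurable_times borel_measurable_indicator borel_measurable_const borel_open Dopen)
  have fine: "\<exists>\<delta>>0. \<forall>x\<in>B. \<forall>y\<in>B. \<bar>T x - T y\<bar> < \<delta> \<longrightarrow> dist x y < e" if "e > 0" for e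
  proof -
    have "e / 2 > 0" using that by simp
    from reals_Archimedean[OF this] obtain b where b: "inverse (real (Suc b)) < e / 2" by blast
    let ?r = "inverse (real (Suc b))"
    have "\<exists>i. D i = ball c ?r" if "c \<in> F b" for c
    proof -
      have "ball c ?r \<in> range D" unfolding rD using that by (auto simp: \<B>_def)
      then show ?thesis by (metis imageE)
    qed
    then obtain ix where ix: "\<And>c. c \<in> F b \<Longrightarrow> D (ix c) = ball c ?r" by metis
    obtain n where n: "\<And>c. c \<in> F b \<Longrightarrow> ix c < n"
      using finite_nat_bounded[of "ix ` F b"] F(1) by auto
    show ?thesis
    proof (intro exI[of _ "1 / 3 ^ n"] conjI ballI impI)
      show "0 < 1 / (3::real) ^ n" by simp
      fix x y assume xy: "x \<in> B" "y \<in> B" and near: "\<bar>T x - T y\<bar> < 1 / 3 ^ n"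
      obtain c where c: "c \<in> F b" "x \<in> ball c ?r" using F(2)[of b] xy by blast
      have "y \<in> ball c ?r"
        using ternary_code_near_imp_same_digits[OF near[unfolded T_def] n[OF c(1)]] c(2) ix[OF c(1)] by simp
      then have "dist x y < 2 * ?r" using c(2) dist_triangle2[of x y c] by (auto simp: dist_commute)
      then show "dist x y < e" using b by linarith
    qed
  qed
  have inj: "inj_on T B"
  proof (rule inj_onI, rule ccontr)
    fix x y assume xy: "x \<in> B" "y \<in> B" "T x = T y" "x \<noteq> y"
    then have "dist x y > 0" by simp
    from fine[OF this] obtain \<delta> where "\<delta> > 0" "\<bar>T x - T y\<bar> < \<delta> \<Longrightarrow> dist x y < dist x y" using xy by blast
    then show False using xy by simp
  qed
  define S0 where "S0 = inv_into B T"
  have S0: "S0 (T x) = x" if "x \<in> B" for x unfolding S0_def by (rule inv_into_f_f[OF inj that])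
  have "uniformly_continuous_on (T ` B) S0"
    unfolding uniformly_continuous_on_def
  proof (intro allI impI)
    fix e :: real assume "e > 0"
    from fine[OF this] obtain \<delta> where "\<delta> > 0" "\<And>x y. x \<in> B \<Longrightarrow> y \<in> B \<Longrightarrow> \<bar>T x - T y\<bar> < \<delta> \<Longrightarrow> dist x y < e" by blast
    then show "\<exists>d>0. \<forall>x\<in>T ` B. \<forall>x'\<in>T ` B. dist x' x < d \<longrightarrow> dist (S0 x') (S0 x) < e"
      by (intro exI[of _ \<delta>]) (auto simp: S0 dist_real_def)
  qed
  then obtain g where g: "uniformly_continuous_on (closure (T ` B)) g" "\<And>t. t \<in> T ` B \<Longrightarrow> S0 t = g t"
    using uniformly_continuous_on_extension_on_closure[of "T ` B" S0] by metis
  obtain S where S: "continuous_on UNIV S" "\<And>t. t \<in> closure (T ` B) \<Longrightarrow> S t = g t"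
    by (rule Dugundji[of "UNIV :: 'a set" "UNIV :: real set" "closure (T ` B)" g])
      (use uniformly_continuous_imp_continuous[OF g(1)] in auto)
  have "S (T x) = x" if "x \<in> B" for x
    using S(2)[of "T x"] g(2)[of "T x"] S0[OF that] that closure_subset[of "T ` B"] by force
  with Tm S(1) show ?thesis
    using ternary_code_bounds[of D] by (intro that[of T S]) (auto simp: T_def)
qed

text \<open>
  The codes push the measures to the line, where Helly's selection theorem applies since all codes lie in
  the unit interval. The measurable code need not be continuous: only its continuous left inverse enters
  the integrals.
\<close>

theorem bounded_support_Prokhorov:
  fixes P :: "nat \<Rightarrow> 'a::euclidean_space measure"
  assumes P: "\<And>k. prob_space (P k)" "\<And>k. sets (P k) = sets borel" and B: "bounded B" "\<And>k. AE x in P k. x \<in> B"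
  obtains r Q where "strict_mono r" "prob_space Q" "sets Q = sets borel"
    "\<And>\<phi> c. continuous_on UNIV \<phi> \<Longrightarrow> (\<And>x. \<bar>\<phi> x\<bar> \<le> c) \<Longrightarrow> (\<lambda>k. \<integral>x. \<phi> x \<partial>P (r k)) \<longlonglongrightarrow> (\<integral>x. \<phi> x \<partial>Q :: real)"
proof -
  have "B \<noteq> {}"
  proof
    assume "B = {}"
    with B(2)[of 0] have "AE x in P 0. False" by simp
    with prob_space.AE_False[OF P(1)] show False by blast
  qed
  then obtain T :: "'a \<Rightarrow> real" and S :: "real \<Rightarrow> 'a"
    where Tm: "T \<in> borel_measurable borel" and T01: "\<And>x. 0 \<le> T x" "\<And>x. T x \<le> 1"
      and S: "continuous_on UNIV S" and ST: "\<And>x. x \<in> B \<Longrightarrow> S (T x) = x"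
    using bounded_set_coding[OF B(1)] by metis
  have TmP: "T \<in> borel_measurable (P k)" for k
    using Tm by (simp add: measurable_cong_sets[OF P(2) refl])
  have Sm: "S \<in> borel_measurable borel" by (rule borel_measurable_continuous_onI[OF S])
  define \<nu> where "\<nu> k = distr (P k) borel T" for k
  have rd: "real_distribution (\<nu> k)" for k
    unfolding \<nu>_def by (rule prob_space.real_distribution_distr[OF P(1) TmP])
  have one: "measure (\<nu> k) {-1<..2} = 1" for k
  proof -
    have "T -` {-1<..2} \<inter> space (P k) = space (P k)"
    proof -
      have "-1 < T x \<and> T x \<le> 2" for x using T01[of x] by linarith
      then show ?thesis by auto
    qed
    then show ?thesis
      unfolding \<nu>_def using TmP prob_space.prob_space[OF P(1)] by (simp add: measure_distr)
  qed
  have "tight \<nu>"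
    unfolding tight_def
  proof (intro conjI allI impI)
    fix e :: real assume "e > 0"
    then show "\<exists>a b. a < b \<and> (\<forall>k. 1 - e < measure (\<nu> k) {a<..b})"
      using one by (intro exI[of _ "-1::real"] exI[of _ "2::real"]) simp
  qed (rule rd)
  from tight_imp_convergent_subsubsequence[OF this strict_mono_id] obtain r N where
    r: "strict_mono (r :: nat \<Rightarrow> nat)" and N: "real_distribution N" and conv: "weak_conv_m (\<nu> \<circ> id \<circ> r) N"
    by blast
  interpret N: real_distribution N by (rule N)
  have SmN: "S \<in> borel_measurable N" using Sm by simp
  define Q where "Q = distr N borel S"
  show ?thesis
  proof (rule that[OF r])
    show "prob_space Q" unfolding Q_def by (rule N.prob_space_distr[OF SmN])
    show "sets Q = sets borel" by (simp add: Q_def)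
    fix \<phi> :: "'a \<Rightarrow> real" and c assume \<phi>: "continuous_on UNIV \<phi>" "\<And>x. \<bar>\<phi> x\<bar> \<le> c"
    have \<phi>m: "\<phi> \<in> borel_measurable borel" by (rule borel_measurable_continuous_onI[OF \<phi>(1)])
    have cS: "continuous_on UNIV (\<lambda>t. \<phi> (S t))" by (rule continuous_on_compose2[OF \<phi>(1) S]) auto
    have "(\<lambda>k. \<integral>t. \<phi> (S t) \<partial>(\<nu> \<circ> id \<circ> r) k) \<longlonglongrightarrow> (\<integral>t. \<phi> (S t) \<partial>N)"
      by (rule weak_conv_imp_integral_bdd_continuous_conv[OF _ N conv, of "\<lambda>t. \<phi> (S t)" c])
        (use rd cS \<phi>(2) in \<open>auto simp: continuous_on_eq_continuous_at\<close>)
    moreover have "(\<integral>t. \<phi> (S t) \<partial>\<nu> k) = (\<integral>x. \<phi> x \<partial>P k)" for k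
    proof -
      have "(\<integral>t. \<phi> (S t) \<partial>\<nu> k) = (\<integral>x. \<phi> (S (T x)) \<partial>P k)"
        unfolding \<nu>_def by (rule integral_distr[OF TmP]) (rule borel_measurable_continuous_onI[OF cS])
      also have "\<dots> = (\<integral>x. \<phi> x \<partial>P k)"
      proof (rule integral_cong_AE)
        show "(\<lambda>x. \<phi> (S (T x))) \<in> borel_measurable (P k)"
          by (rule measurable_compose[OF TmP borel_measurable_continuous_onI[OF cS]])
        show "\<phi> \<in> borel_measurable (P k)"
          using \<phi>m by (simp add: measurable_cong_sets[OF P(2) refl])
        show "AE x in P k. \<phi> (S (T x)) = \<phi> x" using B(2)[of k] by eventually_elim (simp add: ST)
      qed
      finally show ?thesis .
    qed
    moreover have "(\<integral>t. \<phi> (S t) \<partial>N) = (\<integral>x. \<phi> x \<partial>Q)"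
      unfolding Q_def by (rule integral_distr[OF SmN \<phi>m, symmetric])
    ultimately show "(\<lambda>k. \<integral>x. \<phi> x \<partial>P (r k)) \<longlonglongrightarrow> (\<integral>x. \<phi> x \<partial>Q)" by simp
  qed
qed

lemma bounded_mult_integrable:
  fixes m :: "'a::euclidean_space \<Rightarrow> real"
  assumes m: "integrable (lebesgue_on \<Omega>) m" and \<phi>: "continuous_on UNIV \<phi>" "\<And>x. \<bar>\<phi> x\<bar> \<le> B"
  shows "integrable (lebesgue_on \<Omega>) (\<lambda>x. m x * \<phi> x)"
proof (rule Bochner_Integration.integrable_bound)
  show "integrable (lebesgue_on \<Omega>) (\<lambda>x. B * m x)" using m by auto
  show "(\<lambda>x. m x * \<phi> x) \<in> borel_measurable (lebesgue_on \<Omega>)"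
    by (intro borel_measurable_times borel_measurable_integrable[OF m] continuous_borel_lebesgue_on \<phi>)
  have "norm (m x * \<phi> x) \<le> norm (B * m x)" for x
  proof -
    have "\<bar>\<phi> x\<bar> \<le> \<bar>B\<bar>" using \<phi>(2)[of x] by linarith
    then show ?thesis using mult_right_mono[of "\<bar>\<phi> x\<bar>" "\<bar>B\<bar>" "\<bar>m x\<bar>"] by (simp add: abs_mult mult.commute)
  qed
  then show "AE x in lebesgue_on \<Omega>. norm (m x * \<phi> x) \<le> norm (B * m x)" by simp
qed

text \<open>The masses converge along a subsequence; if their limit is positive, normalization reduces to probability measures.\<close>

lemma weak_compactness_densities:
  fixes m :: "nat \<Rightarrow> 'a::euclidean_space \<Rightarrow> real"
  assumes "bounded \<Omega>" "\<Omega> \<in> sets lebesgue" and m: "\<And>k. integrable (lebesgue_on \<Omega>) (m k)"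
    and pos: "\<And>k. AE x in lebesgue_on \<Omega>. 0 \<le> m k x" and C: "\<And>k. (\<integral>x. m k x \<partial>lebesgue_on \<Omega>) \<le> C"
  obtains r \<nu> where "strict_mono r" "finite_measure \<nu>" "sets \<nu> = sets borel"
    "\<And>\<phi>. continuous_on UNIV \<phi> \<Longrightarrow> bounded (range \<phi>) \<Longrightarrow>
      (\<lambda>k. \<integral>x. m (r k) x * \<phi> x \<partial>lebesgue_on \<Omega>) \<longlonglongrightarrow> (\<integral>x. \<phi> x \<partial>\<nu> :: real)"
proof -
  let ?L = "lebesgue_on \<Omega>"
  define c where "c k = (\<integral>x. m k x \<partial>?L)" for k
  have c0: "c k \<ge> 0" for k unfolding c_def by (rule integral_nonneg_AE[OF pos])
  have "bounded (range c)" using c0 C by (intro boundedI[of _ C]) (auto simp: c_def)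
  then obtain l q where q: "strict_mono (q :: nat \<Rightarrow> nat)" and lim: "(c \<circ> q) \<longlonglongrightarrow> l"
    using bounded_imp_convergent_subsequence by blast
  have l0: "l \<ge> 0" by (rule LIMSEQ_le_const[OF lim]) (use c0 in auto)
  show ?thesis
  proof (cases "l = 0")
    case True
    show ?thesis
    proof (rule that[OF q, of "null_measure borel"])
      show "finite_measure (null_measure borel)" by (rule finite_measureI) simp
      fix \<phi> :: "'a \<Rightarrow> real" assume c\<phi>: "continuous_on UNIV \<phi>" and "bounded (range \<phi>)"
      then obtain b where \<phi>: "continuous_on UNIV \<phi>" "\<And>x. \<bar>\<phi> x\<bar> \<le> b" by (auto simp: bounded_iff)
      have "(\<lambda>k. \<integral>x. m (q k) x * \<phi> x \<partial>?L) \<longlonglongrightarrow> 0"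
      proof (rule Lim_null_comparison)
        have "norm (\<integral>x. m k x * \<phi> x \<partial>?L) \<le> b * c k" for k
        proof -
          have "norm (\<integral>x. m k x * \<phi> x \<partial>?L) \<le> (\<integral>x. norm (m k x * \<phi> x) \<partial>?L)" by (rule integral_norm_bound)
          also have "\<dots> \<le> (\<integral>x. b * m k x \<partial>?L)"
          proof (rule integral_mono_AE)
            show "integrable ?L (\<lambda>x. norm (m k x * \<phi> x))" using bounded_mult_integrable[OF m \<phi>] by (rule integrable_norm)
            show "integrable ?L (\<lambda>x. b * m k x)" using m[of k] by auto
            show "AE x in ?L. norm (m k x * \<phi> x) \<le> b * m k x"
              using pos[of k]
            proof eventually_elim
              case (elim x)
              then show ?case using mult_left_mono[OF \<phi>(2)[of x] elim] by (simp add: abs_mult mult.commute)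
            qed
          qed
          finally show ?thesis by (simp add: c_def)
        qed
        then show "\<forall>\<^sub>F k in sequentially. norm (\<integral>x. m (q k) x * \<phi> x \<partial>?L) \<le> b * c (q k)" by simp
        show "(\<lambda>k. b * c (q k)) \<longlonglongrightarrow> 0" using tendsto_mult_left[OF lim, of b] True by (simp add: o_def)
      qed
      then show "(\<lambda>k. \<integral>x. m (q k) x * \<phi> x \<partial>?L) \<longlonglongrightarrow> (\<integral>x. \<phi> x \<partial>null_measure borel)" by simp
    qed simp
  next
    case False
    then have lp: "l > 0" using l0 by simp
    have "\<forall>\<^sub>F k in sequentially. c (q k) > 0" using order_tendstoD(1)[OF lim lp] by simp
    then obtain K where K: "\<And>k. k \<ge> K \<Longrightarrow> c (q k) > 0" by (auto simp: eventually_sequentially)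
    define p where "p k = q (k + K)" for k
    have p: "strict_mono p" using q by (auto simp: p_def strict_mono_def)
    have cp: "c (p k) > 0" for k using K[of "k + K"] by (simp add: p_def)
    have limp: "(\<lambda>k. c (p k)) \<longlonglongrightarrow> l"
      using LIMSEQ_ignore_initial_segment[OF lim, of K] by (simp add: p_def o_def)
    define d where "d k = density ?L (\<lambda>x. ennreal (m (p k) x / c (p k)))" for k
    have mm[measurable]: "m k \<in> borel_measurable ?L" for k using m by (rule borel_measurable_integrable)
    have posd: "AE x in ?L. 0 \<le> m (p k) x / c (p k)" for k
      using pos[of "p k"] by eventually_elim (use cp[of k] in simp)
    have idm: "(\<lambda>x. x) \<in> measurable (d k) borel" for k
      using borel_measurable_lebesgue_onI[of "\<lambda>x. x" \<Omega>] by (simp add: d_def)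
    have prob: "prob_space (d k)" for k
    proof (rule prob_spaceI)
      have "emeasure (d k) (space (d k)) = (\<integral>\<^sup>+x. ennreal (m (p k) x / c (p k)) \<partial>?L)"
      proof -
        have "emeasure (d k) (space ?L) = (\<integral>\<^sup>+x. ennreal (m (p k) x / c (p k)) * indicator (space ?L) x \<partial>?L)"
          unfolding d_def by (rule emeasure_density) auto
        also have "\<dots> = (\<integral>\<^sup>+x. ennreal (m (p k) x / c (p k)) \<partial>?L)"
          by (rule nn_integral_cong) simp
        finally show ?thesis by (simp add: d_def)
      qed
      also have "\<dots> = ennreal (\<integral>x. m (p k) x / c (p k) \<partial>?L)"
        using m posd by (intro nn_integral_eq_integral) auto
      also have "(\<integral>x. m (p k) x / c (p k) \<partial>?L) = 1" using cp[of k] by (simp add: c_def)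
      finally show "emeasure (d k) (space (d k)) = 1" by simp
    qed
    define P where "P k = distr (d k) borel (\<lambda>x. x)" for k
    have P: "prob_space (P k)" "sets (P k) = sets borel" for k
      unfolding P_def by (rule prob_space.prob_space_distr[OF prob idm]) simp
    have AEP: "AE x in P k. x \<in> closure \<Omega>" for k
    proof -
      have "AE x in d k. x \<in> closure \<Omega>"
        using AE_space[of "d k"] by eventually_elim (use closure_subset[of \<Omega>] in \<open>auto simp: d_def\<close>)
      then show ?thesis unfolding P_def by (subst AE_distr_iff[OF idm]) auto
    qed
    have bc: "bounded (closure \<Omega>)" using assms(1) by (rule bounded_closure)
    obtain r Q where r: "strict_mono (r :: nat \<Rightarrow> nat)" and Q: "prob_space Q" "sets Q = sets borel"
      and conv: "\<And>\<phi> c. continuous_on UNIV \<phi> \<Longrightarrow> (\<And>x. \<bar>\<phi> x\<bar> \<le> c) \<Longrightarrow> (\<lambda>k. \<integral>x. \<phi> x \<partial>P (r k)) \<longlonglongrightarrow> (\<integral>x. \<phi> x \<partial>Q :: real)"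
      
      using bounded_support_Prokhorov[of P "closure \<Omega>"] P bc AEP by blast
    define \<nu> where "\<nu> = density Q (\<lambda>_. ennreal l)"
    show ?thesis
    proof (rule that[of "p \<circ> r" \<nu>])
      show "strict_mono (p \<circ> r)" by (rule strict_mono_o[OF p r])
      show "sets \<nu> = sets borel" by (simp add: \<nu>_def Q)
      have "emeasure \<nu> (space \<nu>) = ennreal l * emeasure Q (space Q)"
        unfolding \<nu>_def by (subst emeasure_density_const) auto
      then show "finite_measure \<nu>"
        using prob_space.emeasure_space_1[OF Q(1)] by (intro finite_measureI) simp
      fix \<phi> :: "'a \<Rightarrow> real" assume c\<phi>: "continuous_on UNIV \<phi>" and "bounded (range \<phi>)"
      then obtain b where \<phi>: "continuous_on UNIV \<phi>" "\<And>x. \<bar>\<phi> x\<bar> \<le> b" by (auto simp: bounded_iff)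
      have \<phi>m: "\<phi> \<in> borel_measurable borel" by (rule borel_measurable_continuous_onI[OF \<phi>(1)])
      have \<phi>mL: "\<phi> \<in> borel_measurable ?L" by (rule borel_measurable_lebesgue_onI[OF \<phi>m])
      have eq: "c (p k) * (\<integral>x. \<phi> x \<partial>P k) = (\<integral>x. m (p k) x * \<phi> x \<partial>?L)" for k
      proof -
        have "(\<integral>x. \<phi> x \<partial>P k) = (\<integral>x. \<phi> x \<partial>d k)" unfolding P_def by (rule integral_distr[OF idm \<phi>m])
        also have "\<dots> = (\<integral>x. (m (p k) x / c (p k)) *\<^sub>R \<phi> x \<partial>?L)"
          unfolding d_def by (rule integral_density[OF \<phi>mL _ posd]) measurable
        also have "\<dots> = (\<integral>x. m (p k) x * \<phi> x \<partial>?L) / c (p k)" by simp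
        finally show ?thesis using cp[of k] by (simp add: field_simps)
      qed
      have "(\<lambda>k. c (p (r k)) * (\<integral>x. \<phi> x \<partial>P (r k))) \<longlonglongrightarrow> l * (\<integral>x. \<phi> x \<partial>Q)"
        using LIMSEQ_subseq_LIMSEQ[OF limp r] by (intro tendsto_mult conv[OF \<phi>]) (simp add: o_def)
      moreover have "(\<integral>x. \<phi> x \<partial>\<nu>) = l * (\<integral>x. \<phi> x \<partial>Q)"
        unfolding \<nu>_def using l0 \<phi>m
        by (subst integral_density) (auto simp: measurable_cong_sets[OF Q(2) refl])
      ultimately show "(\<lambda>k. \<integral>x. m ((p \<circ> r) k) x * \<phi> x \<partial>?L) \<longlonglongrightarrow> (\<integral>x. \<phi> x \<partial>\<nu>)"
        by (simp add: eq)
    qed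
  qed
qed

section \<open>Weak-star limits of bounded functions\<close>

lemma integrable_approx_continuous:
  fixes g :: "'a::euclidean_space \<Rightarrow> real"
  assumes g: "integrable (lebesgue_on \<Omega>) g" and "\<Omega> \<in> sets lebesgue" "finite_measure (lebesgue_on \<Omega>)" and "e > 0"
  obtains \<psi> b where "continuous_on UNIV \<psi>" "\<And>x. \<bar>\<psi> x\<bar> \<le> b" "(\<integral>x. \<bar>g x - \<psi> x\<bar> \<partial>lebesgue_on \<Omega>) < e"
proof -
  let ?L = "lebesgue_on \<Omega>"
  interpret finite_measure ?L by fact
  have gm[measurable]: "g \<in> borel_measurable ?L" using g by (rule borel_measurable_integrable)
  define c where "c j x = max (- real j) (min (real j) (g x))" for j :: nat and x
  have cm[measurable]: "c j \<in> borel_measurable ?L" for j unfolding c_def by measurable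
  have "(\<lambda>j. \<integral>x. \<bar>g x - c j x\<bar> \<partial>?L) \<longlonglongrightarrow> (\<integral>x. 0 \<partial>?L)"
  proof (rule integral_dominated_convergence)
    show "integrable ?L (\<lambda>x. \<bar>g x\<bar>)" using g by auto
    show "AE x in ?L. (\<lambda>j. \<bar>g x - c j x\<bar>) \<longlonglongrightarrow> 0"
    proof (rule AE_I2)
      fix x
      obtain J :: nat where J: "\<bar>g x\<bar> \<le> real J" using real_arch_simple by blast
      have "\<bar>g x - c j x\<bar> = 0" if "j \<ge> J" for j
      proof -
        have "\<bar>g x\<bar> \<le> real j" using J that by (meson of_nat_mono order_trans)
        then show ?thesis unfolding c_def by auto
      qed
      then show "(\<lambda>j. \<bar>g x - c j x\<bar>) \<longlonglongrightarrow> 0"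
        by (intro tendsto_eventually) (auto simp: eventually_sequentially)
    qed
    show "AE x in ?L. norm \<bar>g x - c j x\<bar> \<le> \<bar>g x\<bar>" for j
      by (rule AE_I2) (auto simp: c_def)
  qed measurable
  then have "(\<lambda>j. \<integral>x. \<bar>g x - c j x\<bar> \<partial>?L) \<longlonglongrightarrow> 0" by simp
  from order_tendstoD(2)[OF this, of "e/2"] \<open>e > 0\<close> obtain j where j: "(\<integral>x. \<bar>g x - c j x\<bar> \<partial>?L) < e / 2"
    by (auto simp: eventually_sequentially)
  obtain \<psi> where \<psi>: "\<And>i::nat. continuous_on UNIV (\<psi> i)" "\<And>i x. \<bar>\<psi> i x\<bar> \<le> real j"
      "AE x in ?L. (\<lambda>i. \<psi> i x) \<longlonglongrightarrow> c j x"
    by (rule bounded_measurable_approx_continuous[OF cm assms(2), of j "real j"]) (auto simp: c_def)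
  have \<psi>m[measurable]: "\<psi> i \<in> borel_measurable ?L" for i by (rule continuous_borel_lebesgue_on[OF \<psi>(1)])
  have cb: "\<bar>c j x\<bar> \<le> real j" for x by (auto simp: c_def)
  have "(\<lambda>i. \<integral>x. \<bar>c j x - \<psi> i x\<bar> \<partial>?L) \<longlonglongrightarrow> (\<integral>x. 0 \<partial>?L)"
  proof (rule integral_dominated_convergence)
    show "integrable ?L (\<lambda>x. 2 * real j)" by simp
    show "AE x in ?L. (\<lambda>i. \<bar>c j x - \<psi> i x\<bar>) \<longlonglongrightarrow> 0"
      using \<psi>(3)
    proof eventually_elim
      case (elim x)
      from tendsto_rabs[OF tendsto_diff[OF tendsto_const[of "c j x"] elim]] show ?case by simp
    qed
    show "AE x in ?L. norm \<bar>c j x - \<psi> i x\<bar> \<le> 2 * real j" for i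
    proof (rule AE_I2)
      fix x show "norm \<bar>c j x - \<psi> i x\<bar> \<le> 2 * real j" using cb[of x] \<psi>(2)[of i x] by simp
    qed
  qed measurable
  then have "(\<lambda>i. \<integral>x. \<bar>c j x - \<psi> i x\<bar> \<partial>?L) \<longlonglongrightarrow> 0" by simp
  from order_tendstoD(2)[OF this, of "e/2"] \<open>e > 0\<close> obtain i where i: "(\<integral>x. \<bar>c j x - \<psi> i x\<bar> \<partial>?L) < e / 2"
    by (auto simp: eventually_sequentially)
  have ci: "integrable ?L (c j)" by (rule integrable_const_bound[of _ "real j"]) (use cb in auto)
  have pi: "integrable ?L (\<psi> i)" by (rule integrable_const_bound[of _ "real j"]) (use \<psi>(2) in auto)
  have "(\<integral>x. \<bar>g x - \<psi> i x\<bar> \<partial>?L) \<le> (\<integral>x. \<bar>g x - c j x\<bar> + \<bar>c j x - \<psi> i x\<bar> \<partial>?L)"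
    using g ci pi by (intro integral_mono) auto
  also have "\<dots> = (\<integral>x. \<bar>g x - c j x\<bar> \<partial>?L) + (\<integral>x. \<bar>c j x - \<psi> i x\<bar> \<partial>?L)"
    using g ci pi by (intro Bochner_Integration.integral_add) auto
  finally have "(\<integral>x. \<bar>g x - \<psi> i x\<bar> \<partial>?L) < e" using i j by linarith
  then show ?thesis by (intro that[OF \<psi>(1) \<psi>(2)])
qed

context bounded_open_set
begin

lemma indicator_integrable: "A \<in> sets (lebesgue_on \<Omega>) \<Longrightarrow> integrable (lebesgue_on \<Omega>) (indicator A :: _ \<Rightarrow> real)"
  by (intro integrable_real_indicator) (auto simp: emeasure_eq_measure)

lemma integral_indicator_eq: "A \<in> sets (lebesgue_on \<Omega>) \<Longrightarrow> (\<integral>x. indicator A x \<partial>lebesgue_on \<Omega>) = measure (lebesgue_on \<Omega>) A"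
  using sets.sets_into_space[of A "lebesgue_on \<Omega>"] by (simp add: Int_absorb2)

lemma Lp_1_iff_integrable: "g \<in> Lp 1 \<Omega> \<longleftrightarrow> integrable (lebesgue_on \<Omega>) g" for g :: "real^'N \<Rightarrow> real"
  unfolding Lp_def by (auto simp: integrable_norm_iff integrable_abs_iff)

lemma Linf_mult_integrable:
  fixes z g :: "real^'N \<Rightarrow> real"
  assumes "z \<in> borel_measurable (lebesgue_on \<Omega>)" "AE x in lebesgue_on \<Omega>. \<bar>z x\<bar> \<le> C" "integrable (lebesgue_on \<Omega>) g"
  shows "integrable (lebesgue_on \<Omega>) (\<lambda>x. z x * g x)" "\<bar>\<integral>x. z x * g x \<partial>lebesgue_on \<Omega>\<bar> \<le> C * (\<integral>x. \<bar>g x\<bar> \<partial>lebesgue_on \<Omega>)"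
proof -
  have b: "AE x in lebesgue_on \<Omega>. norm (z x * g x) \<le> C * \<bar>g x\<bar>"
    using assms(2)
  proof eventually_elim
    case (elim x)
    then show ?case using mult_right_mono[OF elim abs_ge_zero[of "g x"]] by (simp add: abs_mult)
  qed
  have Cg: "integrable (lebesgue_on \<Omega>) (\<lambda>x. C * \<bar>g x\<bar>)" using assms(3) by auto
  show i: "integrable (lebesgue_on \<Omega>) (\<lambda>x. z x * g x)"
  proof (rule Bochner_Integration.integrable_bound[OF Cg])
    show "(\<lambda>x. z x * g x) \<in> borel_measurable (lebesgue_on \<Omega>)"
      by (intro borel_measurable_times assms(1) borel_measurable_integrable[OF assms(3)])
    show "AE x in lebesgue_on \<Omega>. norm (z x * g x) \<le> norm (C * \<bar>g x\<bar>)"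
      using b by eventually_elim (metis abs_ge_self order_trans real_norm_def)
  qed
  have "\<bar>\<integral>x. z x * g x \<partial>lebesgue_on \<Omega>\<bar> \<le> (\<integral>x. norm (z x * g x) \<partial>lebesgue_on \<Omega>)"
    using integral_norm_bound[of "lebesgue_on \<Omega>" "\<lambda>x. z x * g x"] by simp
  also have "\<dots> \<le> (\<integral>x. C * \<bar>g x\<bar> \<partial>lebesgue_on \<Omega>)"
    by (rule integral_mono_AE[OF integrable_norm[OF i] Cg b])
  finally show "\<bar>\<integral>x. z x * g x \<partial>lebesgue_on \<Omega>\<bar> \<le> C * (\<integral>x. \<bar>g x\<bar> \<partial>lebesgue_on \<Omega>)" by simp
qed

text \<open>Bounded continuous functions are dense in \<open>L1\<close>, so by the uniform bound \<open>C\<close> they suffice as test functions.\<close>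

lemma weak_star_LinfI:
  fixes z :: "nat \<Rightarrow> real^'N \<Rightarrow> real"
  assumes z: "\<And>k. z k \<in> borel_measurable (lebesgue_on \<Omega>)" "\<And>k. AE x in lebesgue_on \<Omega>. \<bar>z k x\<bar> \<le> C"
    and w: "w \<in> borel_measurable (lebesgue_on \<Omega>)" "AE x in lebesgue_on \<Omega>. \<bar>w x\<bar> \<le> C" and C: "C > 0"
    and lim: "\<And>\<phi> b. continuous_on UNIV \<phi> \<Longrightarrow> (\<And>x. \<bar>\<phi> x\<bar> \<le> b) \<Longrightarrow>
      (\<lambda>k. \<integral>x. z k x * \<phi> x \<partial>lebesgue_on \<Omega>) \<longlonglongrightarrow> (\<integral>x. w x * \<phi> x \<partial>lebesgue_on \<Omega>)"
  shows "weak_star_Linf \<Omega> z w"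
  unfolding weak_star_Linf_def
proof (intro conjI allI ballI)
  let ?L = "lebesgue_on \<Omega>"
  show "z k \<in> Linf \<Omega>" for k using z by (auto simp: Linf_def)
  show "w \<in> Linf \<Omega>" using w by (auto simp: Linf_def)
  fix g :: "real^'N \<Rightarrow> real" assume "g \<in> Lp 1 \<Omega>"
  then have g: "integrable ?L g" by (simp add: Lp_1_iff_integrable)
  show "(\<lambda>k. \<integral>x. z k x * g x \<partial>?L) \<longlonglongrightarrow> (\<integral>x. w x * g x \<partial>?L)"
  proof (rule LIMSEQ_I)
    fix e :: real assume "e > 0"
    then have "e / (4 * C) > 0" using C by simp
    then obtain \<psi> b where \<psi>: "continuous_on UNIV \<psi>" "\<And>x. \<bar>\<psi> x\<bar> \<le> b" and near: "(\<integral>x. \<bar>g x - \<psi> x\<bar> \<partial>?L) < e / (4 * C)"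
      using integrable_approx_continuous[OF g Om_sets finite_measure_axioms] by metis
    have \<psi>i: "integrable ?L \<psi>"
      by (rule integrable_const_bound[of _ b]) (use \<psi> in \<open>auto intro: continuous_borel_lebesgue_on\<close>)
    have d: "integrable ?L (\<lambda>x. g x - \<psi> x)" using g \<psi>i by auto
    have small: "C * (\<integral>x. \<bar>g x - \<psi> x\<bar> \<partial>?L) < e / 4"
      using near C by (simp add: field_simps)
    obtain N where N: "\<And>k. k \<ge> N \<Longrightarrow> norm ((\<integral>x. z k x * \<psi> x \<partial>?L) - (\<integral>x. w x * \<psi> x \<partial>?L)) < e / 2"
      using LIMSEQ_D[OF lim[OF \<psi>], of "e / 2"] \<open>e > 0\<close> by auto
    show "\<exists>no. \<forall>k\<ge>no. norm ((\<integral>x. z k x * g x \<partial>?L) - (\<integral>x. w x * g x \<partial>?L)) < e"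
    proof (intro exI[of _ N] allI impI)
      fix k assume "N \<le> k"
      have s: "(\<integral>x. y x * g x \<partial>?L) = (\<integral>x. y x * (g x - \<psi> x) \<partial>?L) + (\<integral>x. y x * \<psi> x \<partial>?L)"
        if "y \<in> borel_measurable ?L" "AE x in ?L. \<bar>y x\<bar> \<le> C" for y
        using Linf_mult_integrable(1)[OF that d] Linf_mult_integrable(1)[OF that \<psi>i]
        by (subst Bochner_Integration.integral_add[symmetric]) (auto simp: algebra_simps)
      have "\<bar>\<integral>x. z k x * (g x - \<psi> x) \<partial>?L\<bar> < e / 4" "\<bar>\<integral>x. w x * (g x - \<psi> x) \<partial>?L\<bar> < e / 4"
        using Linf_mult_integrable(2)[OF z(1)[of k] z(2) d] Linf_mult_integrable(2)[OF w d] small by linarith+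
      moreover have "norm ((a + b) - (a' + b')) < e" if "\<bar>a\<bar> < e / 4" "\<bar>a'\<bar> < e / 4" "norm (b - b') < e / 2"
        for a a' b b' :: real
        using that unfolding real_norm_def by linarith
      ultimately show "norm ((\<integral>x. z k x * g x \<partial>?L) - (\<integral>x. w x * g x \<partial>?L)) < e"
        unfolding s[OF z] s[OF w] using N[OF \<open>N \<le> k\<close>] by blast
    qed
  qed
qed

text \<open>
  Testing with the indicator of the part of \<open>A\<close> where the bound fails. The sign \<open>\<sigma> = 1\<close> gives upper bounds and
  \<open>\<sigma> = -1\<close> lower bounds; the error \<open>e\<close> may depend on the test set.
\<close>

lemma weak_star_limit_bound:
  assumes ws: "weak_star_Linf \<Omega> z w" and A: "A \<in> sets (lebesgue_on \<Omega>)"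
    and bound: "\<And>E. E \<in> sets (lebesgue_on \<Omega>) \<Longrightarrow> E \<subseteq> A \<Longrightarrow> \<exists>e. e \<longlonglongrightarrow> 0 \<and>
      (\<forall>k. \<sigma> * (\<integral>x. z k x * indicator E x \<partial>lebesgue_on \<Omega>) \<le> c * measure (lebesgue_on \<Omega>) E + e k)"
  shows "AE x in lebesgue_on \<Omega>. x \<in> A \<longrightarrow> \<sigma> * w x \<le> c"
proof -
  let ?L = "lebesgue_on \<Omega>"
  have w: "w \<in> borel_measurable ?L" and "\<exists>C. AE x in ?L. \<bar>w x\<bar> \<le> C"
    using ws by (auto simp: weak_star_Linf_def Linf_def)
  then obtain C where C: "AE x in ?L. \<bar>w x\<bar> \<le> C" by blast
  define E where "E = A \<inter> {x \<in> space ?L. \<sigma> * w x > c}"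
  have Es: "E \<in> sets ?L" unfolding E_def using A w by measurable
  have EA: "E \<subseteq> A" by (simp add: E_def)
  obtain e where e: "e \<longlonglongrightarrow> 0"
    "\<And>k. \<sigma> * (\<integral>x. z k x * indicator E x \<partial>?L) \<le> c * measure ?L E + e k"
    using bound[OF Es EA] by blast
  have Ei: "integrable ?L (indicator E :: _ \<Rightarrow> real)"
    using Es by (intro integrable_real_indicator) (auto simp: emeasure_eq_measure)
  have "(\<lambda>k. \<integral>x. z k x * indicator E x \<partial>?L) \<longlonglongrightarrow> (\<integral>x. w x * indicator E x \<partial>?L)"
    using ws Ei unfolding weak_star_Linf_def Lp_1_iff_integrable[symmetric] by blast
  then have l1: "(\<lambda>k. \<sigma> * (\<integral>x. z k x * indicator E x \<partial>?L)) \<longlonglongrightarrow> \<sigma> * (\<integral>x. w x * indicator E x \<partial>?L)"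
    by (intro tendsto_intros)
  have l2: "(\<lambda>k. c * measure ?L E + e k) \<longlonglongrightarrow> c * measure ?L E + 0"
    by (intro tendsto_intros e(1))
  have le: "\<sigma> * (\<integral>x. w x * indicator E x \<partial>?L) \<le> c * measure ?L E"
    using LIMSEQ_le[OF l1 l2] e(2) by auto
  have wi: "integrable ?L (\<lambda>x. w x * indicator E x)" by (rule Linf_mult_integrable(1)[OF w C Ei])
  have nn: "0 \<le> (\<sigma> * w x - c) * indicator E x" for x by (auto simp: E_def indicator_def)
  have ii: "integrable ?L (\<lambda>x. \<sigma> * (w x * indicator E x) - c * indicator E x)" using wi Ei by auto
  have "(\<integral>x. (\<sigma> * w x - c) * indicator E x \<partial>?L) = (\<integral>x. \<sigma> * (w x * indicator E x) - c * indicator E x \<partial>?L)"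
    by (rule Bochner_Integration.integral_cong) (auto simp: algebra_simps)
  also have "\<dots> = \<sigma> * (\<integral>x. w x * indicator E x \<partial>?L) - c * measure ?L E"
  proof -
    have "E \<inter> \<Omega> = E" using sets.sets_into_space[OF Es] by auto
    then show ?thesis using wi Ei by simp
  qed
  finally have "(\<integral>x. (\<sigma> * w x - c) * indicator E x \<partial>?L) \<le> 0" using le by simp
  moreover have "integrable ?L (\<lambda>x. (\<sigma> * w x - c) * indicator E x)"
    using ii by (rule Bochner_Integration.integrable_cong[THEN iffD1, rotated 2]) (auto simp: algebra_simps)
  ultimately have "AE x in ?L. (\<sigma> * w x - c) * indicator E x = 0"
    using integral_nonneg_eq_0_iff_AE[of ?L "\<lambda>x. (\<sigma> * w x - c) * indicator E x"] nn
    by (metis (no_types, lifting) AE_I2 Bochner_Integration.integral_nonneg order_antisym)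
  with AE_space[of ?L] show ?thesis
    by eventually_elim (auto simp: E_def indicator_def split: if_splits)
qed

end

section \<open>Bounds that are uniform in the exponent\<close>

locale singular_family = elliptic_problem \<Omega> M \<alpha> \<beta>
  for \<Omega> :: "(real^'N) set" and M :: "real^'N \<Rightarrow> real^'N^'N" and \<alpha> \<beta> :: real +
  fixes \<omega> :: "(real^'N) set" and f :: "real^'N \<Rightarrow> real" and u :: "nat \<Rightarrow> real^'N \<Rightarrow> real"
  assumes f_Linf: "f \<in> Linf \<Omega>"
    and f_nonneg: "AE x in lebesgue_on \<Omega>. f x \<ge> 0"
    and inside: "\<omega> \<Subset> \<Omega>"
    and f_off: "AE x in lebesgue_on \<Omega>. x \<notin> \<omega> \<longrightarrow> f x = 0"
    and f_lower: "\<And>\<omega>'. \<omega>' \<Subset> \<omega> \<Longrightarrow> \<exists>c>0. AE x in lebesgue_on \<omega>'. f x \<ge> c"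
    and u_solution: "\<And>n. n \<ge> 2 \<Longrightarrow> monotone_approximation_solution \<Omega> M f (real n) (u n)"
begin

abbreviation L :: "(real^'N) measure" where "L \<equiv> lebesgue_on \<Omega>"

abbreviation source :: "nat \<Rightarrow> real^'N \<Rightarrow> real" where "source n x \<equiv> f x / u n x ^ n"

abbreviation U :: "nat \<Rightarrow> real^'N \<Rightarrow> real \<times> (real^'N)" where "U n x \<equiv> (u n x, weak_grad \<Omega> (u n) x)"

lemma omega_inside: "open \<omega>" "compact (closure \<omega>)" "closure \<omega> \<subseteq> \<Omega>" "\<omega> \<subseteq> \<Omega>"
  using inside closure_subset[of \<omega>] by (auto simp: compactly_inside_def)

lemma f_measurable: "f \<in> borel_measurable L"
  using f_Linf by (simp add: Linf_def)

lemma f_bound: obtains F where "F > 0" "AE x in L. f x \<le> F"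
proof -
  obtain C where C: "AE x in L. \<bar>f x\<bar> \<le> C" using f_Linf by (auto simp: Linf_def)
  have "AE x in L. f x \<le> max 1 C" using C by eventually_elim auto
  then show ?thesis by (intro that[of "max 1 C"]) auto
qed

lemma f_integrable: "integrable L f"
proof -
  obtain C where C: "AE x in L. \<bar>f x\<bar> \<le> C" using f_Linf by (auto simp: Linf_def)
  then show ?thesis by (intro integrable_const_bound[of _ C] f_measurable) auto
qed

text \<open>The two formulations differ only in the representative of the gradient of the test function.\<close>

lemma approximate_solution_weak:
  assumes "approximate_solution \<Omega> M f \<gamma> m v"
  shows "weak_solution (\<lambda>x. (v x, weak_grad \<Omega> v x)) (\<lambda>x. f x / (v x + 1 / real m) powr \<gamma>)"
  unfolding weak_solution_def
proof (intro conjI ballI)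
  have v: "v \<in> W1p_0 2 \<Omega>" using assms by (simp add: approximate_solution_def)
  show VH: "(\<lambda>x. (v x, weak_grad \<Omega> v x)) \<in> H0 \<Omega>" by (rule W1p_0_imp_H0[OF v])
  fix W assume W: "W \<in> H0 \<Omega>"
  have gL: "weak_grad \<Omega> v \<in> L2 L" using H0_snd_L2[OF VH] by simp
  have wL: "weak_grad \<Omega> (\<lambda>x. fst (W x)) \<in> L2 L"
    using H0_snd_L2[OF W1p_0_imp_H0[OF H0_imp_W1p_0[OF W]]] by simp
  have "(\<integral>x. (M x *v weak_grad \<Omega> v x) \<bullet> snd (W x) \<partial>L) = (\<integral>x. (M x *v weak_grad \<Omega> v x) \<bullet> weak_grad \<Omega> (\<lambda>x. fst (W x)) x \<partial>L)"
  proof (rule integral_cong_AE)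
    show "(\<lambda>x. (M x *v weak_grad \<Omega> v x) \<bullet> snd (W x)) \<in> borel_measurable L"
      "(\<lambda>x. (M x *v weak_grad \<Omega> v x) \<bullet> weak_grad \<Omega> (\<lambda>x. fst (W x)) x) \<in> borel_measurable L"
      by (intro borel_measurable_inner L2_measurable[OF flux_L2[OF gL]] L2_measurable[OF wL]
          L2_measurable[OF H0_snd_L2[OF W]])+
    show "AE x in L. (M x *v weak_grad \<Omega> v x) \<bullet> snd (W x) = (M x *v weak_grad \<Omega> v x) \<bullet> weak_grad \<Omega> (\<lambda>x. fst (W x)) x"
      using H0_weak_grad_AE[OF W] by eventually_elim simp
  qed
  also have "\<dots> = (\<integral>x. f x * fst (W x) / (v x + 1 / real m) powr \<gamma> \<partial>L)"
    using assms H0_imp_W1p_0[OF W] unfolding approximate_solution_def by blast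
  finally show "(\<integral>x. (M x *v snd (v x, weak_grad \<Omega> v x)) \<bullet> snd (W x) \<partial>L)
      = (\<integral>x. f x / (v x + 1 / real m) powr \<gamma> * fst (W x) \<partial>L)" by simp
qed

text \<open>Stampacchia's bound and the energy bound, applied to \<open>G = f / (v + 1/m) ^ n\<close>.\<close>

lemma approximate_solution_bounds:
  obtains K E where "K \<ge> 0"
    "\<And>n m v k. n \<ge> 2 \<Longrightarrow> m \<ge> 1 \<Longrightarrow> k \<ge> 1 \<Longrightarrow> approximate_solution \<Omega> M f (real n) m v \<Longrightarrow>
      AE x in L. v x \<le> k + K / k ^ n"
    "\<And>n m v. n \<ge> 2 \<Longrightarrow> m \<ge> 1 \<Longrightarrow> approximate_solution \<Omega> M f (real n) m v \<Longrightarrow>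
      sqn L (weak_grad \<Omega> v) \<le> E"
proof -
  obtain F where F: "F > 0" "AE x in L. f x \<le> F" by (rule f_bound)
  obtain R where R: "R > 0" "4 * measure L \<Omega> \<le> measure lborel (ball (0::real^'N) R)" using ex_large_ball by blast
  obtain \<phi> where \<phi>: "\<phi> \<in> C1c \<Omega>" "\<And>x. \<phi> x \<ge> 0" "\<And>x. x \<in> closure \<omega> \<Longrightarrow> \<phi> x \<ge> 1"
    by (rule C1c_cutoff[OF omega_inside(2) open_Om omega_inside(3)]) blast
  define K where "K = 2 ^ (CARD('N) + 1) * (2 * F / \<alpha>) * R\<^sup>2"
  define E where "E = 2 * ((\<integral>x. f x \<partial>L) + \<beta>\<^sup>2 / (2 * \<alpha>) * sqn L (grad \<phi>)) / \<alpha>"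
  have K0: "K \<ge> 0" using F alpha_pos by (simp add: K_def)
  show ?thesis
  proof (rule that[of K E, OF K0])
    fix n m :: nat and v assume n: "n \<ge> 2" and m: "m \<ge> 1" and v: "approximate_solution \<Omega> M f (real n) m v"
    define G where "G x = f x / (v x + 1 / real m) powr real n" for x
    define V where "V x = (v x, weak_grad \<Omega> v x)" for x
    have V: "weak_solution V G"
      using approximate_solution_weak[OF v] by (simp add: V_def[abs_def] G_def[abs_def])
    have v0: "AE x in L. 0 \<le> v x" using v by (simp add: approximate_solution_def)
    have m0: "1 / real m > 0" using m by simp
    have vm: "v \<in> borel_measurable L" using v by (simp add: approximate_solution_def Linf_def)
    have Gm: "G \<in> borel_measurable L"
      unfolding G_def using f_measurable vm by measurable
    have G0: "AE x in L. 0 \<le> G x"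
      using f_nonneg by eventually_elim (simp add: G_def)
    show "AE x in L. v x \<le> k + K / k ^ n" if k: "k \<ge> 1" for k :: real
    proof -
      have "AE x in L. fst (V x) > k \<longrightarrow> G x \<le> F / k ^ n"
        using F(2)
      proof eventually_elim
        case (elim x)
        show ?case
        proof
          assume "fst (V x) > k"
          then have "v x > k" by (simp add: V_def)
          with m0 have *: "v x + 1 / real m \<ge> k" by linarith
          have "k ^ n = k powr real n" using k by (simp add: powr_realpow)
          also have "\<dots> \<le> (v x + 1 / real m) powr real n" using * k by (intro powr_mono2) auto
          finally have "k ^ n \<le> (v x + 1 / real m) powr real n" .
          moreover have "k ^ n > 0" using k by simp
          ultimately show "G x \<le> F / k ^ n"
            unfolding G_def using elim F(1) by (intro frac_le) auto
        qed
      qed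
      moreover have "0 \<le> k" "0 < F / k ^ n" using k F(1) by auto
      ultimately have "AE x in L. fst (V x) \<le> k + 2 ^ (CARD('N) + 1) * (2 * (F / k ^ n) / \<alpha>) * R\<^sup>2"
        by (intro weak_solution_upper_bound[OF V _ _ _ R]) auto
      then show ?thesis by (simp add: V_def K_def mult.commute)
    qed
    have Gint: "integrable L G"
    proof (rule integrable_const_bound[OF _ Gm])
      show "AE x in L. norm (G x) \<le> F / (1 / real m) powr real n"
        using F(2) f_nonneg v0
      proof eventually_elim
        case (elim x)
        have "(1 / real m) powr real n \<le> (v x + 1 / real m) powr real n"
          using elim(3) m0 by (intro powr_mono2) auto
        moreover have "(1 / real m) powr real n > 0" using m by simp
        ultimately have "G x \<le> F / (1 / real m) powr real n"
          unfolding G_def using elim F(1) by (intro frac_le) auto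
        moreover have "G x \<ge> 0" using elim by (simp add: G_def)
        ultimately show ?case by simp
      qed
    qed
    have GV: "AE x in L. G x * fst (V x) \<le> f x + G x"
      using f_nonneg v0
    proof eventually_elim
      case (elim x)
      define t where "t = v x + 1 / real m"
      have t: "t > 0" unfolding t_def using elim(2) m0 by linarith
      have G': "G x = f x / t ^ n" using t by (simp add: G_def t_def powr_realpow)
      show ?case
      \<comment> \<open>where \<open>t > 1\<close> the source times \<open>t\<close> is at most \<open>f\<close>; where \<open>t \<le> 1\<close> it is at most the source\<close>
      proof (cases "t \<le> 1")
        case True
        then have "v x \<le> 1" using m0 unfolding t_def by linarith
        moreover have "G x \<ge> 0" using elim(1) t by (simp add: G')
        ultimately have "G x * v x \<le> G x" by (simp add: mult_left_le)
        then show ?thesis using elim(1) by (simp add: V_def)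
      next
        case False
        have "G x * v x \<le> G x * t" using elim(1) t m0 by (intro mult_left_mono) (auto simp: G' t_def)
        also have "\<dots> = f x * (t / t ^ n)" by (simp add: G')
        also have "\<dots> \<le> f x * 1"
        proof (rule mult_left_mono[OF _ elim(1)])
          have "t ^ 1 \<le> t ^ n" using False n by (intro power_increasing) auto
          then show "t / t ^ n \<le> 1" using t by (simp add: divide_le_eq_1_pos)
        qed
        moreover have "G x \<ge> 0" using elim(1) t by (simp add: G')
        ultimately show ?thesis by (simp add: V_def)
      qed
    qed
    have supp: "AE x in L. G x \<le> G x * \<phi> x"
      using f_off G0
    proof eventually_elim
      case (elim x)
      show ?case
      proof (cases "x \<in> \<omega>")
        case True
        then have "\<phi> x \<ge> 1" using \<phi>(3) closure_subset[of \<omega>] by blast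
        then show ?thesis using elim(2) mult_left_mono[of 1 "\<phi> x" "G x"] by simp
      next
        case False
        then show ?thesis using elim(1) by (simp add: G_def)
      qed
    qed
    show "sqn L (weak_grad \<Omega> v) \<le> E"
      using weak_solution_energy(1)[OF V Gint G0 f_integrable f_nonneg GV \<phi>(1) supp] by (simp add: E_def V_def)
  qed
qed

lemma u_distributional:
  assumes "n \<ge> 2"
  shows "distributional_solution \<Omega> M f (real n) (u n)"
  using u_solution[OF assms] by (simp add: monotone_approximation_solution_def)

lemma u_lower: assumes "n \<ge> 2" obtains c where "c > 0" "AE x in lebesgue_on \<omega>. u n x \<ge> c"
  using u_distributional[OF assms] inside unfolding distributional_solution_def by blast

lemma u_pos: assumes "n \<ge> 2" shows "AE x in L. x \<in> \<omega> \<longrightarrow> u n x > 0"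
proof -
  obtain c where c: "c > 0" "AE x in lebesgue_on \<omega>. u n x \<ge> c" by (rule u_lower[OF assms])
  have "\<omega> \<in> sets lebesgue" using omega_inside(1) by simp
  then have "AE x in lebesgue. x \<in> \<omega> \<longrightarrow> u n x \<ge> c" using c(2) by (simp add: AE_lebesgue_on_iff)
  then have "AE x in lebesgue. x \<in> \<Omega> \<longrightarrow> x \<in> \<omega> \<longrightarrow> u n x > 0"
    by eventually_elim (use c(1) in auto)
  then show ?thesis by (simp add: AE_lebesgue_on_iff[OF Om_sets])
qed

text \<open>
  Pointwise bounds pass to the limit of the approximations directly. For the energy, the bounded approximations
  converge almost everywhere, hence against test functions, and their weak limit in \<open>H0 \<Omega>\<close> is \<open>u n\<close>.
\<close>

lemma u_uniform_bounds:
  obtains K E where "K \<ge> 0"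
    "\<And>n k. n \<ge> 2 \<Longrightarrow> k \<ge> 1 \<Longrightarrow> AE x in L. u n x \<le> k + K / k ^ n"
    "\<And>n. n \<ge> 2 \<Longrightarrow> AE x in L. 0 \<le> u n x"
    "\<And>n. n \<ge> 2 \<Longrightarrow> U n \<in> H0 \<Omega>"
    "\<And>n. n \<ge> 2 \<Longrightarrow> sqn L (U n) \<le> E"
proof -
  obtain K E where K: "K \<ge> 0"
    and sup: "\<And>n m v k. n \<ge> 2 \<Longrightarrow> m \<ge> 1 \<Longrightarrow> k \<ge> 1 \<Longrightarrow> approximate_solution \<Omega> M f (real n) m v \<Longrightarrow>
      AE x in L. v x \<le> k + K / k ^ n"
    and en: "\<And>n m v. n \<ge> 2 \<Longrightarrow> m \<ge> 1 \<Longrightarrow> approximate_solution \<Omega> M f (real n) m v \<Longrightarrow>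
      sqn L (weak_grad \<Omega> v) \<le> E"
    using approximate_solution_bounds by metis
  define E' where "E' = (1 + K)\<^sup>2 * measure L \<Omega> + E"
  have main: "(\<forall>k\<ge>1. AE x in L. u n x \<le> k + K / k ^ n) \<and> (AE x in L. 0 \<le> u n x) \<and> U n \<in> H0 \<Omega> \<and> sqn L (U n) \<le> E'"
    if n: "n \<ge> 2" for n
  proof -
    obtain v where v: "\<And>m. m \<ge> 1 \<Longrightarrow> approximate_solution \<Omega> M f (real n) m (v m)"
      and lim: "AE x in L. (\<lambda>m. v m x) \<longlonglongrightarrow> u n x"
      using u_solution[OF n] unfolding monotone_approximation_solution_def by blast
    define z where "z m = v (Suc m)" for m
    have z: "approximate_solution \<Omega> M f (real n) (Suc m) (z m)" for m unfolding z_def by (rule v) simp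
    have zlim: "AE x in L. (\<lambda>m. z m x) \<longlonglongrightarrow> u n x"
      using lim unfolding z_def by eventually_elim (rule LIMSEQ_Suc)
    have ub: "AE x in L. u n x \<le> k + K / k ^ n" if k: "k \<ge> 1" for k
    proof -
      have "AE x in L. \<forall>m. z m x \<le> k + K / k ^ n"
        unfolding AE_all_countable using sup[OF n _ k z] by simp
      with zlim show ?thesis by eventually_elim (rule LIMSEQ_le_const2, auto)
    qed
    have z0: "AE x in L. \<forall>m. 0 \<le> z m x"
      unfolding AE_all_countable using z by (auto simp: approximate_solution_def)
    with zlim have u0: "AE x in L. 0 \<le> u n x" by eventually_elim (rule LIMSEQ_le_const, auto)
    have zB: "AE x in L. \<forall>m. \<bar>z m x\<bar> \<le> 1 + K"
    proof -
      have "AE x in L. z m x \<le> 1 + K" for m using sup[OF n _ _ z[of m], of 1] by simp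
      then have "AE x in L. \<forall>m. z m x \<le> 1 + K" unfolding AE_all_countable by blast
      with z0 show ?thesis by eventually_elim auto
    qed
    have "AE x in L. u n x \<le> 1 + K" using ub[of 1] by simp
    with u0 have uB: "AE x in L. \<bar>u n x\<bar> \<le> 1 + K" by eventually_elim auto
    have zm: "z m \<in> borel_measurable L" for m using z by (simp add: approximate_solution_def Linf_def)
    have um: "u n \<in> borel_measurable L"
    proof (rule measurable_lebesgue_on_AE_eq[OF _ Om_sets])
      show "(\<lambda>x. lim (\<lambda>m. z m x)) \<in> borel_measurable L" by (rule borel_measurable_lim_metric[OF zm])
      show "AE x in L. lim (\<lambda>m. z m x) = u n x" using zlim by eventually_elim (rule limI)
    qed
    define V where "V m x = (z m x, weak_grad \<Omega> (z m) x)" for m x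
    have VH: "V m \<in> H0 \<Omega>" for m
      using approximate_solution_weak[OF z, of m] by (simp add: weak_solution_def V_def[abs_def])
    have VE: "sqn L (V m) \<le> E'" for m
    proof -
      have "sqn L (z m) \<le> (\<integral>x. (1 + K)\<^sup>2 \<partial>L)"
        unfolding sqn_def
      proof (rule integral_mono_AE)
        show "integrable L (\<lambda>x. (norm (z m x))\<^sup>2)"
          using L2_integrable_sq[OF H0_fst_L2[OF VH[of m]]] by (simp add: V_def)
        show "AE x in L. (norm (z m x))\<^sup>2 \<le> (1 + K)\<^sup>2"
          using zB
        proof eventually_elim
          case (elim x)
          from power_mono[OF spec[OF elim, of m] abs_ge_zero, of 2] show ?case by simp
        qed
      qed simp
      also have "\<dots> = (1 + K)\<^sup>2 * measure L \<Omega>" by simp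
      finally have "sqn L (z m) \<le> (1 + K)\<^sup>2 * measure L \<Omega>" .
      moreover have "sqn L (weak_grad \<Omega> (z m)) \<le> E" by (rule en[OF n _ z]) simp
      ultimately show ?thesis
        by (subst sqn_pair[OF H0_L2[OF VH]]) (simp add: V_def E'_def)
    qed
    have ui: "u n \<in> L2 L" by (rule bounded_measurable_L2[OF um]) (use uB in simp)
    have wl: "(\<lambda>m. \<integral>x. fst (V m x) * \<psi> x \<partial>L) \<longlonglongrightarrow> (\<integral>x. u n x * \<psi> x \<partial>L)" if \<psi>: "\<psi> \<in> C1c \<Omega>" for \<psi>
    proof (rule integral_dominated_convergence)
      have pm: "\<psi> \<in> borel_measurable L" by (rule L2_measurable[OF C1c_L2(1)[OF \<psi>]])
      show "integrable L (\<lambda>x. (1 + K) * \<bar>\<psi> x\<bar>)" using L2_integrable[OF C1c_L2(1)[OF \<psi>]] by auto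
      show "(\<lambda>x. u n x * \<psi> x) \<in> borel_measurable L" using um pm by measurable
      show "(\<lambda>x. fst (V m x) * \<psi> x) \<in> borel_measurable L" for m using zm[of m] pm by (simp add: V_def)
      show "AE x in L. (\<lambda>m. fst (V m x) * \<psi> x) \<longlonglongrightarrow> u n x * \<psi> x"
        using zlim by eventually_elim (simp add: V_def tendsto_mult_right)
      show "AE x in L. norm (fst (V m x) * \<psi> x) \<le> (1 + K) * \<bar>\<psi> x\<bar>" for m
        using zB by eventually_elim (simp add: V_def abs_mult mult_right_mono)
    qed
    obtain g where g: "(\<lambda>x. (u n x, g x)) \<in> H0 \<Omega>" "sqn L (\<lambda>x. (u n x, g x)) \<le> E'"
      by (rule H0_weak_limit[OF VH VE L2_Lp_loc[OF ui] wl])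
    have "AE x in L. g x = weak_grad \<Omega> (u n) x" using H0_weak_grad_AE[OF g(1)] by simp
    then have ae: "AE x in L. (u n x, g x) = U n x" by eventually_elim simp
    have UH: "U n \<in> H0 \<Omega>" by (rule H0_AE_cong[OF g(1) ae])
    have "sqn L (U n) = sqn L (\<lambda>x. (u n x, g x))"
      by (rule L2_AE_cong(2)[OF H0_L2[OF g(1)] L2_measurable[OF H0_L2[OF UH]] ae])
    with g(2) UH ub u0 show ?thesis by auto
  qed
  show ?thesis by (rule that[of K E', OF K]) (use main in auto)
qed

end

section \<open>Limits of the solutions\<close>

text \<open>From \<open>t \<ge> 2 - 1/t\<close> and Bernoulli's inequality for \<open>(1/t) ^ n\<close>.\<close>

lemma reciprocal_power_bound:
  assumes "t > (0::real)" "n \<ge> 1"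
  shows "1 - (1 / t ^ n) / real n \<le> t"
proof -
  have "1 + real n * (1 / t - 1) \<le> (1 + (1 / t - 1)) ^ n"
    using assms by (intro Bernoulli_inequality) simp
  then have "1 + real n * (1 / t - 1) \<le> 1 / t ^ n" by (simp add: power_divide)
  then have "real n * (1 / t - 1) \<le> 1 / t ^ n" by linarith
  then have "1 / t - 1 \<le> (1 / t ^ n) / real n"
    using assms(2) by (simp only: pos_le_divide_eq of_nat_0_less_iff mult.commute)
  moreover have "2 - 1 / t \<le> t"
  proof -
    have "0 \<le> (t - 1)\<^sup>2" by simp
    then show ?thesis using assms(1) by (simp add: field_simps power2_eq_square)
  qed
  ultimately show ?thesis by linarith
qed

text \<open>The constants of the uniform bounds are fixed once and for all, so that later statements share them.\<close>

locale bounded_singular_family = singular_family \<Omega> M \<alpha> \<beta> \<omega> f u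
  for \<Omega> :: "(real^'N) set" and M :: "real^'N \<Rightarrow> real^'N^'N" and \<alpha> \<beta> :: real
    and \<omega> :: "(real^'N) set" and f :: "real^'N \<Rightarrow> real" and u :: "nat \<Rightarrow> real^'N \<Rightarrow> real" +
  fixes K E :: real
  assumes K_nonneg: "K \<ge> 0"
    and u_upper: "\<And>n k. n \<ge> 2 \<Longrightarrow> k \<ge> 1 \<Longrightarrow> AE x in L. u n x \<le> k + K / k ^ n"
    and u_nonneg: "\<And>n. n \<ge> 2 \<Longrightarrow> AE x in L. 0 \<le> u n x"
    and U_H0: "\<And>n. n \<ge> 2 \<Longrightarrow> U n \<in> H0 \<Omega>"
    and U_energy: "\<And>n. n \<ge> 2 \<Longrightarrow> sqn L (U n) \<le> E"
begin

lemma u_abs_le: "n \<ge> 2 \<Longrightarrow> AE x in L. \<bar>u n x\<bar> \<le> 1 + K"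
proof -
  assume n: "n \<ge> 2"
  from u_upper[OF n, of 1] have "AE x in L. u n x \<le> 1 + K" by simp
  with u_nonneg[OF n] show ?thesis by eventually_elim auto
qed

lemma u_measurable: "n \<ge> 2 \<Longrightarrow> u n \<in> borel_measurable L"
  using L2_measurable[OF H0_fst_L2[OF U_H0]] by simp

lemma u_Linf: "n \<ge> 2 \<Longrightarrow> u n \<in> Linf \<Omega>"
  using u_measurable u_abs_le by (auto simp: Linf_def)

lemma source_nonneg: "n \<ge> 2 \<Longrightarrow> AE x in L. 0 \<le> source n x"
  using u_nonneg[of n] f_nonneg by (auto elim: eventually_elim2)

lemma source_measurable: "n \<ge> 2 \<Longrightarrow> source n \<in> borel_measurable L"
  using f_measurable u_measurable[of n] by measurable

text \<open>For a fixed exponent the source is bounded, since \<open>u n\<close> is bounded below in \<open>\<omega>\<close>; this bound is not uniform in \<open>n\<close>.\<close>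

lemma source_integrable:
  assumes n: "n \<ge> 2"
  shows "integrable L (source n)"
proof -
  obtain F where F: "F > 0" "AE x in L. f x \<le> F" by (rule f_bound)
  obtain c where c: "c > 0" "AE x in lebesgue_on \<omega>. u n x \<ge> c" by (rule u_lower[OF n])
  have "AE x in lebesgue. x \<in> \<omega> \<longrightarrow> u n x \<ge> c"
    using c(2) omega_inside(1) by (simp add: AE_lebesgue_on_iff)
  then have low: "AE x in L. x \<in> \<omega> \<longrightarrow> u n x \<ge> c"
    unfolding AE_lebesgue_on_iff[OF Om_sets] by eventually_elim auto
  have "AE x in L. norm (source n x) \<le> F / c ^ n"
    using F(2) low f_off f_nonneg
  proof eventually_elim
    case (elim x)
    show ?case
    proof (cases "x \<in> \<omega>")
      case True
      with elim c(1) have "c ^ n \<le> u n x ^ n" by (intro power_mono) auto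
      moreover have "c ^ n > 0" using c(1) by simp
      ultimately have "source n x \<le> F / c ^ n" using elim(1) F(1) by (intro frac_le) auto
      moreover have "source n x \<ge> 0" using elim True c(1) by auto
      ultimately show ?thesis by simp
    next
      case False
      then show ?thesis using elim F(1) c(1) by simp
    qed
  qed
  then show ?thesis by (rule integrable_const_bound) (rule source_measurable[OF n])
qed

lemma u_equation:
  assumes n: "n \<ge> 2" and \<phi>: "\<phi> \<in> C1c \<Omega>"
  shows "(\<integral>x. (M x *v weak_grad \<Omega> (u n) x) \<bullet> grad \<phi> x \<partial>L) = (\<integral>x. source n x * \<phi> x \<partial>L)"
proof -
  have "(\<integral>x. (M x *v weak_grad \<Omega> (u n) x) \<bullet> grad \<phi> x \<partial>L) = (\<integral>x. f x * \<phi> x / u n x powr real n \<partial>L)"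
    using u_distributional[OF n] \<phi> unfolding distributional_solution_def by blast
  also have "\<dots> = (\<integral>x. source n x * \<phi> x \<partial>L)"
  proof (rule integral_cong_AE)
    have pm: "\<phi> \<in> borel_measurable L" by (rule L2_measurable[OF C1c_L2(1)[OF \<phi>]])
    show "(\<lambda>x. f x * \<phi> x / u n x powr real n) \<in> borel_measurable L"
      using f_measurable u_measurable[OF n] pm by measurable
    show "(\<lambda>x. source n x * \<phi> x) \<in> borel_measurable L"
      using source_measurable[OF n] pm by measurable
    show "AE x in L. f x * \<phi> x / u n x powr real n = source n x * \<phi> x"
      using u_pos[OF n] f_off
    proof eventually_elim
      case (elim x)
      then show ?case by (cases "x \<in> \<omega>") (auto simp: powr_realpow)
    qed
  qed
  finally show ?thesis .
qed

text \<open>The source is tested with a cutoff of \<open>\<omega>\<close>, and the energy bound controls the flux.\<close>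

lemma source_bound: obtains X where "\<And>n. n \<ge> 2 \<Longrightarrow> (\<integral>x. source n x \<partial>L) \<le> X"
proof -
  obtain \<phi> where \<phi>: "\<phi> \<in> C1c \<Omega>" "\<And>x. \<phi> x \<ge> 0" "\<And>x. x \<in> closure \<omega> \<Longrightarrow> \<phi> x \<ge> 1"
    by (rule C1c_cutoff[OF omega_inside(2) open_Om omega_inside(3)]) blast
  obtain b where b: "\<And>x. \<bar>\<phi> x\<bar> \<le> b" by (rule C1c_bounded[OF \<phi>(1)]) blast
  show ?thesis
  proof (rule that)
    fix n :: nat assume n: "n \<ge> 2"
    have gL: "weak_grad \<Omega> (u n) \<in> L2 L" using H0_snd_L2[OF U_H0[OF n]] by simp
    have "(\<integral>x. source n x \<partial>L) \<le> (\<integral>x. source n x * \<phi> x \<partial>L)"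
    proof (rule integral_mono_AE[OF source_integrable[OF n]])
      show "integrable L (\<lambda>x. source n x * \<phi> x)"
        by (rule bounded_mult_integrable[OF source_integrable[OF n] C1c_continuous[OF \<phi>(1)] b])
      show "AE x in L. source n x \<le> source n x * \<phi> x"
        using f_off source_nonneg[OF n]
      proof eventually_elim
        case (elim x)
        show ?case
        proof (cases "x \<in> \<omega>")
          case True
          then have "\<phi> x \<ge> 1" using \<phi>(3) closure_subset[of \<omega>] by blast
          then show ?thesis using elim(2) mult_left_mono[of 1 "\<phi> x" "source n x"] by simp
        qed (use elim(1) in simp)
      qed
    qed
    also have "\<dots> = (\<integral>x. (M x *v weak_grad \<Omega> (u n) x) \<bullet> grad \<phi> x \<partial>L)"
      by (rule u_equation[OF n \<phi>(1), symmetric])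
    also have "\<dots> \<le> \<alpha> / 2 * sqn L (weak_grad \<Omega> (u n)) + \<beta>\<^sup>2 / (2 * \<alpha>) * sqn L (grad \<phi>)"
      by (rule flux_test_bound[OF gL \<phi>(1)])
    also have "\<dots> \<le> \<alpha> / 2 * E + \<beta>\<^sup>2 / (2 * \<alpha>) * sqn L (grad \<phi>)"
    proof -
      have "sqn L (weak_grad \<Omega> (u n)) \<le> E"
        using U_energy[OF n] sqn_nonneg[of L "u n"] by (subst (asm) sqn_pair[OF H0_L2[OF U_H0[OF n]]]) simp
      then show ?thesis using alpha_pos by (intro add_right_mono mult_left_mono) auto
    qed
    finally show "(\<integral>x. source n x \<partial>L) \<le> \<alpha> / 2 * E + \<beta>\<^sup>2 / (2 * \<alpha>) * sqn L (grad \<phi>)" .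
  qed
qed

text \<open>
  The functions \<open>u n\<close> are densities of bounded mass, so a subsequence converges as measures. The limit measure
  has a density because the midpoints converge strongly in \<open>L2\<close>, and continuous functions are dense in \<open>L1\<close>.
\<close>

lemma ex_weak_star_subsequence:
  "\<exists>s w. strict_mono s \<and> (\<forall>k. s k \<ge> 2) \<and> weak_star_Linf \<Omega> (\<lambda>k. u (s k)) w"
proof -
  have ui: "integrable L (u n)" if "n \<ge> 2" for n
    using L2_integrable[OF H0_fst_L2[OF U_H0[OF that]]] by simp
  have mass: "(\<integral>x. u n x \<partial>L) \<le> (1 + K) * measure L \<Omega>" if n: "n \<ge> 2" for n
  proof -
    have "(\<integral>x. u n x \<partial>L) \<le> (\<integral>x. 1 + K \<partial>L)"
      using u_abs_le[OF n] by (intro integral_mono_AE ui n) (auto elim: eventually_mono)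
    then show ?thesis by (simp add: mult.commute)
  qed
  have A: "integrable L (u (k + 2))" "AE x in L. 0 \<le> u (k + 2) x" "(\<integral>x. u (k + 2) x \<partial>L) \<le> (1 + K) * measure L \<Omega>" for k
    using ui[of "k + 2"] u_nonneg[of "k + 2"] mass[of "k + 2"] by simp_all
  obtain r \<nu> where r: "strict_mono (r :: nat \<Rightarrow> nat)" and "finite_measure \<nu>" and
    lim: "\<And>\<phi>. continuous_on UNIV \<phi> \<Longrightarrow> bounded (range \<phi>) \<Longrightarrow>
      (\<lambda>k. \<integral>x. u (r k + 2) x * \<phi> x \<partial>L) \<longlonglongrightarrow> (\<integral>x. \<phi> x \<partial>\<nu> :: real)"
    by (rule weak_compactness_densities[of \<Omega> "\<lambda>k. u (k + 2)", OF bounded_Om Om_sets A], rule that, assumption+)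
  define s where "s k = r k + 2" for k
  have s2: "s k \<ge> 2" for k by (simp add: s_def)
  obtain y Y where Y: "Y \<in> L2 L" and y: "\<And>k. y k \<in> midhull (\<lambda>k. U (s k)) k"
    and yY: "(\<lambda>k. sqn L (\<lambda>x. y k x - Y x)) \<longlonglongrightarrow> 0"
    and Yl: "\<And>\<Phi> l. \<Phi> \<in> L2 L \<Longrightarrow> (\<lambda>k. \<integral>x. U (s k) x \<bullet> \<Phi> x \<partial>L) \<longlonglongrightarrow> l \<Longrightarrow> (\<integral>x. Y x \<bullet> \<Phi> x \<partial>L) = l"
    by (rule L2_weak_limit[OF H0_L2[OF U_H0[OF s2]] U_energy[OF s2]], rule that, assumption+)
  define w where "w x = fst (Y x)" for x
  have wm: "w \<in> borel_measurable L"
    using Y unfolding L2_pair w_def by (blast intro: L2_measurable)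
  define S where "S = {- (1 + K)..1 + K} \<times> (UNIV :: (real^'N) set)"
  have "AE x in L. Y x \<in> S"
  proof (rule L2_limit_AE_closed[OF _ Y yY])
    show "y k \<in> L2 L" for k by (rule midhull_L2[OF y H0_L2[OF U_H0[OF s2]]])
    show "closed S" unfolding S_def by (intro closed_Times) auto
    show "AE x in L. y k x \<in> S" for k
    proof (rule midhull_AE_convex[OF y])
      show "convex S" unfolding S_def by (intro convex_Times) auto
      show "AE x in L. U (s j) x \<in> S" for j
        using u_abs_le[OF s2[of j]] by eventually_elim (auto simp: S_def)
    qed
  qed
  then have wB: "AE x in L. \<bar>w x\<bar> \<le> 1 + K" by eventually_elim (auto simp: S_def w_def)
  have "weak_star_Linf \<Omega> (\<lambda>k. u (s k)) w"
  proof (rule weak_star_LinfI[OF u_measurable[OF s2] u_abs_le[OF s2] wm wB])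
    show "1 + K > 0" using K_nonneg by simp
    fix \<phi> :: "real^'N \<Rightarrow> real" and b assume \<phi>: "continuous_on UNIV \<phi>" "\<And>x. \<bar>\<phi> x\<bar> \<le> b"
    have \<phi>L: "\<phi> \<in> L2 L"
      by (rule bounded_measurable_L2[OF continuous_borel_lebesgue_on[OF \<phi>(1)], of b]) (simp add: \<phi>(2))
    then have L2: "(\<lambda>x. (\<phi> x, 0 :: real^'N)) \<in> L2 L" by (simp add: L2_pair) (simp add: L2_def)
    have "bounded (range \<phi>)" using \<phi>(2) by (auto simp: bounded_iff)
    note l = lim[OF \<phi>(1) this, folded s_def]
    have "(\<integral>x. Y x \<bullet> (\<phi> x, 0) \<partial>L) = (\<integral>x. \<phi> x \<partial>\<nu>)"
      using l by (intro Yl[OF L2]) (simp add: inner_prod_def)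
    then have "(\<integral>x. w x * \<phi> x \<partial>L) = (\<integral>x. \<phi> x \<partial>\<nu>)" by (simp add: inner_prod_def w_def)
    with l show "(\<lambda>k. \<integral>x. u (s k) x * \<phi> x \<partial>L) \<longlonglongrightarrow> (\<integral>x. w x * \<phi> x \<partial>L)" by simp
  qed
  moreover have "strict_mono s" using r by (simp add: s_def strict_mono_def)
  ultimately show ?thesis using s2 by blast
qed

text \<open>The weak limit on the whole space, restricted to \<open>\<Omega>\<close>; functions with compact support in \<open>\<Omega>\<close> do not see the rest.\<close>

lemma ex_limit_measure:
  fixes s :: "nat \<Rightarrow> nat"
  assumes "\<And>k. s k \<ge> 2"
  shows "\<exists>r \<mu>. strict_mono r \<and> weak_star_measure \<Omega> (\<lambda>k. source (s (r k))) \<mu>"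
proof -
  obtain X where X: "\<And>n. n \<ge> 2 \<Longrightarrow> (\<integral>x. source n x \<partial>L) \<le> X" by (rule source_bound) blast
  obtain r \<nu> where r: "strict_mono (r :: nat \<Rightarrow> nat)" and \<nu>: "finite_measure \<nu>" "sets \<nu> = sets borel" and
    lim: "\<And>\<phi>. continuous_on UNIV \<phi> \<Longrightarrow> bounded (range \<phi>) \<Longrightarrow>
      (\<lambda>k. \<integral>x. source (s (r k)) x * \<phi> x \<partial>L) \<longlonglongrightarrow> (\<integral>x. \<phi> x \<partial>\<nu> :: real)"
    by (rule weak_compactness_densities[of \<Omega> "\<lambda>k. source (s k)", OF bounded_Om Om_sets
        source_integrable[OF assms] source_nonneg[OF assms] X[OF assms]], rule that, assumption+)
  interpret \<nu>: finite_measure \<nu> by (rule \<nu>(1))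
  define \<mu> where "\<mu> = restrict_space \<nu> \<Omega>"
  have sp: "space \<nu> = UNIV" using sets_eq_imp_space_eq[OF \<nu>(2)] by simp
  have Os: "\<Omega> \<inter> space \<nu> \<in> sets \<nu>" using \<nu>(2) open_Om by (simp add: sp)
  have "weak_star_measure \<Omega> (\<lambda>k. source (s (r k))) \<mu>"
    unfolding weak_star_measure_def
  proof (intro conjI ballI)
    show "sets \<mu> = sets (restrict_space borel \<Omega>)"
      unfolding \<mu>_def by (rule sets_restrict_space_cong[OF \<nu>(2)])
    have "emeasure \<mu> (space \<mu>) = emeasure \<nu> \<Omega>"
      using Os by (simp add: \<mu>_def space_restrict_space emeasure_restrict_space sp)
    then show "finite_measure \<mu>" by (intro finite_measureI) simp
    fix \<phi> :: "real^'N \<Rightarrow> real" assume "\<phi> \<in> Cc \<Omega>"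
    then have \<phi>: "continuous_on UNIV \<phi>" "compact (closure {x. \<phi> x \<noteq> 0})" "closure {x. \<phi> x \<noteq> 0} \<subseteq> \<Omega>"
      by (auto simp: Cc_def)
    have off: "\<phi> x = 0" if "x \<notin> closure {x. \<phi> x \<noteq> 0}" for x
      using that closure_subset[of "{x. \<phi> x \<noteq> 0}"] by blast
    obtain b where b: "\<And>x. norm (\<phi> x) \<le> b"
      by (rule continuous_zero_off_compact_bounded[OF \<phi>(1,2) off]) blast+
    then have br: "bounded (range \<phi>)" by (auto simp: bounded_iff)
    have "(\<integral>x. \<phi> x \<partial>\<mu>) = (\<integral>x. indicator \<Omega> x *\<^sub>R \<phi> x \<partial>\<nu>)"
      unfolding \<mu>_def by (rule integral_restrict_space[OF Os])
    also have "\<dots> = (\<integral>x. \<phi> x \<partial>\<nu>)"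
    proof (rule Bochner_Integration.integral_cong[OF refl])
      fix x show "indicator \<Omega> x *\<^sub>R \<phi> x = \<phi> x"
        using off[of x] \<phi>(3) by (cases "x \<in> \<Omega>") (auto simp: indicator_def)
    qed
    finally show "(\<lambda>k. \<integral>x. source (s (r k)) x * \<phi> x \<partial>L) \<longlonglongrightarrow> (\<integral>x. \<phi> x \<partial>\<mu>)"
      using lim[OF \<phi>(1) br] by simp
  qed
  with r show ?thesis by blast
qed

context
  fixes s :: "nat \<Rightarrow> nat" and w :: "real^'N \<Rightarrow> real"
  assumes s: "strict_mono s" "\<And>k. s k \<ge> 2" and ws: "weak_star_Linf \<Omega> (\<lambda>k. u (s k)) w"
begin

lemma s_at_top: "filterlim s at_top sequentially"
  by (rule filterlim_subseq[OF s(1)])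

text \<open>The bound \<open>u n \<le> k + K / k ^ n\<close> tends to \<open>k\<close> for every \<open>k > 1\<close>.\<close>

lemma limit_le_1: "AE x in L. w x \<le> 1"
proof -
  have le: "AE x in L. w x \<le> k" if k: "k > 1" for k
  proof -
    have "AE x in L. x \<in> \<Omega> \<longrightarrow> 1 * w x \<le> k"
    proof (rule weak_star_limit_bound[OF ws])
      show "\<Omega> \<in> sets L" by simp
      fix A assume A: "A \<in> sets L" "A \<subseteq> \<Omega>"
      have "(\<lambda>j. K * inverse (k ^ s j) * measure L A) \<longlonglongrightarrow> K * 0 * measure L A"
        by (intro tendsto_intros filterlim_compose[OF LIMSEQ_inverse_realpow_zero[OF k] s_at_top])
      then have "(\<lambda>j. K / k ^ s j * measure L A) \<longlonglongrightarrow> 0" by (simp add: divide_inverse)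
      moreover have "1 * (\<integral>x. u (s j) x * indicator A x \<partial>L) \<le> k * measure L A + K / k ^ s j * measure L A" for j
      proof -
        have "(\<integral>x. u (s j) x * indicator A x \<partial>L) \<le> (\<integral>x. (k + K / k ^ s j) * indicator A x \<partial>L)"
        proof (rule integral_mono_AE)
          show "integrable L (\<lambda>x. u (s j) x * indicator A x)"
            by (rule Linf_mult_integrable(1)[OF u_measurable[OF s(2)] u_abs_le[OF s(2)] indicator_integrable[OF A(1)]])
          show "integrable L (\<lambda>x. (k + K / k ^ s j) * indicator A x)"
            using indicator_integrable[OF A(1)] by auto
          show "AE x in L. u (s j) x * indicator A x \<le> (k + K / k ^ s j) * indicator A x"
            using u_upper[OF s(2)[of j], of k] k by (auto elim: eventually_mono simp: indicator_def)
        qed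
        also have "\<dots> = (k + K / k ^ s j) * measure L A"
          using integral_indicator_eq[OF A(1)] by simp
        finally show ?thesis by (simp add: distrib_right)
      qed
      ultimately show "\<exists>e. e \<longlonglongrightarrow> 0 \<and> (\<forall>j. 1 * (\<integral>x. u (s j) x * indicator A x \<partial>L) \<le> k * measure L A + e j)"
        by blast
    qed
    then have "AE x in L. x \<in> \<Omega> \<longrightarrow> w x \<le> k" by simp
    with AE_space[of L] show ?thesis by eventually_elim simp
  qed
  have "AE x in L. \<forall>i. w x \<le> 1 + inverse (real (Suc i))"
    unfolding AE_all_countable using le by simp
  then show ?thesis
  proof eventually_elim
    case (elim x)
    have "(\<lambda>i. 1 + inverse (real (Suc i))) \<longlonglongrightarrow> 1 + 0"
      by (intro tendsto_intros LIMSEQ_inverse_real_of_nat)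
    from LIMSEQ_le_const[OF this] elim show ?case by auto
  qed
qed

text \<open>
  On a ball inside \<open>\<omega>\<close>, where \<open>f \<ge> c\<close>, one has \<open>u n \<ge> 1 - source n / (c n)\<close>; the mass of the source is bounded, so the
  integrals of \<open>u n\<close> over any measurable part are asymptotically at least its measure.
\<close>

lemma limit_eq_1: "AE x in lebesgue_on \<omega>. w x = 1"
proof (rule AE_lebesgue_on_local)
  show oms: "\<omega> \<in> sets lebesgue" using omega_inside(1) by simp
  fix a assume "a \<in> \<omega>"
  then obtain r where r: "r > 0" "cball a r \<subseteq> \<omega>" using omega_inside(1) open_contains_cball by blast
  define B where "B = ball a r"
  have B: "open B" "B \<subseteq> \<omega>" "a \<in> B" "B \<Subset> \<omega>"
    using r omega_inside(1) by (auto simp: B_def compactly_inside_def closure_ball)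
  have BO: "B \<subseteq> \<Omega>" using B(2) omega_inside(4) by blast
  obtain c where c: "c > 0" "AE x in lebesgue_on B. f x \<ge> c" using f_lower[OF B(4)] by blast
  have Bs: "B \<in> sets L" using B(1) BO Om_sets by (simp add: sets_restrict_space_iff)
  have "AE x in lebesgue. x \<in> B \<longrightarrow> f x \<ge> c" using c(2) B(1) by (simp add: AE_lebesgue_on_iff)
  then have fc: "AE x in L. x \<in> B \<longrightarrow> f x \<ge> c"
    unfolding AE_lebesgue_on_iff[OF Om_sets] by eventually_elim auto
  obtain X where X: "\<And>n. n \<ge> 2 \<Longrightarrow> (\<integral>x. source n x \<partial>L) \<le> X" by (rule source_bound) blast
  have "AE x in L. x \<in> B \<longrightarrow> (-1) * w x \<le> -1"
  proof (rule weak_star_limit_bound[OF ws Bs])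
    fix A assume A: "A \<in> sets L" "A \<subseteq> B"
    have "(\<lambda>j. X / c * inverse (real (s j))) \<longlonglongrightarrow> X / c * 0"
      by (intro tendsto_intros filterlim_compose[OF lim_inverse_n s_at_top])
    then have e: "(\<lambda>j. X / c / real (s j)) \<longlonglongrightarrow> 0" by (simp add: divide_inverse)
    have "-1 * (\<integral>x. u (s j) x * indicator A x \<partial>L) \<le> -1 * measure L A + X / c / real (s j)" for j
    proof -
      let ?n = "s j"
      have n: "?n \<ge> 2" by (rule s(2))
      define d where "d = 1 / (c * real ?n)"
      have d: "d > 0" using c(1) n by (simp add: d_def)
      have si: "integrable L (\<lambda>x. d * source ?n x)" by (rule integrable_mult_right[OF source_integrable[OF n]])
      have "measure L A - X / c / real ?n \<le> measure L A - d * (\<integral>x. source ?n x \<partial>L)"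
        using mult_left_mono[OF X[OF n], of d] d by (simp add: d_def)
      also have "\<dots> = (\<integral>x. indicator A x - d * source ?n x \<partial>L)"
        unfolding Bochner_Integration.integral_diff[OF indicator_integrable[OF A(1)] si] integral_indicator_eq[OF A(1)]
        by (simp only: integral_mult_right_zero)
      also have "\<dots> \<le> (\<integral>x. u ?n x * indicator A x \<partial>L)"
      proof (rule integral_mono_AE)
        show "integrable L (\<lambda>x. indicator A x - d * source ?n x)"
          by (rule Bochner_Integration.integrable_diff[OF indicator_integrable[OF A(1)] si])
        show "integrable L (\<lambda>x. u ?n x * indicator A x)"
          by (rule Linf_mult_integrable(1)[OF u_measurable[OF n] u_abs_le[OF n] indicator_integrable[OF A(1)]])
        show "AE x in L. indicator A x - d * source ?n x \<le> u ?n x * indicator A x"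
          using fc u_pos[OF n] source_nonneg[OF n]
        proof eventually_elim
          case (elim x)
          show ?case
          proof (cases "x \<in> A")
            case True
            with A B(2) have x: "x \<in> B" "x \<in> \<omega>" by auto
            have up: "u ?n x > 0" using elim(2) x by simp
            have "1 \<le> f x / c" using elim(1) x c(1) by simp
            then have "1 / u ?n x ^ ?n \<le> (f x / c) / u ?n x ^ ?n" using up by (intro divide_right_mono) auto
            then have "(1 / u ?n x ^ ?n) / real ?n \<le> (f x / c) / u ?n x ^ ?n / real ?n" by (rule divide_right_mono) simp
            also have "\<dots> = d * source ?n x" by (simp add: d_def)
            finally have "(1 / u ?n x ^ ?n) / real ?n \<le> d * source ?n x" .
            moreover have "1 - (1 / u ?n x ^ ?n) / real ?n \<le> u ?n x"
              using n by (intro reciprocal_power_bound[OF up]) simp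
            ultimately have "1 - d * source ?n x \<le> u ?n x" by linarith
            then show ?thesis using True by simp
          next
            case False
            have "0 \<le> d * source ?n x" using elim(3) d by (intro mult_nonneg_nonneg) auto
            then show ?thesis using False by simp
          qed
        qed
      qed
      finally show ?thesis by simp
    qed
    with e show "\<exists>e. e \<longlonglongrightarrow> 0 \<and> (\<forall>k. -1 * (\<integral>x. u (s k) x * indicator A x \<partial>L) \<le> -1 * measure L A + e k)" by blast
  qed
  with limit_le_1 have "AE x in L. x \<in> B \<longrightarrow> w x = 1" by eventually_elim auto
  then have "AE x in lebesgue. x \<in> B \<longrightarrow> w x = 1"
    unfolding AE_lebesgue_on_iff[OF Om_sets] by eventually_elim (use BO in auto)
  then have "AE x in lebesgue_on B. w x = 1" using B(1) by (simp add: AE_lebesgue_on_iff)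
  with B show "\<exists>U. open U \<and> a \<in> U \<and> (AE y in lebesgue_on U. w y = 1)" by blast
qed

text \<open>The transpose moves the matrix to the test function, where the flux becomes a fixed functional of the gradient.\<close>

lemma transpose_flux_L2:
  assumes "\<phi> \<in> C1c \<Omega>"
  shows "(\<lambda>x. transpose (M x) *v grad \<phi> x) \<in> L2 L"
proof -
  have "linear (transpose :: real^'N^'N \<Rightarrow> real^'N^'N)"
    by (rule linearI) (simp_all add: transpose_def vec_eq_iff)
  then have "continuous_on UNIV (transpose :: real^'N^'N \<Rightarrow> real^'N^'N)"
    by (rule linear_continuous_on[OF linear_conv_bounded_linear[THEN iffD1]])
  then have tm: "(\<lambda>x. transpose (M x)) \<in> borel_measurable L"
    by (rule borel_measurable_continuous_on[OF _ M_measurable])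
  have m: "(\<lambda>x. transpose (M x) *v grad \<phi> x) \<in> borel_measurable L"
    by (rule borel_measurable_matrix_vector[OF tm L2_measurable[OF C1c_L2(2)[OF assms]]])
  obtain b where b: "\<And>x. norm (grad \<phi> x) \<le> b" by (rule C1c_bounded[OF assms]) blast
  have "AE x in L. norm (transpose (M x) *v grad \<phi> x) \<le> \<beta> * b"
    using flux_bound
  proof eventually_elim
    case (elim x)
    define \<xi> where "\<xi> = transpose (M x) *v grad \<phi> x"
    have "\<xi> \<bullet> \<xi> = grad \<phi> x \<bullet> (M x *v \<xi>)"
      using dot_lmul_matrix[of "grad \<phi> x" "M x" \<xi>] by (simp add: \<xi>_def)
    also have "\<dots> \<le> norm (grad \<phi> x) * norm (M x *v \<xi>)" by (rule norm_cauchy_schwarz)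
    also have "\<dots> \<le> b * (\<beta> * norm \<xi>)" using elim b beta_pos by (intro mult_mono) (auto intro: order_trans[OF norm_ge_zero])
    finally have "norm \<xi> * norm \<xi> \<le> (\<beta> * b) * norm \<xi>" by (simp add: power2_norm_eq_inner[symmetric] power2_eq_square mult_ac)
    moreover have "\<beta> * b \<ge> 0" using beta_pos b order_trans[OF norm_ge_zero b] by auto
    ultimately have "norm \<xi> \<le> \<beta> * b" by (cases "norm \<xi> = 0") (auto simp: mult_le_cancel_right)
    then show ?case by (simp add: \<xi>_def)
  qed
  then show ?thesis by (rule bounded_measurable_L2[OF m])
qed

text \<open>Every limit of the sources against a test function is the limit of the fluxes, hence the flux of the weak limit of the gradients.\<close>

lemma limit_in_H0:
  obtains g where "(\<lambda>x. (w x, g x)) \<in> H0 \<Omega>"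
    "\<And>\<phi> l. \<phi> \<in> C1c \<Omega> \<Longrightarrow> (\<lambda>k. \<integral>x. source (s k) x * \<phi> x \<partial>L) \<longlonglongrightarrow> l \<Longrightarrow>
      (\<integral>x. (M x *v g x) \<bullet> grad \<phi> x \<partial>L) = l"
proof -
  have wm: "w \<in> borel_measurable L" and "\<exists>C. AE x in L. \<bar>w x\<bar> \<le> C"
    using ws by (auto simp: weak_star_Linf_def Linf_def)
  then obtain C where C: "AE x in L. \<bar>w x\<bar> \<le> C" by blast
  have wL: "w \<in> L2 L" by (rule bounded_measurable_L2[OF wm]) (use C in simp)
  have lim: "(\<lambda>k. \<integral>x. fst (U (s k) x) * \<psi> x \<partial>L) \<longlonglongrightarrow> (\<integral>x. w x * \<psi> x \<partial>L)" if "\<psi> \<in> C1c \<Omega>" for \<psi>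
  proof -
    have "\<psi> \<in> Lp 1 \<Omega>" unfolding Lp_1_iff_integrable by (rule L2_integrable[OF C1c_L2(1)[OF that]])
    then show ?thesis using ws by (simp add: weak_star_Linf_def)
  qed
  have eq: "(transpose (M x) *v \<eta>) \<bullet> \<xi> = (M x *v \<xi>) \<bullet> \<eta>" for x \<eta> \<xi>
    using dot_lmul_matrix[of \<eta> "M x" \<xi>] by (simp add: inner_commute)
  show ?thesis
  proof (rule H0_weak_limit[OF U_H0[OF s(2)] U_energy[OF s(2)] L2_Lp_loc[OF wL] lim])
    fix g assume g: "(\<lambda>x. (w x, g x)) \<in> H0 \<Omega>"
      and l: "\<And>\<Phi> l. \<Phi> \<in> L2 L \<Longrightarrow> (\<lambda>k. \<integral>x. \<Phi> x \<bullet> snd (U (s k) x) \<partial>L) \<longlonglongrightarrow> l \<Longrightarrow> (\<integral>x. \<Phi> x \<bullet> g x \<partial>L) = l"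
    show ?thesis
    proof (rule that[OF g])
      fix \<phi> l' assume \<phi>: "\<phi> \<in> C1c \<Omega>" and l': "(\<lambda>k. \<integral>x. source (s k) x * \<phi> x \<partial>L) \<longlonglongrightarrow> l'"
      have "(\<lambda>k. \<integral>x. (transpose (M x) *v grad \<phi> x) \<bullet> snd (U (s k) x) \<partial>L) \<longlonglongrightarrow> l'"
        using l' by (simp only: eq snd_conv u_equation[OF s(2) \<phi>])
      from l[OF transpose_flux_L2[OF \<phi>] this] show "(\<integral>x. (M x *v g x) \<bullet> grad \<phi> x \<partial>L) = l'"
        by (simp only: eq)
    qed
  qed
qed

text \<open>A function that is constant on an open set has zero weak gradient there: the gradient of a test function has integral zero.\<close>

lemma gradient_zero_inside:
  assumes g: "(\<lambda>x. (w x, g x)) \<in> H0 \<Omega>"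
  shows "AE x in lebesgue_on \<omega>. g x = 0"
proof (rule fundamental_lemma_vector[OF omega_inside(1)])
  have wg: "has_weak_grad \<Omega> w g" using H0_has_weak_grad[OF g] by simp
  then have gl: "g \<in> Lp_loc 1 \<Omega>" by (simp add: has_weak_grad_def)
  show "g \<in> Lp_loc 1 \<omega>" using gl omega_inside(4) by (auto simp: Lp_loc_def)
  fix \<phi> assume \<phi>: "\<phi> \<in> C1c \<omega>"
  have \<phi>O: "\<phi> \<in> C1c \<Omega>" by (rule C1c_mono[OF \<phi> omega_inside(4)])
  obtain Q where Q: "Q \<subseteq> \<omega>" "\<And>x. x \<notin> Q \<Longrightarrow> \<phi> x = 0" "\<And>x. x \<notin> Q \<Longrightarrow> grad \<phi> x = 0"
    by (rule C1c_support[OF \<phi>]) blast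
  then have off: "\<And>x. x \<notin> \<omega> \<Longrightarrow> \<phi> x = 0" "\<And>x. x \<notin> \<omega> \<Longrightarrow> grad \<phi> x = 0" by blast+
  have oms: "\<omega> \<in> sets lebesgue" using omega_inside(1) by simp
  have "(\<integral>x. \<phi> x *\<^sub>R g x \<partial>lebesgue_on \<omega>) = (\<integral>x. \<phi> x *\<^sub>R g x \<partial>L)"
    by (rule integral_lebesgue_on_subset(1)[OF omega_inside(4) oms Om_sets, symmetric]) (simp add: off)
  also have "\<dots> = - (\<integral>x. w x *\<^sub>R grad \<phi> x \<partial>L)"
    using wg \<phi>O by (simp add: has_weak_grad_def)
  also have "(\<integral>x. w x *\<^sub>R grad \<phi> x \<partial>L) = (\<integral>x. grad \<phi> x \<partial>L)"
  proof (rule integral_cong_AE)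
    have gm: "grad \<phi> \<in> borel_measurable L" by (rule continuous_borel_lebesgue_on[OF C1c_continuous_grad[OF \<phi>]])
    show "grad \<phi> \<in> borel_measurable L" by (rule gm)
    show "(\<lambda>x. w x *\<^sub>R grad \<phi> x) \<in> borel_measurable L"
      using gm L2_measurable[OF H0_fst_L2[OF g]] by simp
    have "AE x in lebesgue. x \<in> \<omega> \<longrightarrow> w x = 1" using limit_eq_1 by (simp add: AE_lebesgue_on_iff[OF oms])
    then have "AE x in L. x \<in> \<omega> \<longrightarrow> w x = 1"
      unfolding AE_lebesgue_on_iff[OF Om_sets] by eventually_elim auto
    then show "AE x in L. w x *\<^sub>R grad \<phi> x = grad \<phi> x"
      by eventually_elim (metis off(2) scaleR_one scaleR_zero_right)
  qed
  also have "\<dots> = (\<integral>x. grad \<phi> x \<partial>lborel)"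
    by (rule lebesgue_on_eq_lborel(1)[OF borel_measurable_continuous_onI[OF C1c_continuous_grad[OF \<phi>]] Om_sets])
      (use off omega_inside(4) in blast)
  also have "\<dots> = 0" by (rule C1c_integral_grad_zero[OF \<phi>])
  finally show "(\<integral>x. \<phi> x *\<^sub>R g x \<partial>lebesgue_on \<omega>) = 0" by simp
qed

text \<open>
  Off the frontier every point has a ball on which a bump has zero \<open>\<mu>\<close>-integral: inside \<open>\<omega>\<close> because the limit flux
  vanishes there, outside the closure because the source does. Countably many of these balls cover.
\<close>

lemma limit_measure:
  assumes \<mu>: "weak_star_measure \<Omega> (\<lambda>k. source (s k)) \<mu>"
  shows "emeasure \<mu> (\<Omega> - frontier \<omega>) = 0 \<and> solution_with_measure_datum \<Omega> M \<mu> w"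
proof
  obtain g where g: "(\<lambda>x. (w x, g x)) \<in> H0 \<Omega>" and
    eq: "\<And>\<phi> l. \<phi> \<in> C1c \<Omega> \<Longrightarrow> (\<lambda>k. \<integral>x. source (s k) x * \<phi> x \<partial>L) \<longlonglongrightarrow> l \<Longrightarrow>
      (\<integral>x. (M x *v g x) \<bullet> grad \<phi> x \<partial>L) = l"
    by (rule limit_in_H0) blast
  have sets\<mu>: "sets \<mu> = sets (restrict_space borel \<Omega>)" and fin: "finite_measure \<mu>"
    and lim: "\<And>\<phi>. \<phi> \<in> Cc \<Omega> \<Longrightarrow> (\<lambda>k. \<integral>x. source (s k) x * \<phi> x \<partial>L) \<longlonglongrightarrow> (\<integral>x. \<phi> x \<partial>\<mu>)"
    using \<mu> by (auto simp: weak_star_measure_def)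
  interpret \<mu>: finite_measure \<mu> by (rule fin)
  have eqn: "(\<integral>x. (M x *v g x) \<bullet> grad \<phi> x \<partial>L) = (\<integral>x. \<phi> x \<partial>\<mu>)" if "\<phi> \<in> C1c \<Omega>" for \<phi>
    by (rule eq[OF that lim[OF C1c_Cc[OF that]]])
  have gL: "g \<in> L2 L" using H0_snd_L2[OF g] by simp
  have wH: "w \<in> W1p_0 2 \<Omega>" using H0_imp_W1p_0[OF g] by simp
  have wgL: "weak_grad \<Omega> w \<in> L2 L" using H0_snd_L2[OF W1p_0_imp_H0[OF wH]] by simp
  show "solution_with_measure_datum \<Omega> M \<mu> w"
    unfolding solution_with_measure_datum_def
  proof (intro conjI ballI wH)
    fix \<phi> assume \<phi>: "\<phi> \<in> C1c \<Omega>"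
    have "(\<integral>x. (M x *v weak_grad \<Omega> w x) \<bullet> grad \<phi> x \<partial>L) = (\<integral>x. (M x *v g x) \<bullet> grad \<phi> x \<partial>L)"
    proof (rule integral_cong_AE)
      show "(\<lambda>x. (M x *v weak_grad \<Omega> w x) \<bullet> grad \<phi> x) \<in> borel_measurable L"
        "(\<lambda>x. (M x *v g x) \<bullet> grad \<phi> x) \<in> borel_measurable L"
        by (intro borel_measurable_inner L2_measurable[OF flux_L2[OF gL]] L2_measurable[OF flux_L2[OF wgL]]
            L2_measurable[OF C1c_L2(2)[OF \<phi>]])+
      show "AE x in L. (M x *v weak_grad \<Omega> w x) \<bullet> grad \<phi> x = (M x *v g x) \<bullet> grad \<phi> x"
        using H0_weak_grad_AE[OF g] by eventually_elim simp
    qed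
    with eqn[OF \<phi>] show "(\<integral>x. (M x *v weak_grad \<Omega> w x) \<bullet> grad \<phi> x \<partial>L) = (\<integral>x. \<phi> x \<partial>\<mu>)" by simp
  qed
  have zero_ball: "emeasure \<mu> (ball a r) = 0"
    if r: "r > 0" "cball a r \<subseteq> \<Omega>" and z: "(\<integral>x. bump a r x \<partial>\<mu>) = 0" for a r
  proof -
    have C: "bump a r \<in> C1c \<Omega>" by (rule bump_C1c[OF r])
    obtain b where b: "\<And>x. \<bar>bump a r x\<bar> \<le> b" by (rule C1c_bounded[OF C]) blast
    have bm: "bump a r \<in> borel_measurable \<mu>"
      using borel_measurable_continuous_onI[OF C1c_continuous[OF C]]
      by (simp add: measurable_cong_sets[OF sets\<mu> refl] measurable_restrict_space1)
    have "integrable \<mu> (bump a r)"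
      by (rule \<mu>.integrable_const_bound[of _ b, OF _ bm]) (simp add: b)
    with z have "AE x in \<mu>. bump a r x = 0"
      by (subst (asm) integral_nonneg_eq_0_iff_AE) (auto simp: bump_nonneg)
    then have "AE x in \<mu>. x \<notin> ball a r"
      by eventually_elim (metis bump_pos_iff[OF r(1)] less_irrefl)
    moreover have "ball a r \<in> sets \<mu>"
    proof -
      have "ball a r \<subseteq> \<Omega>" using r(2) ball_subset_cball by blast
      then show ?thesis unfolding sets\<mu> using open_Om by (subst sets_restrict_space_iff) auto
    qed
    ultimately show ?thesis by (simp add: AE_iff_null_sets null_setsD1)
  qed
  define \<B> where "\<B> = {ball a r |a r. r > 0 \<and> cball a r \<subseteq> \<Omega> \<and> emeasure \<mu> (ball a r) = 0}"
  have cover: "\<Omega> - frontier \<omega> \<subseteq> \<Union>\<B>"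
  proof
    fix x assume x: "x \<in> \<Omega> - frontier \<omega>"
    then consider "x \<in> \<omega>" | "x \<in> \<Omega> - closure \<omega>"
      using omega_inside(1) by (auto simp: frontier_def interior_open)
    then have "\<exists>r>0. cball x r \<subseteq> \<Omega> \<and> (\<integral>y. bump x r y \<partial>\<mu>) = 0"
    proof cases
      case 1
      then obtain r where r: "r > 0" "cball x r \<subseteq> \<omega>" using omega_inside(1) open_contains_cball by blast
      have C: "bump x r \<in> C1c \<omega>" by (rule bump_C1c[OF r])
      obtain Q where Q: "Q \<subseteq> \<omega>" "\<And>y. y \<notin> Q \<Longrightarrow> grad (bump x r) y = 0" by (rule C1c_support[OF C]) blast
      have "AE y in lebesgue. y \<in> \<omega> \<longrightarrow> g y = 0"
        using gradient_zero_inside[OF g] omega_inside(1) by (simp add: AE_lebesgue_on_iff)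
      then have "AE y in L. (M y *v g y) \<bullet> grad (bump x r) y = 0"
        unfolding AE_lebesgue_on_iff[OF Om_sets]
      proof eventually_elim
        case (elim y)
        show ?case
        proof (cases "y \<in> \<omega>")
          case True
          then show ?thesis using elim by simp
        next
          case False
          then have "y \<notin> Q" using Q(1) by blast
          then show ?thesis by (simp add: Q(2))
        qed
      qed
      then have "(\<integral>y. (M y *v g y) \<bullet> grad (bump x r) y \<partial>L) = 0" by (rule integral_eq_zero_AE)
      with eqn[OF C1c_mono[OF C omega_inside(4)]] r omega_inside(4) show ?thesis by (intro exI[of _ r]) auto
    next
      case 2
      have "open (\<Omega> - closure \<omega>)" using open_Om by (intro open_Diff) auto
      with 2 obtain r where r: "r > 0" "cball x r \<subseteq> \<Omega> - closure \<omega>" using open_contains_cball by blast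
      then have r': "cball x r \<subseteq> \<Omega>" by blast
      have C: "bump x r \<in> C1c \<Omega>" by (rule bump_C1c[OF r(1) r'])
      have off: "bump x r y = 0" if "y \<in> \<omega>" for y
      proof -
        have "y \<notin> ball x r" using that r(2) closure_subset[of \<omega>] ball_subset_cball[of x r] by blast
        then show ?thesis using bump_pos_iff[OF r(1), of x y] bump_nonneg[of x r y] by simp
      qed
      have "(\<integral>y. source (s k) y * bump x r y \<partial>L) = 0" for k
      proof (rule integral_eq_zero_AE)
        show "AE y in L. source (s k) y * bump x r y = 0"
          using f_off by eventually_elim (use off in auto)
      qed
      with lim[OF C1c_Cc[OF C]] have "(\<integral>y. bump x r y \<partial>\<mu>) = 0" by (simp add: LIMSEQ_const_iff)
      with r(1) r' show ?thesis by blast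
    qed
    then obtain r where r: "r > 0" "cball x r \<subseteq> \<Omega>" "(\<integral>y. bump x r y \<partial>\<mu>) = 0" by blast
    have "ball x r \<in> \<B>" unfolding \<B>_def using zero_ball[OF r] r(1,2) by blast
    with r(1) show "x \<in> \<Union>\<B>" by (metis UnionI centre_in_ball)
  qed
  obtain \<V> where V: "\<V> \<subseteq> \<B>" "countable \<V>" "\<Union>\<V> = \<Union>\<B>"
    using Lindelof[of \<B>] by (auto simp: \<B>_def)
  have "(\<Union>V\<in>\<V>. V) \<in> null_sets \<mu>"
  proof (rule null_sets_UN'[OF V(2)])
    fix V assume "V \<in> \<V>"
    then obtain a r where V': "V = ball a r" "cball a r \<subseteq> \<Omega>" "emeasure \<mu> V = 0" using V(1) unfolding \<B>_def by blast
    have "V \<subseteq> \<Omega>" using V' ball_subset_cball by blast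
    then have "V \<in> sets \<mu>" unfolding sets\<mu> V'(1) using open_Om by (subst sets_restrict_space_iff) auto
    with V'(3) show "V \<in> null_sets \<mu>" by (rule null_setsI)
  qed
  then have "\<Union>\<B> \<in> null_sets \<mu>" using V(3) by simp
  moreover have "\<Omega> - frontier \<omega> \<in> sets \<mu>"
    unfolding sets\<mu> using open_Om by (subst sets_restrict_space_iff) auto
  ultimately have "\<Omega> - frontier \<omega> \<in> null_sets \<mu>" using cover null_sets_subset by blast
  then show "emeasure \<mu> (\<Omega> - frontier \<omega>) = 0" by (rule null_setsD1)
qed

end

end

theorem theorem2p2:
  fixes \<Omega> \<omega> :: "(real^'N) set"
    and M :: "real^'N \<Rightarrow> real^'N^'N"
    and \<alpha> \<beta> :: real
    and f :: "real^'N \<Rightarrow> real"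
    and u :: "nat \<Rightarrow> real^'N \<Rightarrow> real"
  assumes "open \<Omega>" and "bounded \<Omega>"
    and "elliptic_matrix \<Omega> \<alpha> \<beta> M"
    and "f \<in> Linf \<Omega>"
    and "AE x in lebesgue_on \<Omega>. f x \<ge> 0"
    and "\<not> (AE x in lebesgue_on \<Omega>. f x = 0)"
    and "\<omega> \<Subset> \<Omega>"
    and "AE x in lebesgue_on \<Omega>. x \<notin> \<omega> \<longrightarrow> f x = 0"
    and "\<And>\<omega>'. \<omega>' \<Subset> \<omega> \<Longrightarrow> \<exists>c>0. AE x in lebesgue_on \<omega>'. f x \<ge> c"
    and "\<And>n. n \<ge> 2 \<Longrightarrow> monotone_approximation_solution \<Omega> M f (real n) (u n)"
  shows
    "(\<exists>C. \<forall>n\<ge>2. u n \<in> Linf \<Omega> \<and> (AE x in lebesgue_on \<Omega>. \<bar>u n x\<bar> \<le> C)) \<and>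
     (\<exists>s w. strict_mono s \<and> (\<forall>k. s k \<ge> 2) \<and> weak_star_Linf \<Omega> (\<lambda>k. u (s k)) w) \<and>
     (\<exists>C. \<forall>n\<ge>2. integrable (lebesgue_on \<Omega>) (\<lambda>x. f x / u n x ^ n) \<and>
                 (\<integral>x. \<bar>f x / u n x ^ n\<bar> \<partial>lebesgue_on \<Omega>) \<le> C) \<and>
     (\<forall>s w. strict_mono s \<and> (\<forall>k. s k \<ge> 2) \<and> weak_star_Linf \<Omega> (\<lambda>k. u (s k)) w \<longrightarrow>
        (AE x in lebesgue_on \<omega>. w x = 1) \<and>
        (\<exists>r \<mu>. strict_mono r \<and> weak_star_measure \<Omega> (\<lambda>k x. f x / u (s (r k)) x ^ s (r k)) \<mu>) \<and>
        (\<forall>\<mu>. weak_star_measure \<Omega> (\<lambda>k x. f x / u (s k) x ^ s k) \<mu> \<longrightarrow>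
              emeasure \<mu> (\<Omega> - frontier \<omega>) = 0 \<and> solution_with_measure_datum \<Omega> M \<mu> w))"
proof -
  interpret singular_family \<Omega> M \<alpha> \<beta> \<omega> f u
    using assms by unfold_locales
  obtain K E where KE: "K \<ge> 0"
    "\<And>n k. n \<ge> 2 \<Longrightarrow> k \<ge> 1 \<Longrightarrow> AE x in L. u n x \<le> k + K / k ^ n"
    "\<And>n. n \<ge> 2 \<Longrightarrow> AE x in L. 0 \<le> u n x"
    "\<And>n. n \<ge> 2 \<Longrightarrow> U n \<in> H0 \<Omega>"
    "\<And>n. n \<ge> 2 \<Longrightarrow> sqn L (U n) \<le> E"
    by (rule u_uniform_bounds, rule that, assumption+)
  interpret bounded_singular_family \<Omega> M \<alpha> \<beta> \<omega> f u K E
    by unfold_locales (rule KE; assumption?)+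
  obtain X where X: "\<And>n. n \<ge> 2 \<Longrightarrow> (\<integral>x. source n x \<partial>L) \<le> X" by (rule source_bound) blast
  have abs: "(\<integral>x. \<bar>source n x\<bar> \<partial>L) \<le> X" if n: "n \<ge> 2" for n
  proof -
    have "(\<integral>x. \<bar>source n x\<bar> \<partial>L) = (\<integral>x. source n x \<partial>L)"
    proof (rule integral_cong_AE)
      show "(\<lambda>x. \<bar>source n x\<bar>) \<in> borel_measurable L" using source_measurable[OF n] by measurable
      show "source n \<in> borel_measurable L" by (rule source_measurable[OF n])
      show "AE x in L. \<bar>source n x\<bar> = source n x" using source_nonneg[OF n] by eventually_elim (rule abs_of_nonneg)
    qed
    with X[OF n] show ?thesis by simp
  qed
  have sup: "\<exists>C. \<forall>n\<ge>2. u n \<in> Linf \<Omega> \<and> (AE x in L. \<bar>u n x\<bar> \<le> C)"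
    using u_Linf u_abs_le by blast
  have L1: "\<exists>C. \<forall>n\<ge>2. integrable L (source n) \<and> (\<integral>x. \<bar>source n x\<bar> \<partial>L) \<le> C"
    using source_integrable abs by blast
  have lims: "(AE x in lebesgue_on \<omega>. w x = 1) \<and>
      (\<exists>r \<mu>. strict_mono r \<and> weak_star_measure \<Omega> (\<lambda>k. source (s (r k))) \<mu>) \<and>
      (\<forall>\<mu>. weak_star_measure \<Omega> (\<lambda>k. source (s k)) \<mu> \<longrightarrow>
        emeasure \<mu> (\<Omega> - frontier \<omega>) = 0 \<and> solution_with_measure_datum \<Omega> M \<mu> w)"
    if "strict_mono s \<and> (\<forall>k. s k \<ge> 2) \<and> weak_star_Linf \<Omega> (\<lambda>k. u (s k)) w" for s w
  proof -
    from that have s: "strict_mono s" "\<And>k. s k \<ge> 2" and ws: "weak_star_Linf \<Omega> (\<lambda>k. u (s k)) w" by auto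
    show ?thesis
      by (intro conjI allI impI limit_eq_1[OF s ws] ex_limit_measure[OF s(2)]; (drule limit_measure[OF s ws], elim conjE))
  qed
  have "\<forall>s w. strict_mono s \<and> (\<forall>k. s k \<ge> 2) \<and> weak_star_Linf \<Omega> (\<lambda>k. u (s k)) w \<longrightarrow>
      (AE x in lebesgue_on \<omega>. w x = 1) \<and>
      (\<exists>r \<mu>. strict_mono r \<and> weak_star_measure \<Omega> (\<lambda>k. source (s (r k))) \<mu>) \<and>
      (\<forall>\<mu>. weak_star_measure \<Omega> (\<lambda>k. source (s k)) \<mu> \<longrightarrow>
        emeasure \<mu> (\<Omega> - frontier \<omega>) = 0 \<and> solution_with_measure_datum \<Omega> M \<mu> w)"
    by (intro allI impI lims)
  with sup L1 ex_weak_star_subsequence show ?thesis by (intro conjI)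
qed

end
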